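(* Let $R$ be a standard graded $K$-algebra over a field $K$ with maximal homogeneous ideal $\mathfrak m$, let $c\ge1$ be an integer, and set $Z_i=Z_i(\mathfrak m^c,R)$. Then for every $i\in\mathbb N$: (a) $t_0^R(Z_i)\leq ic+\min\{i\operatorname{Rate}(R),\ i+\operatorname{reg}(R)\}$. (b) $H_i(\mathfrak m^c,R)_{ic+j}=0$ for every $j\geq \min\{i\operatorname{Rate}(R),\ i+\operatorname{reg}(R)\}+c$.
   Context: A standard graded $K$-algebra is an $\mathbb N$-graded algebra $R$ with $R_0=K$, finitely generated over $K$ by elements of degree $1$; write $R=S/I$ with $S$ a standard graded polynomial ring over $K$ and $I$ homogeneous. For a finitely generated graded $R$-module $M$, $t_i^R(M)=\max\{j:\operatorname{Tor}_i^R(M,K)_j\neq0\}$ (and $-\infty$ if $\operatorname{Tor}_i^R(M,K)=0$); so $t_0^R(M)$ is the largest degree of a minimal generator. $\operatorname{reg}(M)=\sup\{t_i^S(M)-i:i\in\mathbb N\}$ is the Castelnuovo-Mumford regularity. The Backelin rate is $\operatorname{Rate}(R)=\sup\{(t_i^R(K)-1)/(i-1): i\in\mathbb N,\ i>1\}$; one has $\operatorname{Rate}(R)\ge1$, with equality if and only if $R$ is Koszul (in the degenerate case where $t_i^R(K)=-\infty$ for all $i>1$, $R$ is Koszul and $\operatorname{Rate}(R)$ is read as $1$). $K(\mathfrak m^c,R)$ is the graded Koszul complex associated to a $K$-basis of $R_c$ (the minimal generators of $\mathfrak m^c$), with $K_t(\mathfrak m^c,R)=R\otimes_K\bigwedge^tR_c$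 and basis elements of $\bigwedge^t R_c$ in degree $tc$ (so the differential has degree $0$); $Z_i(\mathfrak m^c,R)$ and $H_i(\mathfrak m^c,R)$ are its $i$-th cycles and homology. *)

theory Defs
  imports Complex_Main "HOL-Library.Poly_Mapping" "HOL-Library.Extended_Real"
begin

section \<open>Standard graded algebras\<close>

text \<open>
  A \<open>K\<close>-algebra structure on a commutative ring is given by the scalar multiplication \<open>scale\<close>;
  \<open>G d\<close> is the homogeneous component of degree \<open>d\<close>.
\<close>

locale standard_graded_algebra = vector_space scale
  for scale :: "'k::field \<Rightarrow> 'r::comm_ring_1 \<Rightarrow> 'r" +
  fixes G :: "nat \<Rightarrow> 'r set"
  assumes scale_mult: "scale a (x * y) = scale a x * y"
    and component_subspace: "subspace (G d)"
    and decomposition: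
      "\<exists>!f. (\<forall>d. f d \<in> G d) \<and> finite {d. f d \<noteq> 0} \<and> x = (\<Sum>d\<in>{d. f d \<noteq> 0}. f d)"
    and component_mult: "x \<in> G d \<Longrightarrow> y \<in> G e \<Longrightarrow> x * y \<in> G (d + e)"
    and component_0: "G 0 = range (\<lambda>a. scale a 1)"
    and generated_in_degree_1:
      "\<exists>X. finite X \<and> X \<subseteq> G 1 \<and>
        (\<forall>A. X \<subseteq> A \<and> 1 \<in> A \<and> subspace A \<and> (\<forall>x\<in>A. \<forall>y\<in>A. x * y \<in> A) \<longrightarrow> A = UNIV)"

text \<open>Scalar multiplication on the free module of finitely supported functions \<open>'b \<Rightarrow>\<^sub>0 'r\<close>.\<close>

definition fscale :: "'r::comm_ring_1 \<Rightarrow> ('b \<Rightarrow>\<^sub>0 'r) \<Rightarrow> ('b \<Rightarrow>\<^sub>0 'r)" where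
  "fscale r = Poly_Mapping.map (\<lambda>s. r * s)"

lemma lookup_fscale [simp]: "Poly_Mapping.lookup (fscale r x) b = r * Poly_Mapping.lookup x b"
  by (simp add: fscale_def Poly_Mapping.map.rep_eq when_def)

lemma module_fscale: "module fscale"
  by standard (auto intro!: poly_mapping_eqI simp: lookup_add algebra_simps)

text \<open>
  The polynomial ring \<open>S = K[x\<^sub>v | v :: 'n]\<close> in finitely many variables is the type
  \<open>('n::finite \<Rightarrow>\<^sub>0 nat) \<Rightarrow>\<^sub>0 'k\<close> (monomial exponents to coefficients), with \<open>fscale\<close> as scalar
  multiplication.
\<close>

definition homogeneous_polys :: "nat \<Rightarrow> (('n::finite \<Rightarrow>\<^sub>0 nat) \<Rightarrow>\<^sub>0 'k::field) set" where
  "homogeneous_polys d =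
    {p. \<forall>m\<in>Poly_Mapping.keys p. (\<Sum>v\<in>UNIV. Poly_Mapping.lookup m v) = d}"

text \<open>
  A presentation \<open>R = S/I\<close> with \<open>I\<close> homogeneous, as a surjective graded \<open>K\<close>-algebra homomorphism
  \<open>S \<rightarrow> R\<close> (with kernel \<open>I\<close>).
\<close>

definition graded_presentation ::
  "('k::field \<Rightarrow> 'r::comm_ring_1 \<Rightarrow> 'r) \<Rightarrow> (nat \<Rightarrow> 'r set) \<Rightarrow>
    ((('n::finite \<Rightarrow>\<^sub>0 nat) \<Rightarrow>\<^sub>0 'k) \<Rightarrow> 'r) \<Rightarrow> bool" where
  "graded_presentation scale G \<phi> \<longleftrightarrow>
     module_hom fscale scale \<phi> \<and> \<phi> 1 = 1 \<and> (\<forall>p q. \<phi> (p * q) = \<phi> p * \<phi> q) \<and>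
     (\<forall>d. \<phi> ` homogeneous_polys d \<subseteq> G d) \<and> surj \<phi>"

definition int_component :: "(nat \<Rightarrow> 'r::zero set) \<Rightarrow> int \<Rightarrow> 'r set" where
  "int_component G j = (if j < 0 then {0} else G (nat j))"

text \<open>The maximal homogeneous ideal, generated by all elements of positive degree.\<close>

definition max_homogeneous_ideal :: "(nat \<Rightarrow> 'r::comm_ring_1 set) \<Rightarrow> 'r set" where
  "max_homogeneous_ideal G = module.span (*) (\<Union>d\<in>{1..}. G d)"


section \<open>Graded modules, graded free resolutions and Tor\<close>

text \<open>
  A \<open>\<int>\<close>-graded module over a graded ring with components \<open>G\<close> is given by a scalar multiplication
  \<open>sc\<close> on an ambient type and its homogeneous components \<open>M j\<close> therein; the module itself is their
  span.
\<close>

definition carrier_of ::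
  "('r::comm_ring_1 \<Rightarrow> 'm::ab_group_add \<Rightarrow> 'm) \<Rightarrow> (int \<Rightarrow> 'm set) \<Rightarrow> 'm set" where
  "carrier_of sc M = module.span sc (\<Union>j. M j)"

definition free_on :: "'b set \<Rightarrow> ('b \<Rightarrow>\<^sub>0 'r::comm_ring_1) set" where
  "free_on B = {x. Poly_Mapping.keys x \<subseteq> B}"

text \<open>Degree \<open>j\<close> component of the free module on \<open>B\<close>, where \<open>b \<in> B\<close> has degree \<open>\<delta> b\<close>.\<close>

definition free_component ::
  "(nat \<Rightarrow> 'r::comm_ring_1 set) \<Rightarrow> 'b set \<Rightarrow> ('b \<Rightarrow> int) \<Rightarrow> int \<Rightarrow> ('b \<Rightarrow>\<^sub>0 'r) set" where
  "free_component G B \<delta> j =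
    {x \<in> free_on B. \<forall>b\<in>B. Poly_Mapping.lookup x b \<in> int_component G (j - \<delta> b)}"

text \<open>
  A graded free resolution \<open>\<dots> \<rightarrow> F\<^sub>2 \<rightarrow> F\<^sub>1 \<rightarrow> F\<^sub>0 \<rightarrow> M \<rightarrow> 0\<close>: \<open>F\<^sub>i\<close> is free on \<open>basis i\<close>, with degrees
  \<open>bdeg i\<close>; \<open>diff i\<close> is the map \<open>F\<^sub>i\<^sub>+\<^sub>1 \<rightarrow> F\<^sub>i\<close> and \<open>aug\<close> the map \<open>F\<^sub>0 \<rightarrow> M\<close>. Over a standard graded
  algebra, finitely generated graded modules have resolutions with countable bases, hence bases of
  natural numbers suffice.
\<close>

record (overloaded) ('r, 'm) free_resolution =
  basis :: "nat \<Rightarrow> nat set"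
  bdeg :: "nat \<Rightarrow> nat \<Rightarrow> int"
  diff :: "nat \<Rightarrow> (nat \<Rightarrow>\<^sub>0 'r) \<Rightarrow> (nat \<Rightarrow>\<^sub>0 'r)"
  aug :: "(nat \<Rightarrow>\<^sub>0 'r) \<Rightarrow> 'm"

definition res_component ::
  "(nat \<Rightarrow> 'r::comm_ring_1 set) \<Rightarrow> ('r, 'm) free_resolution \<Rightarrow> nat \<Rightarrow> int \<Rightarrow> (nat \<Rightarrow>\<^sub>0 'r) set" where
  "res_component G F i = free_component G (basis F i) (bdeg F i)"

definition graded_free_resolution ::
  "(nat \<Rightarrow> 'r::comm_ring_1 set) \<Rightarrow> ('r \<Rightarrow> 'm::ab_group_add \<Rightarrow> 'm) \<Rightarrow> (int \<Rightarrow> 'm set) \<Rightarrow>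
    ('r, 'm) free_resolution \<Rightarrow> bool" where
  "graded_free_resolution G sc M F \<longleftrightarrow>
     module_hom fscale sc (aug F) \<and>
     (\<forall>i. module_hom fscale fscale (diff F i)) \<and>
     (\<forall>j. aug F ` res_component G F 0 j \<subseteq> M j) \<and>
     (\<forall>i j. diff F i ` res_component G F (Suc i) j \<subseteq> res_component G F i j) \<and>
     aug F ` free_on (basis F 0) = carrier_of sc M \<and>
     {x \<in> free_on (basis F 0). aug F x = 0} = diff F 0 ` free_on (basis F 1) \<and>
     (\<forall>i. {x \<in> free_on (basis F (Suc i)). diff F i x = 0}
            = diff F (Suc i) ` free_on (basis F (Suc (Suc i))))"

definition cosets :: "'m::ab_group_add set \<Rightarrow> 'm set \<Rightarrow> 'm set set" where
  "cosets Z B = (\<lambda>z. (\<lambda>b. z + b) ` B) ` Z"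

definition ideal_times_free :: "'r::comm_ring_1 set \<Rightarrow> 'b set \<Rightarrow> ('b \<Rightarrow>\<^sub>0 'r) set" where
  "ideal_times_free I B = {x \<in> free_on B. \<forall>b\<in>B. Poly_Mapping.lookup x b \<in> I}"

text \<open>
  \<open>Tor\<^sub>i(M, K)\<^sub>j\<close> is the degree \<open>j\<close> part of the homology of \<open>F \<otimes> K = F / \<mm>F\<close> for a chosen graded free
  resolution \<open>F\<close> of \<open>M\<close>. Cycles and boundaries of \<open>F / \<mm>F\<close> are represented by their preimages in
  \<open>F\<close>.
\<close>

definition tor_cycles ::
  "(nat \<Rightarrow> 'r::comm_ring_1 set) \<Rightarrow> ('r, 'm) free_resolution \<Rightarrow> nat \<Rightarrow> int \<Rightarrow> (nat \<Rightarrow>\<^sub>0 'r) set" where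
  "tor_cycles G F i j = {z \<in> res_component G F i j.
     case i of 0 \<Rightarrow> True
     | Suc k \<Rightarrow> diff F k z \<in> ideal_times_free (max_homogeneous_ideal G) (basis F k)}"

definition tor_boundaries ::
  "(nat \<Rightarrow> 'r::comm_ring_1 set) \<Rightarrow> ('r, 'm) free_resolution \<Rightarrow> nat \<Rightarrow> int \<Rightarrow> (nat \<Rightarrow>\<^sub>0 'r) set" where
  "tor_boundaries G F i j = {diff F i y + w | y w.
     y \<in> res_component G F (Suc i) j \<and>
     w \<in> res_component G F i j \<inter> ideal_times_free (max_homogeneous_ideal G) (basis F i)}"

definition tor ::
  "(nat \<Rightarrow> 'r::comm_ring_1 set) \<Rightarrow> ('r \<Rightarrow> 'm::ab_group_add \<Rightarrow> 'm) \<Rightarrow> (int \<Rightarrow> 'm set) \<Rightarrow>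
    nat \<Rightarrow> int \<Rightarrow> (nat \<Rightarrow>\<^sub>0 'r) set set" where
  "tor G sc M i j = (let F = (SOME F. graded_free_resolution G sc M F)
     in cosets (tor_cycles G F i j) (tor_boundaries G F i j))"

text \<open>
  \<open>t\<^sub>i(M)\<close>. A quotient group vanishes iff it is a singleton; \<open>Sup {} = - \<infinity>\<close> in \<open>ereal\<close>.
\<close>

definition t_top ::
  "(nat \<Rightarrow> 'r::comm_ring_1 set) \<Rightarrow> ('r \<Rightarrow> 'm::ab_group_add \<Rightarrow> 'm) \<Rightarrow> (int \<Rightarrow> 'm set) \<Rightarrow>
    nat \<Rightarrow> ereal" where
  "t_top G sc M i = Sup ((\<lambda>j. ereal (of_int j)) ` {j. \<not> is_singleton (tor G sc M i j)})"


section \<open>Castelnuovo-Mumford regularity and Backelin rate\<close>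

text \<open>
  \<open>reg(R)\<close>, where \<open>R\<close> is a module over the polynomial ring \<open>S\<close> through the presentation
  \<open>\<phi> : S \<rightarrow> R\<close>.
\<close>

definition cm_regularity ::
  "(nat \<Rightarrow> 'r::comm_ring_1 set) \<Rightarrow> ((('n::finite \<Rightarrow>\<^sub>0 nat) \<Rightarrow>\<^sub>0 'k::field) \<Rightarrow> 'r) \<Rightarrow> ereal" where
  "cm_regularity G \<phi> =
    (SUP i. t_top homogeneous_polys (\<lambda>p x. \<phi> p * x) (int_component G) i - ereal (real i))"

text \<open>
  \<open>K = R/\<mm>\<close> as an \<open>R\<close>-module concentrated in degree \<open>0\<close>: \<open>r\<close> acts as the scalar \<open>a\<close> with
  \<open>r - a \<sqdot> 1 \<in> \<mm>\<close>.
\<close>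

definition residue ::
  "('k::field \<Rightarrow> 'r::comm_ring_1 \<Rightarrow> 'r) \<Rightarrow> (nat \<Rightarrow> 'r set) \<Rightarrow> 'r \<Rightarrow> 'k" where
  "residue scale G r = (THE a. r - scale a 1 \<in> max_homogeneous_ideal G)"

definition t_residue_field ::
  "('k::field \<Rightarrow> 'r::comm_ring_1 \<Rightarrow> 'r) \<Rightarrow> (nat \<Rightarrow> 'r set) \<Rightarrow> nat \<Rightarrow> ereal" where
  "t_residue_field scale G =
    t_top G (\<lambda>r a. residue scale G r * a) (\<lambda>j. if j = 0 then UNIV else {0})"

definition backelin_rate ::
  "('k::field \<Rightarrow> 'r::comm_ring_1 \<Rightarrow> 'r) \<Rightarrow> (nat \<Rightarrow> 'r set) \<Rightarrow> ereal" where
  "backelin_rate scale G =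
    (if \<forall>i>1. t_residue_field scale G i = - \<infinity> then 1
     else (SUP i\<in>{1<..}. (t_residue_field scale G i - 1) / ereal (real i - 1)))"


section \<open>The Koszul complex of a power of the maximal ideal\<close>

text \<open>
  \<open>bs\<close> lists a \<open>K\<close>-basis \<open>v\<^sub>0, \<dots>, v\<^sub>n\<^sub>-\<^sub>1\<close> of \<open>R\<^sub>c\<close>. The basis element
  \<open>v\<^bsub>a\<^sub>1\<^esub> \<and> \<dots> \<and> v\<^bsub>a\<^sub>t\<^esub>\<close>, \<open>a\<^sub>1 < \<dots> < a\<^sub>t\<close>, of \<open>\<And>\<^sup>tR\<^sub>c\<close> is encoded by the index set
  \<open>{a\<^sub>1, \<dots>, a\<^sub>t}\<close>, so \<open>R \<otimes> \<And>\<^sup>tR\<^sub>c\<close> consists of finitely supported functions on such sets.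
\<close>

definition is_basis_list ::
  "('k::field \<Rightarrow> 'r::comm_ring_1 \<Rightarrow> 'r) \<Rightarrow> 'r set \<Rightarrow> 'r list \<Rightarrow> bool" where
  "is_basis_list scale V bs \<longleftrightarrow>
    distinct bs \<and> \<not> module.dependent scale (set bs) \<and> module.span scale (set bs) = V"

definition koszul_component ::
  "(nat \<Rightarrow> 'r::comm_ring_1 set) \<Rightarrow> nat \<Rightarrow> 'r list \<Rightarrow> nat \<Rightarrow> int \<Rightarrow> (nat set \<Rightarrow>\<^sub>0 'r) set" where
  "koszul_component G c bs t =
    free_component G {A. A \<subseteq> {..<length bs} \<and> card A = t} (\<lambda>_. int (t * c))"

definition koszul_diff :: "'r::comm_ring_1 list \<Rightarrow> (nat set \<Rightarrow>\<^sub>0 'r) \<Rightarrow> (nat set \<Rightarrow>\<^sub>0 'r)" where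
  "koszul_diff bs x = (\<Sum>A\<in>Poly_Mapping.keys x. \<Sum>a\<in>A.
     Poly_Mapping.single (A - {a})
       ((- 1) ^ card {b \<in> A. b < a} * (bs ! a) * Poly_Mapping.lookup x A))"

definition koszul_cycles ::
  "(nat \<Rightarrow> 'r::comm_ring_1 set) \<Rightarrow> nat \<Rightarrow> 'r list \<Rightarrow> nat \<Rightarrow> int \<Rightarrow> (nat set \<Rightarrow>\<^sub>0 'r) set" where
  "koszul_cycles G c bs i d = {x \<in> koszul_component G c bs i d. koszul_diff bs x = 0}"

definition koszul_boundaries ::
  "(nat \<Rightarrow> 'r::comm_ring_1 set) \<Rightarrow> nat \<Rightarrow> 'r list \<Rightarrow> nat \<Rightarrow> int \<Rightarrow> (nat set \<Rightarrow>\<^sub>0 'r) set" where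
  "koszul_boundaries G c bs i d = koszul_diff bs ` koszul_component G c bs (Suc i) d"

definition koszul_homology ::
  "(nat \<Rightarrow> 'r::comm_ring_1 set) \<Rightarrow> nat \<Rightarrow> 'r list \<Rightarrow> nat \<Rightarrow> int \<Rightarrow> (nat set \<Rightarrow>\<^sub>0 'r) set set" where
  "koszul_homology G c bs i d = cosets (koszul_cycles G c bs i d) (koszul_boundaries G c bs i d)"

end

theory Submission
  imports Defs
begin

text \<open>
  Fix a standard graded algebra \<open>A\<close> and a graded free resolution \<open>P\<close> of its residue field
  \<open>K\<close>. For a graded \<open>A\<close>-module \<open>M\<close> the homology of \<open>M \<otimes> P\<close> is \<open>Tor(M, K)\<close>. As \<open>P\<close> is free,
  tensoring with \<open>P\<close> preserves exact sequences, so long exact sequences are diagram chases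
  with elements, and a module enters only through its graded pieces. Quotients are never
  formed: a pair of families \<open>N d \<subseteq> M d\<close> in one ambient group stands for \<open>M/N\<close>, and
  \<open>tor_vanishes sc M N j d\<close> says that \<open>Tor\<^sub>j(M/N, K)\<close> is zero in degree \<open>d\<close>.

  Let \<open>Z\<^sub>t\<close>, \<open>B\<^sub>t\<close>, \<open>H\<^sub>t\<close> be the cycles, boundaries and homology of the Koszul complex \<open>K\<^sub>\<bullet>\<close>
  of \<open>\<mm>\<^sup>c\<close> over \<open>R\<close>. From \<open>0 \<rightarrow> Z\<^sub>t\<^sub>+\<^sub>1 \<rightarrow> K\<^sub>t\<^sub>+\<^sub>1 \<rightarrow> B\<^sub>t \<rightarrow> 0\<close> and \<open>0 \<rightarrow> B\<^sub>t \<rightarrow> Z\<^sub>t \<rightarrow> H\<^sub>t \<rightarrow> 0\<close>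
  one gets \<open>t\<^sub>j(Z\<^sub>t\<^sub>+\<^sub>1) \<le> max (t\<^sub>j(K\<^sub>t\<^sub>+\<^sub>1)) (max (t\<^sub>j\<^sub>+\<^sub>1(Z\<^sub>t)) (t\<^sub>j\<^sub>+\<^sub>2(H\<^sub>t)))\<close>. Since
  \<open>\<mm>\<^sup>c\<close> annihilates \<open>H\<^sub>t\<close>, this module lives in degrees below \<open>t\<^sub>0(Z\<^sub>t) + c\<close>; it is built
  from copies of \<open>K\<close> shifted by those degrees, so \<open>t\<^sub>j\<^sub>+\<^sub>2(H\<^sub>t) \<le> t\<^sub>0(Z\<^sub>t) + c - 1 +
  t\<^sub>j\<^sub>+\<^sub>2(K)\<close>. Hence, if \<open>t\<^sub>j(R) \<le> \<rho> + j r\<close> for all \<open>j\<close> and \<open>t\<^sub>j(K) \<le> 1 + (j - 1) r\<close> for \<open>j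
  \<ge> 2\<close>, with \<open>r \<ge> 0\<close>, induction on \<open>t\<close> yields \<open>t\<^sub>j(Z\<^sub>t) \<le> \<rho> + t c + (t + j) r\<close>; this is
  \<open>koszul_cycles_tor\<close>. Here \<open>R\<close> is an algebra over \<open>A\<close>, and the case \<open>j = 0\<close> bounds the
  degrees of the generators of \<open>Z\<^sub>t\<close> over \<open>A\<close>, hence over \<open>R\<close>.

  There are two instances. For \<open>A = R\<close> take \<open>\<rho> = 0\<close> and \<open>r = Rate(R)\<close>; the ring itself has
  no higher \<open>Tor\<close>. For the polynomial ring \<open>A = S\<close> take \<open>\<rho> = reg(R)\<close> and \<open>r = 1\<close>, because
  \<open>S\<close> is Koszul (\<open>polynomial_ring_koszul\<close>). The vanishing of homology follows from the bound
  on generators, again because \<open>\<mm>\<^sup>c\<close> annihilates the homology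
  (\<open>homology_vanishes_high_degree\<close>).

  The invariants \<open>t_top\<close> are computed from an unspecified graded free resolution \<open>F\<close> of the
  module. Such resolutions exist by \<open>resolution_exists\<close>. For \<open>K\<close> over \<open>R\<close> one chooses \<open>P =
  F\<close>, and \<open>F \<otimes> K\<close> is \<open>K \<otimes> P\<close>. For \<open>R\<close> over \<open>S\<close> the resolutions \<open>F\<close> and \<open>P\<close> differ, and \<open>Tor\<close>
  has to be balanced: \<open>tor_vanishes_balance\<close> does this by shifting dimensions along \<open>F\<close>.
\<close>

abbreviation "lookup \<equiv> Poly_Mapping.lookup"
abbreviation "keys \<equiv> Poly_Mapping.keys"
abbreviation "single \<equiv> Poly_Mapping.single"

section \<open>Finitely supported functions\<close>

lemma lookup_map_zero: "f 0 = 0 \<Longrightarrow> lookup (Poly_Mapping.map f x) b = f (lookup x b)"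
  by (simp add: Poly_Mapping.map.rep_eq when_def)

lemma lookup_sum_single:
  assumes "finite S"
  shows "lookup (\<Sum>b\<in>S. single b (f b)) b' = (if b' \<in> S then f b' else 0)"
  using assms by (simp add: lookup_sum lookup_single when_def sum.delta)

lemma poly_mapping_sum_singles: "x = (\<Sum>b\<in>keys x. single b (lookup x b))"
  by (rule poly_mapping_eqI) (simp add: lookup_sum_single in_keys_iff)

text \<open>
  Choosing a value at every key separately gives a function that is again finitely
  supported.
\<close>

lemma poly_mapping_choice:
  fixes z :: "'b \<Rightarrow>\<^sub>0 'm::zero" and P :: "'b \<Rightarrow> 'n::comm_monoid_add \<Rightarrow> bool"
  assumes "\<And>b. b \<in> keys z \<Longrightarrow> \<exists>v. P b v"
  shows "\<exists>y. (\<forall>b\<in>keys z. P b (lookup y b)) \<and> (\<forall>b. b \<notin> keys z \<longrightarrow> lookup y b = 0)"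
proof -
  obtain f where f: "\<And>b. b \<in> keys z \<Longrightarrow> P b (f b)"
    using assms by metis
  show ?thesis
    by (rule exI[of _ "\<Sum>b\<in>keys z. single b (f b)"]) (simp add: lookup_sum_single f)
qed

lemma poly_mapping_induct_single [case_names zero add]:
  fixes y :: "'b \<Rightarrow>\<^sub>0 'm::comm_monoid_add"
  assumes zero: "P 0"
    and add: "\<And>b r x. b \<in> keys y \<Longrightarrow> r = lookup y b \<Longrightarrow> P x \<Longrightarrow> P (single b r + x)"
  shows "P y"
proof -
  have "P (\<Sum>b\<in>S. single b (lookup y b))" if "S \<subseteq> keys y" for S
    using finite_subset[OF that finite_keys] that
    by (induction S rule: finite_induct) (auto intro!: assms)
  from this[of "keys y"] show ?thesis
    using poly_mapping_sum_singles[of y] by simp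
qed

section \<open>Graded families\<close>

text \<open>
  Only the pieces of a graded module are recorded. Their sum need not be direct;
  independence is required separately, where single degrees have to be split off.
\<close>

definition graded_family ::
  "(nat \<Rightarrow> 'r::comm_ring_1 set) \<Rightarrow> ('r \<Rightarrow> 'm::ab_group_add \<Rightarrow> 'm) \<Rightarrow> (int \<Rightarrow> 'm set) \<Rightarrow> bool" where
  "graded_family G sc M \<longleftrightarrow>
     (\<forall>d. 0 \<in> M d \<and> (\<forall>x\<in>M d. \<forall>y\<in>M d. x - y \<in> M d)) \<and>
     (\<forall>n d. \<forall>r\<in>G n. \<forall>x\<in>M d. sc r x \<in> M (int n + d))"

lemma graded_familyI:
  assumes "\<And>d. 0 \<in> M d" "\<And>d x y. x \<in> M d \<Longrightarrow> y \<in> M d \<Longrightarrow> x - y \<in> M d"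
    "\<And>n d r x. r \<in> G n \<Longrightarrow> x \<in> M d \<Longrightarrow> sc r x \<in> M (int n + d)"
  shows "graded_family G sc M"
  using assms by (auto simp: graded_family_def)

lemma graded_family_zero [simp]: "graded_family G sc M \<Longrightarrow> 0 \<in> M d"
  by (simp add: graded_family_def)

lemma graded_family_diff: "graded_family G sc M \<Longrightarrow> x \<in> M d \<Longrightarrow> y \<in> M d \<Longrightarrow> x - y \<in> M d"
  by (simp add: graded_family_def)

lemma graded_family_uminus: "graded_family G sc M \<Longrightarrow> x \<in> M d \<Longrightarrow> - x \<in> M d"
  using graded_family_diff[of G sc M 0 d x] by simp

lemma graded_family_add: "graded_family G sc M \<Longrightarrow> x \<in> M d \<Longrightarrow> y \<in> M d \<Longrightarrow> x + y \<in> M d"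
  using graded_family_diff[of G sc M x d "- y"] graded_family_uminus[of G sc M y d] by simp

lemma graded_family_sum:
  "graded_family G sc M \<Longrightarrow> (\<And>a. a \<in> S \<Longrightarrow> f a \<in> M d) \<Longrightarrow> sum f S \<in> M d"
  by (induction S rule: infinite_finite_induct) (auto intro: graded_family_add)

lemma graded_family_scale:
  "graded_family G sc M \<Longrightarrow> r \<in> G n \<Longrightarrow> x \<in> M d \<Longrightarrow> sc r x \<in> M (int n + d)"
  by (simp add: graded_family_def)

lemma graded_family_scale_int:
  assumes "module sc" "graded_family G sc M" "r \<in> int_component G e" "x \<in> M d"
  shows "sc r x \<in> M (e + d)"
proof (cases "e < 0")
  case True
  then show ?thesis
    using assms by (simp add: int_component_def module.scale_zero_left)
next
  case False
  then show ?thesis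
    using graded_family_scale[OF assms(2), of r "nat e" x d] assms by (simp add: int_component_def)
qed

lemma graded_family_trivial: "module sc \<Longrightarrow> graded_family G sc (\<lambda>d. {0})"
  by (auto simp: graded_family_def module.scale_zero_right)

section \<open>Tensoring a complex of free modules with a module\<close>

text \<open>
  The degree \<open>d\<close> part of \<open>M \<otimes> F\<close> for a free module \<open>F\<close> with basis \<open>B\<close> in degrees \<open>\<delta>\<close>,
  written as the functions that assign a coefficient in \<open>M\<close> to each basis element. For \<open>M\<close>
  the ring itself this is the degree \<open>d\<close> part of \<open>F\<close>.
\<close>

definition tensor_part :: "'b set \<Rightarrow> ('b \<Rightarrow> int) \<Rightarrow> (int \<Rightarrow> 'm::zero set) \<Rightarrow> int \<Rightarrow> ('b \<Rightarrow>\<^sub>0 'm) set" where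
  "tensor_part B \<delta> M d = {x. (\<forall>b\<in>B. lookup x b \<in> M (d - \<delta> b)) \<and> (\<forall>b. b \<notin> B \<longrightarrow> lookup x b = 0)}"

text \<open>
  \<open>M \<otimes> f\<close> for the map \<open>f\<close> of free modules with columns \<open>g b\<close>; the entries of the matrix act
  on \<open>M\<close>.
\<close>

definition tensor_map ::
  "('r::zero \<Rightarrow> 'm::comm_monoid_add \<Rightarrow> 'm) \<Rightarrow> ('b \<Rightarrow> ('c \<Rightarrow>\<^sub>0 'r)) \<Rightarrow> ('b \<Rightarrow>\<^sub>0 'm) \<Rightarrow> ('c \<Rightarrow>\<^sub>0 'm)" where
  "tensor_map sc g x = (\<Sum>b\<in>keys x. Poly_Mapping.map (\<lambda>r. sc r (lookup x b)) (g b))"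

lemma tensor_partI:
  "(\<And>b. b \<in> B \<Longrightarrow> lookup x b \<in> M (d - \<delta> b)) \<Longrightarrow> (\<And>b. b \<notin> B \<Longrightarrow> lookup x b = 0) \<Longrightarrow> x \<in> tensor_part B \<delta> M d"
  by (auto simp: tensor_part_def)

lemma tensor_partD:
  assumes "x \<in> tensor_part B \<delta> M d"
  shows "b \<in> B \<Longrightarrow> lookup x b \<in> M (d - \<delta> b)" "b \<notin> B \<Longrightarrow> lookup x b = 0" "keys x \<subseteq> B"
  using assms by (auto simp: tensor_part_def in_keys_iff)

lemma tensor_part_mono:
  "x \<in> tensor_part B \<delta> M d \<Longrightarrow> (\<And>e. M e \<subseteq> N e) \<Longrightarrow> x \<in> tensor_part B \<delta> N d"
  by (auto simp: tensor_part_def)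

lemma lookup_tensor_map:
  assumes "module sc" "finite S" "keys x \<subseteq> S"
  shows "lookup (tensor_map sc g x) c = (\<Sum>b\<in>S. sc (lookup (g b) c) (lookup x b))"
proof -
  interpret module sc by fact
  have "lookup (tensor_map sc g x) c = (\<Sum>b\<in>keys x. sc (lookup (g b) c) (lookup x b))"
    by (simp add: tensor_map_def lookup_sum lookup_map_zero)
  also have "\<dots> = (\<Sum>b\<in>S. sc (lookup (g b) c) (lookup x b))"
    by (rule sum.mono_neutral_left) (use assms in \<open>auto simp: in_keys_iff\<close>)
  finally show ?thesis .
qed

lemma tensor_map_add:
  assumes "module sc"
  shows "tensor_map sc g (x + y) = tensor_map sc g x + tensor_map sc g y"
proof (rule poly_mapping_eqI)
  fix c
  interpret module sc by fact
  let ?S = "keys x \<union> keys y"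
  have "keys (x + y) \<subseteq> ?S" by (rule Poly_Mapping.keys_add)
  then show "lookup (tensor_map sc g (x + y)) c = lookup (tensor_map sc g x + tensor_map sc g y) c"
    using assms by (simp add: lookup_tensor_map[of sc ?S] lookup_add scale_right_distrib sum.distrib)
qed

lemma tensor_map_zero [simp]: "tensor_map sc g 0 = 0"
  by (simp add: tensor_map_def)

lemma tensor_map_uminus:
  assumes "module sc"
  shows "tensor_map sc g (- x) = - tensor_map sc g x"
  using tensor_map_add[OF assms, of g x "- x"] by (simp add: eq_neg_iff_add_eq_0 add.commute)

lemma tensor_map_diff:
  assumes "module sc"
  shows "tensor_map sc g (x - y) = tensor_map sc g x - tensor_map sc g y"
  using tensor_map_add[OF assms, of g x "- y"] by (simp add: tensor_map_uminus assms)

lemma tensor_map_map: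
  assumes "module sc" "module sc'" "\<And>x y. f (x + y) = f x + f y" "\<And>r x. f (sc r x) = sc' r (f x)"
  shows "tensor_map sc' g (Poly_Mapping.map f x) = Poly_Mapping.map f (tensor_map sc g x)"
proof (rule poly_mapping_eqI)
  fix c
  have f0: "f 0 = 0" using assms(3)[of 0 0] by simp
  have fs: "f (sum h S) = (\<Sum>a\<in>S. f (h a))" for h S
    by (induction S rule: infinite_finite_induct) (auto simp: f0 assms)
  have "keys (Poly_Mapping.map f x) \<subseteq> keys x"
    by (auto simp: in_keys_iff lookup_map_zero f0)
  then show "lookup (tensor_map sc' g (Poly_Mapping.map f x)) c = lookup (Poly_Mapping.map f (tensor_map sc g x)) c"
    by (simp add: lookup_tensor_map[of _ "keys x"] assms lookup_map_zero f0 fs)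
qed

lemma module_ring_mult: "module ((*) :: 'r::comm_ring_1 \<Rightarrow> 'r \<Rightarrow> 'r)"
  by standard (auto simp: algebra_simps)

text \<open>
  The product of two matrices is the matrix of the composition. A complex of free modules
  therefore stays a complex after tensoring.
\<close>

lemma tensor_map_compose:
  assumes "module sc"
  shows "tensor_map sc g (tensor_map sc h x) = tensor_map sc (\<lambda>b. tensor_map (*) g (h b)) x"
proof (rule poly_mapping_eqI)
  fix c
  interpret module sc by fact
  let ?S = "(\<Union>b\<in>keys x. keys (h b))"
  have fin: "finite ?S" by simp
  have k: "keys (tensor_map sc h x) \<subseteq> ?S"
  proof
    fix a assume "a \<in> keys (tensor_map sc h x)"
    then have "(\<Sum>b\<in>keys x. sc (lookup (h b) a) (lookup x b)) \<noteq> 0"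
      by (simp add: in_keys_iff lookup_tensor_map[OF assms finite_keys order_refl])
    then obtain b where "b \<in> keys x" "sc (lookup (h b) a) (lookup x b) \<noteq> 0"
      by (meson sum.neutral)
    then show "a \<in> ?S" by (auto simp: in_keys_iff intro!: bexI[of _ b])
  qed
  have "lookup (tensor_map sc g (tensor_map sc h x)) c
      = (\<Sum>a\<in>?S. \<Sum>b\<in>keys x. sc (lookup (g a) c * lookup (h b) a) (lookup x b))"
    by (subst lookup_tensor_map[OF assms fin k])
       (simp add: lookup_tensor_map[OF assms finite_keys order_refl] scale_sum_right)
  also have "\<dots> = (\<Sum>b\<in>keys x. \<Sum>a\<in>?S. sc (lookup (g a) c * lookup (h b) a) (lookup x b))"
    by (rule sum.swap)
  also have "\<dots> = (\<Sum>b\<in>keys x. sc (lookup (tensor_map (*) g (h b)) c) (lookup x b))"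
  proof (rule sum.cong[OF refl])
    fix b assume "b \<in> keys x"
    then have "keys (h b) \<subseteq> ?S" by auto
    then show "(\<Sum>a\<in>?S. sc (lookup (g a) c * lookup (h b) a) (lookup x b))
        = sc (lookup (tensor_map (*) g (h b)) c) (lookup x b)"
      by (simp add: lookup_tensor_map[OF module_ring_mult fin] scale_sum_left)
  qed
  finally show "lookup (tensor_map sc g (tensor_map sc h x)) c = lookup (tensor_map sc (\<lambda>b. tensor_map (*) g (h b)) x) c"
    by (simp add: lookup_tensor_map[OF assms finite_keys order_refl])
qed

lemma tensor_part_zero: "graded_family G sc M \<Longrightarrow> 0 \<in> tensor_part B \<delta> M d"
  by (simp add: tensor_part_def)

lemma tensor_part_diff:
  "graded_family G sc M \<Longrightarrow> x \<in> tensor_part B \<delta> M d \<Longrightarrow> y \<in> tensor_part B \<delta> M d \<Longrightarrow> x - y \<in> tensor_part B \<delta> M d"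
  by (auto simp: tensor_part_def lookup_minus graded_family_diff)

lemma tensor_part_add:
  "graded_family G sc M \<Longrightarrow> x \<in> tensor_part B \<delta> M d \<Longrightarrow> y \<in> tensor_part B \<delta> M d \<Longrightarrow> x + y \<in> tensor_part B \<delta> M d"
  by (auto simp: tensor_part_def lookup_add graded_family_add)

lemma tensor_map_in_tensor_part:
  assumes "module sc" "graded_family G sc M" "x \<in> tensor_part B \<delta> M d"
    and g: "\<And>b. b \<in> B \<Longrightarrow> g b \<in> tensor_part C \<gamma> (int_component G) (\<delta> b)"
  shows "tensor_map sc g x \<in> tensor_part C \<gamma> M d"
proof (rule tensor_partI)
  interpret module sc by fact
  note l = lookup_tensor_map[OF assms(1) finite_keys order_refl]
  fix c
  { assume c: "c \<in> C"
    have "sc (lookup (g b) c) (lookup x b) \<in> M (d - \<gamma> c)" if "b \<in> keys x" for b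
    proof -
      have b: "b \<in> B" using that tensor_partD(3)[OF assms(3)] by auto
      have "sc (lookup (g b) c) (lookup x b) \<in> M ((\<delta> b - \<gamma> c) + (d - \<delta> b))"
        by (rule graded_family_scale_int[OF assms(1,2) tensor_partD(1)[OF g[OF b] c] tensor_partD(1)[OF assms(3) b]])
      then show ?thesis by simp
    qed
    then show "lookup (tensor_map sc g x) c \<in> M (d - \<gamma> c)"
      unfolding l by (rule graded_family_sum[OF assms(2)]) }
  { assume c: "c \<notin> C"
    show "lookup (tensor_map sc g x) c = 0"
      unfolding l
    proof (rule sum.neutral, rule ballI)
      fix b assume "b \<in> keys x"
      then have "b \<in> B" using tensor_partD(3)[OF assms(3)] by auto
      then show "sc (lookup (g b) c) (lookup x b) = 0"
        using tensor_partD(2)[OF g c] by simp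
    qed }
qed

section \<open>Graded pieces of Tor against the residue field\<close>

text \<open>
  The pieces of the maximal homogeneous ideal.
\<close>

definition positive_part :: "(nat \<Rightarrow> 'r::zero set) \<Rightarrow> int \<Rightarrow> 'r set" where
  "positive_part G d = (if d \<le> 0 then {0} else G (nat d))"

text \<open>
  The degree \<open>d\<close> part of \<open>\<mm>M\<close>.
\<close>

inductive_set positive_multiples ::
  "(nat \<Rightarrow> 'r set) \<Rightarrow> ('r \<Rightarrow> 'm::ab_group_add \<Rightarrow> 'm) \<Rightarrow> (int \<Rightarrow> 'm set) \<Rightarrow> int \<Rightarrow> 'm set"
  for G sc M d where
  zero: "0 \<in> positive_multiples G sc M d"
| add: "r \<in> G n \<Longrightarrow> n \<ge> 1 \<Longrightarrow> x \<in> M (d - int n) \<Longrightarrow> y \<in> positive_multiples G sc M d \<Longrightarrow>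
    sc r x + y \<in> positive_multiples G sc M d"

lemma positive_multiples_closed_add:
  "x \<in> positive_multiples G sc M d \<Longrightarrow> y \<in> positive_multiples G sc M d \<Longrightarrow> x + y \<in> positive_multiples G sc M d"
  by (induction rule: positive_multiples.induct) (auto simp: add.assoc intro: positive_multiples.intros)

lemma positive_multiples_single:
  "r \<in> G n \<Longrightarrow> n \<ge> 1 \<Longrightarrow> x \<in> M (d - int n) \<Longrightarrow> sc r x \<in> positive_multiples G sc M d"
  using positive_multiples.add[OF _ _ _ positive_multiples.zero, of r G n x M d sc] by simp

lemma positive_multiples_closed_sum:
  "(\<And>a. a \<in> S \<Longrightarrow> f a \<in> positive_multiples G sc M d) \<Longrightarrow> sum f S \<in> positive_multiples G sc M d"
  by (induction S rule: infinite_finite_induct)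
    (auto intro: positive_multiples_closed_add positive_multiples.zero)

context standard_graded_algebra
begin

lemma component_zero [simp]: "0 \<in> G d"
  using component_subspace subspace_0 by blast

lemma component_diff: "x \<in> G d \<Longrightarrow> y \<in> G d \<Longrightarrow> x - y \<in> G d"
  using component_subspace subspace_diff by blast

lemma scale_eq_mult: "scale a x = scale a 1 * x"
  using scale_mult[of a 1 x] by simp

lemma component_int_mult:
  "r \<in> G n \<Longrightarrow> x \<in> int_component G d \<Longrightarrow> r * x \<in> int_component G (int n + d)"
proof (cases "d < 0")
  case False
  then show "r \<in> G n \<Longrightarrow> x \<in> int_component G d \<Longrightarrow> r * x \<in> int_component G (int n + d)"
    using component_mult[of r n x "nat d"] by (auto simp: int_component_def nat_add_distrib)
qed (auto simp: int_component_def)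

lemma graded_family_ring: "graded_family G (*) (int_component G)"
  by (rule graded_familyI) (auto simp: component_int_mult, auto simp: int_component_def component_diff)

lemma graded_family_positive_part: "graded_family G (*) (positive_part G)"
proof (rule graded_familyI)
  fix n d r x assume "r \<in> G n" "x \<in> positive_part G d"
  then show "r * x \<in> positive_part G (int n + d)"
    using component_int_mult[of r n x d] by (auto simp: positive_part_def int_component_def split: if_splits)
qed (auto simp: positive_part_def component_diff split: if_splits)

lemma one_in_component_0: "1 \<in> G 0"
  unfolding component_0 by (metis rangeI scale_one)

lemma scalar_component: "scale a 1 \<in> G 0"
  unfolding component_0 by blast

lemma component_sum: "(\<And>a. a \<in> S \<Longrightarrow> f a \<in> G d) \<Longrightarrow> sum f S \<in> G d"
  using component_subspace subspace_sum by blast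

end

text \<open>
  \<open>M \<otimes> F \<rightarrow> M\<close> for the linear form on \<open>F\<close> with values \<open>\<epsilon>\<close>. Below, \<open>\<epsilon>\<close> lifts the augmentation
  of a resolution of the residue field from \<open>K\<close> to the scalars in degree \<open>0\<close>.
\<close>

definition counit :: "('r \<Rightarrow> 'm \<Rightarrow> 'm::ab_group_add) \<Rightarrow> ('b \<Rightarrow> 'r) \<Rightarrow> ('b \<Rightarrow>\<^sub>0 'm) \<Rightarrow> 'm" where
  "counit sc \<epsilon> x = (\<Sum>b\<in>keys x. sc (\<epsilon> b) (lookup x b))"

lemma counit_superset:
  assumes "module sc" "finite S" "keys x \<subseteq> S"
  shows "counit sc \<epsilon> x = (\<Sum>b\<in>S. sc (\<epsilon> b) (lookup x b))"
proof -
  interpret module sc by fact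
  show ?thesis unfolding counit_def
    by (rule sum.mono_neutral_left) (use assms in \<open>auto simp: in_keys_iff\<close>)
qed

lemma counit_add:
  assumes "module sc"
  shows "counit sc \<epsilon> (x + y) = counit sc \<epsilon> x + counit sc \<epsilon> y"
proof -
  interpret module sc by fact
  have "keys (x + y) \<subseteq> keys x \<union> keys y" by (rule Poly_Mapping.keys_add)
  then show ?thesis
    by (simp add: counit_superset[OF assms, of "keys x \<union> keys y"] lookup_add scale_right_distrib sum.distrib)
qed

lemma counit_zero [simp]: "counit sc \<epsilon> 0 = 0"
  by (simp add: counit_def)

lemma counit_diff:
  assumes "module sc"
  shows "counit sc \<epsilon> (x - y) = counit sc \<epsilon> x - counit sc \<epsilon> y"
  using counit_add[OF assms, of \<epsilon> "x - y" y] by (simp add: algebra_simps)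

lemma counit_tensor_map:
  assumes "module sc"
  shows "counit sc \<epsilon> (tensor_map sc g x) = counit sc (\<lambda>b. counit (*) \<epsilon> (g b)) x"
proof -
  interpret module sc by fact
  let ?g = "\<lambda>b. single () (\<epsilon> b)"
  have c: "counit sc \<epsilon> y = lookup (tensor_map sc ?g y) ()" for y
    by (simp add: lookup_tensor_map[OF assms finite_keys order_refl] counit_def)
  have c': "counit (*) \<epsilon> y = lookup (tensor_map (*) ?g y) ()" for y
    by (simp add: lookup_tensor_map[OF module_ring_mult finite_keys order_refl] counit_def)
  show ?thesis
    unfolding c c' tensor_map_compose[OF assms]
    by (simp only: lookup_tensor_map[OF assms finite_keys order_refl] counit_def)
qed

text \<open>
  A graded free resolution of the residue field in coordinates: \<open>B i\<close> and \<open>\<delta> i\<close> are the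
  basis and the degrees of the \<open>i\<close>-th module and \<open>g i b\<close> is the image of the basis element
  \<open>b\<close> of the next one. Exactness is required in each degree. The augmentation enters through
  scalars \<open>\<epsilon> b\<close> lifting its values, together with an element \<open>u\<close> mapped to \<open>1\<close>; the last
  axiom says that its kernel in degree \<open>d\<close>, which is everything if \<open>d \<noteq> 0\<close>, consists of
  boundaries.
\<close>

locale residue_resolution = standard_graded_algebra scale G
  for scale :: "'k::field \<Rightarrow> 'r::comm_ring_1 \<Rightarrow> 'r" and G :: "nat \<Rightarrow> 'r set" +
  fixes B :: "nat \<Rightarrow> nat set" and \<delta> :: "nat \<Rightarrow> nat \<Rightarrow> int"
    and g :: "nat \<Rightarrow> nat \<Rightarrow> (nat \<Rightarrow>\<^sub>0 'r)" and \<epsilon> :: "nat \<Rightarrow> 'r" and u :: "nat \<Rightarrow>\<^sub>0 'r"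
  assumes column: "b \<in> B (Suc i) \<Longrightarrow> g i b \<in> tensor_part (B i) (\<delta> i) (int_component G) (\<delta> (Suc i) b)"
    and column_cycle: "b \<in> B (Suc (Suc i)) \<Longrightarrow> tensor_map (*) (g i) (g (Suc i) b) = 0"
    and exact: "x \<in> tensor_part (B (Suc i)) (\<delta> (Suc i)) (int_component G) d \<Longrightarrow> tensor_map (*) (g i) x = 0 \<Longrightarrow>
      \<exists>y\<in>tensor_part (B (Suc (Suc i))) (\<delta> (Suc (Suc i))) (int_component G) d. tensor_map (*) (g (Suc i)) y = x"
    and counit_degree: "b \<in> B 0 \<Longrightarrow> \<epsilon> b \<in> (if \<delta> 0 b = 0 then G 0 else {0})"
    and unit_part: "u \<in> tensor_part (B 0) (\<delta> 0) (int_component G) 0"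
    and counit_unit: "counit (*) \<epsilon> u = 1"
    and counit_column: "b \<in> B 1 \<Longrightarrow> \<delta> 1 b = 0 \<Longrightarrow> counit (*) \<epsilon> (g 0 b) = 0"
    and exact_0: "x \<in> tensor_part (B 0) (\<delta> 0) (int_component G) d \<Longrightarrow> d \<noteq> 0 \<or> counit (*) \<epsilon> x = 0 \<Longrightarrow>
      \<exists>y\<in>tensor_part (B 1) (\<delta> 1) (int_component G) d. tensor_map (*) (g 0) y = x"
begin

abbreviation T :: "(int \<Rightarrow> 'm::ab_group_add set) \<Rightarrow> nat \<Rightarrow> int \<Rightarrow> (nat \<Rightarrow>\<^sub>0 'm) set" where
  "T M i d \<equiv> tensor_part (B i) (\<delta> i) M d"

text \<open>
  Vanishing in degree \<open>d\<close> of the \<open>j\<close>-th homology of \<open>(M/N) \<otimes> P\<close>, phrased with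
  representatives in \<open>M\<close>: cycles and boundaries are taken modulo \<open>N\<close>.
\<close>

definition tor_vanishes ::
  "('r \<Rightarrow> 'm::ab_group_add \<Rightarrow> 'm) \<Rightarrow> (int \<Rightarrow> 'm set) \<Rightarrow> (int \<Rightarrow> 'm set) \<Rightarrow> nat \<Rightarrow> int \<Rightarrow> bool" where
  "tor_vanishes sc M N j d \<longleftrightarrow>
     (\<forall>z\<in>T M j d. (\<forall>k. j = Suc k \<longrightarrow> tensor_map sc (g k) z \<in> T N k d) \<longrightarrow>
        (\<exists>y\<in>T M (Suc j) d. z - tensor_map sc (g j) y \<in> T N j d))"

lemma tor_vanishesI:
  assumes "\<And>z. z \<in> T M j d \<Longrightarrow> (\<And>k. j = Suc k \<Longrightarrow> tensor_map sc (g k) z \<in> T N k d) \<Longrightarrow>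
    \<exists>y\<in>T M (Suc j) d. z - tensor_map sc (g j) y \<in> T N j d"
  shows "tor_vanishes sc M N j d"
  using assms by (auto simp: tor_vanishes_def)

lemma tor_vanishesE:
  assumes "tor_vanishes sc M N j d" "z \<in> T M j d" "\<And>k. j = Suc k \<Longrightarrow> tensor_map sc (g k) z \<in> T N k d"
  obtains y where "y \<in> T M (Suc j) d" "z - tensor_map sc (g j) y \<in> T N j d"
  using assms by (auto simp: tor_vanishes_def)

lemma differential_part:
  "module sc \<Longrightarrow> graded_family G sc M \<Longrightarrow> x \<in> T M (Suc i) d \<Longrightarrow> tensor_map sc (g i) x \<in> T M i d"
  by (rule tensor_map_in_tensor_part) (auto intro: column)

lemma differential_square:
  assumes "module sc" "x \<in> T M (Suc (Suc i)) d"
  shows "tensor_map sc (g i) (tensor_map sc (g (Suc i)) x) = 0"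
proof -
  interpret sc: module sc by fact
  show ?thesis
    unfolding tensor_map_compose[OF assms(1)]
    by (rule poly_mapping_eqI)
      (use tensor_partD(3)[OF assms(2)] in \<open>simp add: lookup_tensor_map[OF assms(1) finite_keys order_refl] column_cycle subset_iff\<close>)
qed

lemma tor_vanishes_cong:
  assumes "\<And>d. M d = M' d" "\<And>d. N d = N' d"
  shows "tor_vanishes sc M N j d = tor_vanishes sc M' N' j d"
  using assms by presburger

lemma tor_vanishes_same:
  assumes "module sc" "graded_family G sc M"
  shows "tor_vanishes sc M M j d"
  by (rule tor_vanishesI) (auto intro!: bexI[of _ 0] tensor_part_zero[OF assms(2)])

text \<open>
  For \<open>L d \<subseteq> M d \<subseteq> N d\<close> the quotients \<open>M/L\<close>, \<open>N/L\<close> and \<open>N/M\<close> form a short exact sequence.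
  Each of the following lemmas expresses exactness of its long exact sequence at one of
  three places, in a fixed degree.
\<close>

context
  fixes sc :: "'r \<Rightarrow> 'm::ab_group_add \<Rightarrow> 'm" and L M N :: "int \<Rightarrow> 'm set"
  assumes sc: "module sc" and fam: "graded_family G sc L" "graded_family G sc M" "graded_family G sc N"
    and sub: "\<And>d. L d \<subseteq> M d" "\<And>d. M d \<subseteq> N d"
begin

text \<open>
  The part \<open>Tor\<^sub>j(M/L) \<rightarrow> Tor\<^sub>j(N/L) \<rightarrow> Tor\<^sub>j(N/M)\<close> of the long exact sequence.
\<close>

lemma tor_vanishes_middle:
  assumes "tor_vanishes sc M L j d" "tor_vanishes sc N M j d"
  shows "tor_vanishes sc N L j d"
proof (rule tor_vanishesI)
  fix z assume z: "z \<in> T N j d" "\<And>k. j = Suc k \<Longrightarrow> tensor_map sc (g k) z \<in> T L k d"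
  obtain y where y: "y \<in> T N (Suc j) d" "z - tensor_map sc (g j) y \<in> T M j d"
    using tor_vanishesE[OF assms(2) z(1)] z(2) tensor_part_mono sub(1) by metis
  have "tensor_map sc (g k) (z - tensor_map sc (g j) y) \<in> T L k d" if "j = Suc k" for k
    using z(2)[OF that] differential_square[OF sc, of y k N d] y(1) that by (simp add: tensor_map_diff sc)
  from tor_vanishesE[OF assms(1) y(2) this] obtain y' where
    y': "y' \<in> T M (Suc j) d" "z - tensor_map sc (g j) y - tensor_map sc (g j) y' \<in> T L j d" .
  show "\<exists>y\<in>T N (Suc j) d. z - tensor_map sc (g j) y \<in> T L j d"
    by (rule bexI[of _ "y + y'"])
      (use y y' tensor_part_mono[OF y'(1) sub(2)] in
        \<open>auto simp: tensor_map_add sc algebra_simps intro!: tensor_part_add[OF fam(3)]\<close>)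
qed

text \<open>
  The part \<open>Tor\<^sub>j\<^sub>+\<^sub>1(N/M) \<rightarrow> Tor\<^sub>j(M/L) \<rightarrow> Tor\<^sub>j(N/L)\<close>.
\<close>

lemma tor_vanishes_sub:
  assumes "tor_vanishes sc N L j d" "tor_vanishes sc N M (Suc j) d"
  shows "tor_vanishes sc M L j d"
proof (rule tor_vanishesI)
  fix z assume z: "z \<in> T M j d" "\<And>k. j = Suc k \<Longrightarrow> tensor_map sc (g k) z \<in> T L k d"
  obtain y where y: "y \<in> T N (Suc j) d" "z - tensor_map sc (g j) y \<in> T L j d"
    using tor_vanishesE[OF assms(1) tensor_part_mono[OF z(1) sub(2)] z(2)] .
  have "z - (z - tensor_map sc (g j) y) \<in> T M j d"
    by (rule tensor_part_diff[OF fam(2) z(1) tensor_part_mono[OF y(2) sub(1)]])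
  then have "tensor_map sc (g j) y \<in> T M j d" by simp
  then obtain y' where y': "y' \<in> T N (Suc (Suc j)) d" "y - tensor_map sc (g (Suc j)) y' \<in> T M (Suc j) d"
    using tor_vanishesE[OF assms(2) y(1)] by blast
  show "\<exists>y\<in>T M (Suc j) d. z - tensor_map sc (g j) y \<in> T L j d"
    by (rule bexI[OF _ y'(2)]) (use y differential_square[OF sc y'(1)] in \<open>simp add: tensor_map_diff sc\<close>)
qed

text \<open>
  The part \<open>Tor\<^sub>j\<^sub>+\<^sub>1(N/L) \<rightarrow> Tor\<^sub>j\<^sub>+\<^sub>1(N/M) \<rightarrow> Tor\<^sub>j(M/L)\<close>.
\<close>

lemma tor_vanishes_quotient:
  assumes "tor_vanishes sc N L (Suc j) d" "tor_vanishes sc M L j d"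
  shows "tor_vanishes sc N M (Suc j) d"
proof (rule tor_vanishesI)
  fix z assume z: "z \<in> T N (Suc j) d" "\<And>k. Suc j = Suc k \<Longrightarrow> tensor_map sc (g k) z \<in> T M k d"
  have "tensor_map sc (g k) (tensor_map sc (g j) z) \<in> T L k d" if "j = Suc k" for k
    using differential_square[OF sc, of z k N d] z(1) that tensor_part_zero[OF fam(1)] by simp
  from tor_vanishesE[OF assms(2) z(2)[OF refl] this] obtain y where
    y: "y \<in> T M (Suc j) d" "tensor_map sc (g j) z - tensor_map sc (g j) y \<in> T L j d" .
  have "z - y \<in> T N (Suc j) d"
    by (rule tensor_part_diff[OF fam(3) z(1) tensor_part_mono[OF y(1) sub(2)]])
  moreover have "tensor_map sc (g k) (z - y) \<in> T L k d" if "Suc j = Suc k" for k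
    using that y(2) by (simp add: tensor_map_diff sc)
  ultimately obtain w where w: "w \<in> T N (Suc (Suc j)) d" "z - y - tensor_map sc (g (Suc j)) w \<in> T L (Suc j) d"
    by (rule tor_vanishesE[OF assms(1)])
  have "(z - y - tensor_map sc (g (Suc j)) w) + y \<in> T M (Suc j) d"
    by (rule tensor_part_add[OF fam(2) tensor_part_mono[OF w(2) sub(1)] y(1)])
  then show "\<exists>y\<in>T N (Suc (Suc j)) d. z - tensor_map sc (g (Suc j)) y \<in> T M (Suc j) d"
    by (intro bexI[OF _ w(1)]) (simp add: algebra_simps)
qed

end

text \<open>
  The functor \<open>Tor\<^sub>0\<close> preserves surjections.
\<close>

lemma tor_vanishes_quotient_0:
  assumes "tor_vanishes sc N L 0 d" "\<And>d. L d \<subseteq> M d"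
  shows "tor_vanishes sc N M 0 d"
proof (rule tor_vanishesI)
  fix z assume "z \<in> T N 0 d"
  then obtain y where "y \<in> T N (Suc 0) d" "z - tensor_map sc (g 0) y \<in> T L 0 d"
    using tor_vanishesE[OF assms(1)] by blast
  then show "\<exists>y\<in>T N (Suc 0) d. z - tensor_map sc (g 0) y \<in> T M 0 d"
    using tensor_part_mono[of _ _ _ L d M] assms(2) by blast
qed

text \<open>
  Quotients in different ambient groups are compared through a linear map \<open>f\<close>. The
  hypotheses say that \<open>f\<close> raises degrees by \<open>s\<close> and induces an isomorphism from \<open>M/N\<close> to
  \<open>M'/N'\<close>.
\<close>

context
  fixes sc :: "'r \<Rightarrow> 'm::ab_group_add \<Rightarrow> 'm" and sc' :: "'r \<Rightarrow> 'n::ab_group_add \<Rightarrow> 'n"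
    and M N M' N' and f :: "'m \<Rightarrow> 'n" and s :: int
  assumes sc: "module sc" "module sc'"
    and fam: "graded_family G sc M" "graded_family G sc N" "graded_family G sc' M'" "graded_family G sc' N'"
    and f_add: "\<And>x y. f (x + y) = f x + f y" and f_scale: "\<And>r x. f (sc r x) = sc' r (f x)"
    and f_M: "\<And>d x. x \<in> M d \<Longrightarrow> f x \<in> M' (d + s)"
    and f_N: "\<And>d x. x \<in> N d \<Longrightarrow> f x \<in> N' (d + s)"
    and f_inj: "\<And>d x. x \<in> M d \<Longrightarrow> f x \<in> N' (d + s) \<Longrightarrow> x \<in> N d"
    and f_surj: "\<And>d y. y \<in> M' (d + s) \<Longrightarrow> \<exists>x\<in>M d. y - f x \<in> N' (d + s)"
begin

lemma graded_map_zero: "f 0 = 0"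
  using f_add[of 0 0] by simp

lemma graded_map_diff: "f (x - y) = f x - f y"
  using f_add[of "x - y" y] by (simp add: algebra_simps)

lemma tensor_graded_map_numerator: "x \<in> T M i d \<Longrightarrow> Poly_Mapping.map f x \<in> T M' i (d + s)"
  using f_M by (auto simp: tensor_part_def lookup_map_zero graded_map_zero diff_add_eq[symmetric])

lemma tensor_graded_map_denominator: "x \<in> T N i d \<Longrightarrow> Poly_Mapping.map f x \<in> T N' i (d + s)"
  using f_N by (auto simp: tensor_part_def lookup_map_zero graded_map_zero diff_add_eq[symmetric])

lemma tensor_graded_map_reflects: "x \<in> T M i d \<Longrightarrow> Poly_Mapping.map f x \<in> T N' i (d + s) \<Longrightarrow> x \<in> T N i d"
  using f_inj by (auto simp: tensor_part_def lookup_map_zero graded_map_zero diff_add_eq[symmetric])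

lemma tensor_graded_map_diff: "Poly_Mapping.map f (x - y) = Poly_Mapping.map f x - Poly_Mapping.map f y"
  by (rule poly_mapping_eqI) (simp add: lookup_map_zero graded_map_zero lookup_minus graded_map_diff)

text \<open>
  Surjectivity modulo \<open>N'\<close> passes to the tensor product because coefficients can be lifted
  one basis element at a time.
\<close>

lemma tensor_graded_map_lift:
  assumes "y \<in> T M' i (d + s)"
  obtains x where "x \<in> T M i d" "y - Poly_Mapping.map f x \<in> T N' i (d + s)"
proof -
  have "\<exists>v. v \<in> M (d - \<delta> i b) \<and> lookup y b - f v \<in> N' (d + s - \<delta> i b)" if "b \<in> keys y" for b
    using that tensor_partD(1)[OF assms, of b] tensor_partD(3)[OF assms]
      f_surj[of "lookup y b" "d - \<delta> i b"] by (auto simp: diff_add_eq[symmetric] subset_iff)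
  then obtain x where x: "\<And>b. b \<in> keys y \<Longrightarrow> lookup x b \<in> M (d - \<delta> i b) \<and> lookup y b - f (lookup x b) \<in> N' (d + s - \<delta> i b)"
    and x0: "\<And>b. b \<notin> keys y \<Longrightarrow> lookup x b = 0"
    using poly_mapping_choice[of y "\<lambda>b v. v \<in> M (d - \<delta> i b) \<and> lookup y b - f v \<in> N' (d + s - \<delta> i b)"] by blast
  show thesis
  proof (rule that[of x])
    show "x \<in> T M i d"
      by (rule tensor_partI, metis x x0 graded_family_zero[OF fam(1)])
        (use tensor_partD(3)[OF assms] x0 in auto)
    show "y - Poly_Mapping.map f x \<in> T N' i (d + s)"
    proof (rule tensor_partI)
      fix b show "lookup (y - Poly_Mapping.map f x) b \<in> N' (d + s - \<delta> i b)"
        by (cases "b \<in> keys y") (use x x0 in \<open>auto simp: lookup_minus lookup_map_zero graded_map_zero graded_family_zero[OF fam(4)] in_keys_iff\<close>)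
    next
      fix b assume "b \<notin> B i"
      then have "b \<notin> keys y"
        using tensor_partD(3)[OF assms] by auto
      then show "lookup (y - Poly_Mapping.map f x) b = 0"
        using x0 by (simp add: lookup_minus lookup_map_zero graded_map_zero in_keys_iff)
    qed
  qed
qed

lemma tensor_map_graded_map: "tensor_map sc' h (Poly_Mapping.map f x) = Poly_Mapping.map f (tensor_map sc h x)"
  by (rule tensor_map_map) (use sc f_add f_scale in auto)

lemma tor_vanishes_iso:
  assumes "tor_vanishes sc M N j d"
  shows "tor_vanishes sc' M' N' j (d + s)"
proof (rule tor_vanishesI)
  let ?m = "Poly_Mapping.map f"
  fix z' assume z': "z' \<in> T M' j (d + s)" "\<And>k. j = Suc k \<Longrightarrow> tensor_map sc' (g k) z' \<in> T N' k (d + s)"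
  obtain z where z: "z \<in> T M j d" "z' - ?m z \<in> T N' j (d + s)" by (rule tensor_graded_map_lift[OF z'(1)])
  have "tensor_map sc (g k) z \<in> T N k d" if k: "j = Suc k" for k
  proof (rule tensor_graded_map_reflects)
    show "tensor_map sc (g k) z \<in> T M k d"
      by (rule differential_part[OF sc(1) fam(1)]) (use z(1) k in simp)
    have "tensor_map sc' (g k) z' - tensor_map sc' (g k) (z' - ?m z) \<in> T N' k (d + s)"
      by (rule tensor_part_diff[OF fam(4) z'(2)[OF k] differential_part[OF sc(2) fam(4)]])
        (use z(2) k in simp)
    then show "?m (tensor_map sc (g k) z) \<in> T N' k (d + s)"
      by (simp add: tensor_map_diff[OF sc(2)] tensor_map_graded_map)
  qed
  from tor_vanishesE[OF assms z(1) this] obtain y where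
    y: "y \<in> T M (Suc j) d" "z - tensor_map sc (g j) y \<in> T N j d" .
  have "(z' - ?m z) + ?m (z - tensor_map sc (g j) y) \<in> T N' j (d + s)"
    by (rule tensor_part_add[OF fam(4) z(2) tensor_graded_map_denominator[OF y(2)]])
  then show "\<exists>y\<in>T M' (Suc j) (d + s). z' - tensor_map sc' (g j) y \<in> T N' j (d + s)"
    by (intro bexI[OF _ tensor_graded_map_numerator[OF y(1)]]) (simp add: tensor_graded_map_diff tensor_map_graded_map)
qed

lemma tor_vanishes_iso_reverse:
  assumes "tor_vanishes sc' M' N' j (d + s)"
  shows "tor_vanishes sc M N j d"
proof (rule tor_vanishesI)
  let ?m = "Poly_Mapping.map f"
  fix z assume z: "z \<in> T M j d" "\<And>k. j = Suc k \<Longrightarrow> tensor_map sc (g k) z \<in> T N k d"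
  have "tensor_map sc' (g k) (?m z) \<in> T N' k (d + s)" if "j = Suc k" for k
    unfolding tensor_map_graded_map by (rule tensor_graded_map_denominator[OF z(2)[OF that]])
  from tor_vanishesE[OF assms tensor_graded_map_numerator[OF z(1)] this] obtain y' where
    y': "y' \<in> T M' (Suc j) (d + s)" "?m z - tensor_map sc' (g j) y' \<in> T N' j (d + s)" .
  obtain y where y: "y \<in> T M (Suc j) d" "y' - ?m y \<in> T N' (Suc j) (d + s)" by (rule tensor_graded_map_lift[OF y'(1)])
  have "(?m z - tensor_map sc' (g j) y') + tensor_map sc' (g j) (y' - ?m y) \<in> T N' j (d + s)"
    by (rule tensor_part_add[OF fam(4) y'(2) differential_part[OF sc(2) fam(4) y(2)]])
  then have "?m (z - tensor_map sc (g j) y) \<in> T N' j (d + s)"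
    by (simp add: tensor_map_diff[OF sc(2)] tensor_graded_map_diff tensor_map_graded_map)
  then have "z - tensor_map sc (g j) y \<in> T N j d"
    by (rule tensor_graded_map_reflects[OF tensor_part_diff[OF fam(1) z(1) differential_part[OF sc(1) fam(1) y(1)]]])
  then show "\<exists>y\<in>T M (Suc j) d. z - tensor_map sc (g j) y \<in> T N j d"
    using y(1) by blast
qed

end

text \<open>
  Flatness of the ring: \<open>R \<otimes> P\<close> is \<open>P\<close>, which is exact in positive homological degrees.
\<close>

lemma tor_vanishes_ring: "tor_vanishes (*) (int_component G) (\<lambda>d. {0}) (Suc j) d"
proof (rule tor_vanishesI)
  fix z assume z: "z \<in> T (int_component G) (Suc j) d"
    and c: "\<And>k. Suc j = Suc k \<Longrightarrow> tensor_map (*) (g k) z \<in> T (\<lambda>d. {0}) k d"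
  have "tensor_map (*) (g j) z = 0"
    using c[OF refl] by (intro poly_mapping_eqI) (auto simp: tensor_part_def)
  then obtain y where "y \<in> T (int_component G) (Suc (Suc j)) d" "tensor_map (*) (g (Suc j)) y = z"
    using exact[OF z] by blast
  then show "\<exists>y\<in>T (int_component G) (Suc (Suc j)) d. z - tensor_map (*) (g (Suc j)) y \<in> T (\<lambda>d. {0}) (Suc j) d"
    by (auto simp: tensor_part_def intro!: bexI[of _ y])
qed

end

section \<open>Low homological degrees, modules of finite length and direct sums\<close>

text \<open>
  The element \<open>x \<otimes> p\<close> of \<open>M \<otimes> F\<close>.
\<close>

definition pure_tensor :: "('r::zero \<Rightarrow> 'm::zero \<Rightarrow> 'm) \<Rightarrow> ('b \<Rightarrow>\<^sub>0 'r) \<Rightarrow> 'm \<Rightarrow> ('b \<Rightarrow>\<^sub>0 'm)" where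
  "pure_tensor sc p x = Poly_Mapping.map (\<lambda>r. sc r x) p"

lemma lookup_pure_tensor: "module sc \<Longrightarrow> lookup (pure_tensor sc p x) b = sc (lookup p b) x"
  by (simp add: pure_tensor_def lookup_map_zero module.scale_zero_left)

lemma pure_tensor_add:
  assumes "module sc"
  shows "pure_tensor sc p (x + y) = pure_tensor sc p x + pure_tensor sc p y"
  by (rule poly_mapping_eqI) (simp add: lookup_pure_tensor lookup_add assms module.scale_right_distrib)

lemma pure_tensor_zero: "module sc \<Longrightarrow> pure_tensor sc p 0 = 0"
  by (rule poly_mapping_eqI) (simp add: lookup_pure_tensor module.scale_zero_right)

lemma tensor_map_pure:
  assumes "module sc"
  shows "tensor_map sc h (pure_tensor sc p x) = pure_tensor sc (tensor_map (*) h p) x"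
  unfolding pure_tensor_def
  by (rule tensor_map_map)
    (simp_all add: assms module_ring_mult module.scale_left_distrib module.scale_scale[OF assms])

lemma counit_pure:
  assumes "module sc"
  shows "counit sc \<epsilon> (pure_tensor sc p x) = sc (counit (*) \<epsilon> p) x"
proof -
  interpret module sc by fact
  have "keys (pure_tensor sc p x) \<subseteq> keys p"
    by (auto simp: in_keys_iff lookup_pure_tensor assms)
  then have "counit sc \<epsilon> (pure_tensor sc p x) = (\<Sum>b\<in>keys p. sc (\<epsilon> b * lookup p b) x)"
    by (simp add: counit_superset[OF assms, of "keys p"] lookup_pure_tensor assms)
  then show ?thesis
    by (simp add: counit_def scale_sum_left)
qed

lemma counit_single: "module sc \<Longrightarrow> counit sc \<epsilon> (single b m) = sc (\<epsilon> b) m"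
  using counit_superset[of sc "{b}" "single b m" \<epsilon>] by simp

lemma graded_family_positive_multiples:
  assumes "module sc" "graded_family G sc M" "x \<in> positive_multiples G sc M d"
  shows "x \<in> M d"
  using assms(3)
proof induction
  case zero
  show ?case by (rule graded_family_zero[OF assms(2)])
next
  case (add r n x y)
  then show ?case
    using graded_family_scale[OF assms(2), of r n x "d - int n"] by (auto intro: graded_family_add[OF assms(2)])
qed

text \<open>
  The family generated by \<open>N\<close> and an element \<open>v\<close> of degree \<open>e\<close> all of whose multiples of
  higher degree lie in \<open>N\<close> already, so that only scalar multiples of \<open>v\<close> have to be added.
\<close>

definition adjoin ::
  "('k \<Rightarrow> 'r \<Rightarrow> 'r::one) \<Rightarrow> ('r \<Rightarrow> 'm \<Rightarrow> 'm::plus) \<Rightarrow> (int \<Rightarrow> 'm set) \<Rightarrow> int \<Rightarrow> 'm \<Rightarrow> int \<Rightarrow> 'm set" where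
  "adjoin scale sc N e v d = (if d = e then {n + sc (scale a 1) v | n a. n \<in> N e} else N d)"

lemma module_map:
  assumes "module sc"
  shows "module (\<lambda>r. Poly_Mapping.map (sc r) :: ('b \<Rightarrow>\<^sub>0 'm::ab_group_add) \<Rightarrow> _)"
proof -
  interpret module sc by fact
  show ?thesis
    by standard (auto intro!: poly_mapping_eqI simp: lookup_map_zero lookup_add algebra_simps)
qed

lemma graded_family_tensor_part:
  assumes "module sc" "graded_family G sc M"
  shows "graded_family G (\<lambda>r. Poly_Mapping.map (sc r)) (tensor_part B \<delta> M)"
proof (rule graded_familyI)
  fix n d r x assume "r \<in> G n" "x \<in> tensor_part B \<delta> M d"
  then show "Poly_Mapping.map (sc r) x \<in> tensor_part B \<delta> M (int n + d)"
    using graded_family_scale[OF assms(2), of r n]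
    by (auto simp: tensor_part_def lookup_map_zero assms(1) module.scale_zero_right add_diff_eq[symmetric])
qed (use assms(2) tensor_part_zero tensor_part_diff in blast)+

context residue_resolution
begin

lemma pure_tensor_part:
  assumes "module sc" "graded_family G sc M" "p \<in> T (int_component G) i e" "x \<in> M d"
  shows "pure_tensor sc p x \<in> T M i (e + d)"
proof (rule tensor_partI)
  fix b assume "b \<in> B i"
  then show "lookup (pure_tensor sc p x) b \<in> M (e + d - \<delta> i b)"
    using graded_family_scale_int[OF assms(1,2) tensor_partD(1)[OF assms(3)] assms(4), of b]
    by (simp add: lookup_pure_tensor assms(1) diff_add_eq)
next
  fix b assume "b \<notin> B i"
  then show "lookup (pure_tensor sc p x) b = 0"
    using tensor_partD(2)[OF assms(3), of b] by (simp add: lookup_pure_tensor assms(1) module.scale_zero_left)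
qed

lemma counit_part:
  assumes "module sc" "graded_family G sc M" "z \<in> T M 0 d"
  shows "counit sc \<epsilon> z \<in> M d"
  unfolding counit_def
proof (rule graded_family_sum[OF assms(2)])
  fix b assume "b \<in> keys z"
  then have b: "b \<in> B 0" using tensor_partD(3)[OF assms(3)] by auto
  show "sc (\<epsilon> b) (lookup z b) \<in> M d"
    using counit_degree[OF b] tensor_partD(1)[OF assms(3) b] graded_family_scale[OF assms(2), of "\<epsilon> b" 0 _ d]
    by (auto simp: graded_family_zero[OF assms(2)] module.scale_zero_left[OF assms(1)] simp del: graded_family_zero split: if_splits)
qed

text \<open>
  The augmentation of \<open>\<partial>y\<close> is the sum of the coefficients of \<open>y\<close>, each multiplied by the
  augmentation of a column of \<open>P\<^sub>1 \<rightarrow> P\<^sub>0\<close>. The latter is a ring element of the degree of a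
  basis element of \<open>P\<^sub>1\<close>; it is zero in degrees at most \<open>0\<close> and lies in \<open>\<mm>\<close> in positive
  degrees.
\<close>

lemma counit_boundary:
  assumes "module sc" "graded_family G sc M" "y \<in> T M 1 d"
  shows "counit sc \<epsilon> (tensor_map sc (g 0) y) \<in> positive_multiples G sc M d"
  unfolding counit_tensor_map[OF assms(1)]
  unfolding counit_def[of sc]
proof (rule positive_multiples_closed_sum)
  fix b assume "b \<in> keys y"
  then have b: "b \<in> B 1" using tensor_partD(3)[OF assms(3)] by auto
  have c: "counit (*) \<epsilon> (g 0 b) \<in> int_component G (\<delta> 1 b)"
    using counit_part[OF module_ring_mult graded_family_ring column[of b 0]] b by simp
  consider "\<delta> 1 b \<le> 0" | "\<delta> 1 b > 0" by linarith
  then show "sc (counit (*) \<epsilon> (g 0 b)) (lookup y b) \<in> positive_multiples G sc M d"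
  proof cases
    case 1
    then have "counit (*) \<epsilon> (g 0 b) = 0"
      using c counit_column[OF b] by (cases "\<delta> 1 b = 0") (auto simp: int_component_def)
    then show ?thesis by (simp add: module.scale_zero_left assms(1) positive_multiples.zero)
  next
    case 2
    show ?thesis
      by (rule positive_multiples_single[of _ G "nat (\<delta> 1 b)"])
        (use 2 c tensor_partD(1)[OF assms(3) b] in \<open>auto simp: int_component_def\<close>)
  qed
qed

text \<open>
  \<open>P\<^sub>0\<close> may have superfluous basis elements, but \<open>b - \<epsilon> b \<cdot> u\<close> is a boundary for every basis
  element \<open>b\<close>. Hence \<open>M \<otimes> P\<^sub>0\<close> is \<open>M \<otimes> u\<close> up to boundaries.
\<close>

lemma reduce_to_counit:
  assumes sc: "module sc" and fam: "graded_family G sc M" and z: "z \<in> T M 0 d"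
  shows "\<exists>y\<in>T M 1 d. z - pure_tensor sc u (counit sc \<epsilon> z) = tensor_map sc (g 0) y"
  (is "?P z")
proof (induction z rule: poly_mapping_induct_single)
  case zero
  show ?case
    by (rule bexI[of _ 0]) (simp_all add: pure_tensor_zero sc tensor_part_zero[OF fam])
next
  interpret sc: module sc by fact
  case (add b m x)
  then obtain y where y: "y \<in> T M 1 d" "x - pure_tensor sc u (counit sc \<epsilon> x) = tensor_map sc (g 0) y"
    by blast
  have b: "b \<in> B 0" using add tensor_partD(3)[OF z] by auto
  have m: "m \<in> M (d - \<delta> 0 b)" using add tensor_partD(1)[OF z b] by simp
  define p where "p = single b 1 - pure_tensor (*) u (\<epsilon> b)"
  have p1: "single b 1 \<in> T (int_component G) 0 (\<delta> 0 b)"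
    using b one_in_component_0
    by (auto simp: tensor_part_def lookup_single when_def int_component_def)
  have p2: "pure_tensor (*) u (\<epsilon> b) \<in> T (int_component G) 0 (\<delta> 0 b)"
  proof (cases "\<delta> 0 b = 0")
    case True
    then have "\<epsilon> b \<in> int_component G 0" using counit_degree[OF b] by (simp add: int_component_def)
    from pure_tensor_part[OF module_ring_mult graded_family_ring unit_part this] True show ?thesis by simp
  next
    case False
    then have "\<epsilon> b = 0" using counit_degree[OF b] by simp
    then show ?thesis by (simp add: pure_tensor_zero module_ring_mult tensor_part_zero[OF graded_family_ring])
  qed
  have "p \<in> T (int_component G) 0 (\<delta> 0 b)"
    unfolding p_def by (rule tensor_part_diff[OF graded_family_ring p1 p2])
  moreover have "counit (*) \<epsilon> p = 0"
    by (simp add: p_def counit_diff counit_pure module_ring_mult counit_single counit_unit)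
  ultimately obtain q where q: "q \<in> T (int_component G) 1 (\<delta> 0 b)" "tensor_map (*) (g 0) q = p"
    using exact_0 by blast
  have "pure_tensor sc q m \<in> T M 1 (\<delta> 0 b + (d - \<delta> 0 b))"
    by (rule pure_tensor_part[OF sc fam q(1) m])
  then have q': "pure_tensor sc q m \<in> T M 1 d" by simp
  have pm: "pure_tensor sc p m = single b m - pure_tensor sc u (sc (\<epsilon> b) m)"
    by (rule poly_mapping_eqI)
      (simp add: p_def lookup_pure_tensor sc module_ring_mult lookup_minus lookup_single when_def algebra_simps)
  show ?case
  proof (rule bexI[of _ "pure_tensor sc q m + y"])
    show "single b m + x - pure_tensor sc u (counit sc \<epsilon> (single b m + x))
        = tensor_map sc (g 0) (pure_tensor sc q m + y)"
      by (simp add: tensor_map_add sc tensor_map_pure q(2) pm counit_add counit_single pure_tensor_add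
          y(2)[symmetric])
  qed (rule tensor_part_add[OF fam q' y(1)])
qed

text \<open>
  Multiples of \<open>u\<close> by ring elements of positive degree are boundaries, since \<open>\<mm>\<close> annihilates
  \<open>K\<close>.
\<close>

lemma positive_multiple_boundary:
  assumes sc: "module sc" and fam: "graded_family G sc M" and x: "x \<in> positive_multiples G sc M d"
  shows "\<exists>y\<in>T M 1 d. pure_tensor sc u x = tensor_map sc (g 0) y"
  using x
proof induction
  case zero
  show ?case
    by (rule bexI[of _ 0]) (simp_all add: pure_tensor_zero sc tensor_part_zero[OF fam])
next
  interpret sc: module sc by fact
  case (add r n x x')
  then obtain y where y: "y \<in> T M 1 d" "pure_tensor sc u x' = tensor_map sc (g 0) y" by blast
  have "pure_tensor (*) u r \<in> T (int_component G) 0 (0 + int n)"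
    by (rule pure_tensor_part[OF module_ring_mult graded_family_ring unit_part])
      (use add in \<open>simp add: int_component_def\<close>)
  then obtain q where q: "q \<in> T (int_component G) 1 (int n)" "tensor_map (*) (g 0) q = pure_tensor (*) u r"
    using exact_0[of _ "int n"] add.hyps by auto
  have "pure_tensor sc q x \<in> T M 1 (int n + (d - int n))"
    by (rule pure_tensor_part[OF sc fam q(1)]) (use add in simp)
  then have q': "pure_tensor sc q x \<in> T M 1 d" by simp
  have "pure_tensor sc (pure_tensor (*) u r) x = pure_tensor sc u (sc r x)"
    by (rule poly_mapping_eqI) (simp add: lookup_pure_tensor sc module_ring_mult)
  then show ?case
    by (intro bexI[of _ "pure_tensor sc q x + y"] tensor_part_add[OF fam q' y(1)])
      (simp add: tensor_map_add sc tensor_map_pure q(2) pure_tensor_add y(2)[symmetric])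
qed

text \<open>
  \<open>Tor\<^sub>0(M/N, K) = M / (N + \<mm>M)\<close>. Apply the augmentation to the class of \<open>x \<otimes> u\<close>.
\<close>

lemma tor_vanishes_0D:
  assumes sc: "module sc" and fam: "graded_family G sc M" "graded_family G sc N"
    and t: "tor_vanishes sc M N 0 d" and x: "x \<in> M d"
  shows "\<exists>n\<in>N d. x - n \<in> positive_multiples G sc M d"
proof -
  interpret sc: module sc by fact
  have "pure_tensor sc u x \<in> T M 0 d"
    using pure_tensor_part[OF sc fam(1) unit_part x] by simp
  then obtain y where y: "y \<in> T M 1 d" "pure_tensor sc u x - tensor_map sc (g 0) y \<in> T N 0 d"
    using tor_vanishesE[OF t] by auto
  have "counit sc \<epsilon> (pure_tensor sc u x - tensor_map sc (g 0) y) \<in> N d"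
    by (rule counit_part[OF sc fam(2) y(2)])
  then have "x - counit sc \<epsilon> (tensor_map sc (g 0) y) \<in> N d"
    by (simp add: counit_diff sc counit_pure counit_unit)
  then show ?thesis
    using counit_boundary[OF sc fam(1) y(1)] by (intro bexI) auto
qed

text \<open>
  The converse: every class in \<open>Tor\<^sub>0\<close> is represented by some \<open>x \<otimes> u\<close>, and \<open>\<mm>M \<otimes> u\<close> consists
  of boundaries.
\<close>

lemma tor_vanishes_0I:
  assumes sc: "module sc" and fam: "graded_family G sc M" "graded_family G sc N"
    and gen: "\<And>x. x \<in> M d \<Longrightarrow> \<exists>n\<in>N d. x - n \<in> positive_multiples G sc M d"
  shows "tor_vanishes sc M N 0 d"
proof (rule tor_vanishesI)
  fix z assume z: "z \<in> T M 0 d"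
  obtain y where y: "y \<in> T M 1 d" "z - pure_tensor sc u (counit sc \<epsilon> z) = tensor_map sc (g 0) y"
    using reduce_to_counit[OF sc fam(1) z] by blast
  obtain n where n: "n \<in> N d" "counit sc \<epsilon> z - n \<in> positive_multiples G sc M d"
    using gen[OF counit_part[OF sc fam(1) z]] by blast
  obtain y' where y': "y' \<in> T M 1 d" "pure_tensor sc u (counit sc \<epsilon> z - n) = tensor_map sc (g 0) y'"
    using positive_multiple_boundary[OF sc fam(1) n(2)] by blast
  have "pure_tensor sc u (counit sc \<epsilon> z) = tensor_map sc (g 0) y' + pure_tensor sc u n"
    by (simp add: y'(2)[symmetric] pure_tensor_add[OF sc, symmetric])
  then have "z - tensor_map sc (g 0) (y + y') = pure_tensor sc u n"
    using y(2) by (simp add: tensor_map_add sc algebra_simps)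
  moreover have "pure_tensor sc u n \<in> T N 0 d"
    using pure_tensor_part[OF sc fam(2) unit_part n(1)] by simp
  ultimately show "\<exists>y\<in>T M (Suc 0) d. z - tensor_map sc (g 0) y \<in> T N 0 d"
    using tensor_part_add[OF fam(1) y(1) y'(1)] by (intro bexI[of _ "y + y'"]) simp_all
qed

text \<open>
  If \<open>Tor\<^sub>1(M, K)\<close> is zero in degree \<open>d\<close>, then \<open>Tor\<^sub>1(M/N, K)\<close> is in that degree the kernel
  of \<open>N/\<mm>N \<rightarrow> M/\<mm>M\<close>.
\<close>

lemma tor_vanishes_1I:
  assumes sc: "module sc" and fam: "graded_family G sc M" "graded_family G sc N"
    and sub: "\<And>d. N d \<subseteq> M d"
    and t: "tor_vanishes sc M (\<lambda>d. {0}) 1 d"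
    and gen: "\<And>x. x \<in> N d \<Longrightarrow> x \<in> positive_multiples G sc M d \<Longrightarrow> x \<in> positive_multiples G sc N d"
  shows "tor_vanishes sc M N 1 d"
proof (rule tor_vanishesI)
  fix z assume z: "z \<in> T M 1 d" "\<And>k. 1 = Suc k \<Longrightarrow> tensor_map sc (g k) z \<in> T N k d"
  let ?x = "tensor_map sc (g 0) z"
  have x: "?x \<in> T N 0 d" using z(2) by simp
  obtain y where y: "y \<in> T N 1 d" "?x - pure_tensor sc u (counit sc \<epsilon> ?x) = tensor_map sc (g 0) y"
    using reduce_to_counit[OF sc fam(2) x] by blast
  have "counit sc \<epsilon> ?x \<in> positive_multiples G sc N d"
    by (rule gen[OF counit_part[OF sc fam(2) x] counit_boundary[OF sc fam(1) z(1)]])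
  then obtain y' where y': "y' \<in> T N 1 d" "pure_tensor sc u (counit sc \<epsilon> ?x) = tensor_map sc (g 0) y'"
    using positive_multiple_boundary[OF sc fam(2)] by blast
  have yy: "y + y' \<in> T N 1 d" by (rule tensor_part_add[OF fam(2) y(1) y'(1)])
  have "tensor_map sc (g 0) (z - (y + y')) = 0"
    using y(2) y'(2) by (simp add: tensor_map_add tensor_map_diff sc algebra_simps)
  then have "tensor_map sc (g k) (z - (y + y')) \<in> T (\<lambda>d. {0}) k d" if "1 = Suc k" for k
    using that by (simp add: tensor_part_def)
  moreover have "z - (y + y') \<in> T M 1 d"
    by (rule tensor_part_diff[OF fam(1) z(1) tensor_part_mono[OF yy sub]])
  ultimately obtain w where w: "w \<in> T M (Suc 1) d" "z - (y + y') - tensor_map sc (g 1) w \<in> T (\<lambda>d. {0}) 1 d"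
    using tor_vanishesE[OF t] by metis
  have "z - (y + y') - tensor_map sc (g 1) w = 0"
    using w(2) by (intro poly_mapping_eqI) (auto simp: tensor_part_def)
  then have "z - tensor_map sc (g 1) w = y + y'" by (simp add: algebra_simps)
  then show "\<exists>y\<in>T M (Suc 1) d. z - tensor_map sc (g 1) y \<in> T N 1 d"
    using w(1) yy by metis
qed

abbreviation residue_tor_vanishes :: "nat \<Rightarrow> int \<Rightarrow> bool" where
  "residue_tor_vanishes \<equiv> tor_vanishes (*) (int_component G) (positive_part G)"

lemma graded_family_scalar:
  "graded_family G sc N \<Longrightarrow> n \<in> N e \<Longrightarrow> sc (scale a 1) n \<in> N e"
  using graded_family_scale[of G sc N "scale a 1" 0 n e] scalar_component by simp

context
  fixes sc :: "'r \<Rightarrow> 'm::ab_group_add \<Rightarrow> 'm" and N :: "int \<Rightarrow> 'm set" and e :: int and v :: 'm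
  assumes sc: "module sc" and fam: "graded_family G sc N"
    and v: "\<And>n r. n \<ge> 1 \<Longrightarrow> r \<in> G n \<Longrightarrow> sc r v \<in> N (int n + e)"
begin

lemma adjoin_base: "x \<in> N d \<Longrightarrow> x \<in> adjoin scale sc N e v d"
proof (cases "d = e")
  case True
  assume "x \<in> N d"
  moreover have "x = x + sc (scale 0 1) v" by (simp add: module.scale_zero_left[OF sc])
  ultimately have "x \<in> {n + sc (scale a 1) v | n a. n \<in> N e}" using True by blast
  then show ?thesis unfolding adjoin_def True by (simp only: simp_thms if_True)
qed (simp add: adjoin_def)

lemma adjoin_generator: "v \<in> adjoin scale sc N e v e"
proof -
  have "v = 0 + sc (scale 1 1) v" by (simp add: module.scale_one[OF sc])
  then have "v \<in> {n + sc (scale a 1) v | n a. n \<in> N e}" using graded_family_zero[OF fam, of e] by blast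
  then show ?thesis unfolding adjoin_def by (simp only: simp_thms if_True)
qed

lemma graded_family_adjoin: "graded_family G sc (adjoin scale sc N e v)"
proof (rule graded_familyI)
  interpret sc: module sc by (rule sc)
  fix d show "0 \<in> adjoin scale sc N e v d" by (rule adjoin_base) (rule graded_family_zero[OF fam])
  { fix x y assume x: "x \<in> adjoin scale sc N e v d" and y: "y \<in> adjoin scale sc N e v d"
    show "x - y \<in> adjoin scale sc N e v d"
    proof (cases "d = e")
      case True
      then obtain n a n' a' where "n \<in> N e" "n' \<in> N e" "x = n + sc (scale a 1) v" "y = n' + sc (scale a' 1) v"
        using x y by (auto simp: adjoin_def)
      then show ?thesis using True
        by (auto simp: adjoin_def scale_left_diff_distrib sc.scale_left_diff_distrib algebra_simps
            intro!: exI[of _ "n - n'"] exI[of _ "a - a'"] graded_family_diff[OF fam])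
    next
      case False
      then show ?thesis using x y by (simp add: adjoin_def graded_family_diff[OF fam])
    qed }
  fix n r x assume r: "r \<in> G n" and x: "x \<in> adjoin scale sc N e v d"
  show "sc r x \<in> adjoin scale sc N e v (int n + d)"
  proof (cases "d = e")
    case True
    then obtain m a where m: "m \<in> N e" "x = m + sc (scale a 1) v"
      using x by (auto simp: adjoin_def)
    have eq: "sc r x = sc r m + sc (r * scale a 1) v" using m by (simp add: algebra_simps)
    have rm: "sc r m \<in> N (int n + e)" by (rule graded_family_scale[OF fam r m(1)])
    show ?thesis
    proof (cases "n = 0")
      case True
      then obtain b where "r = scale b 1" using r component_0 by auto
      then have "r * scale a 1 = scale (b * a) 1" using scale_mult[of b 1 "scale a 1"] by simp
      then show ?thesis using rm True \<open>d = e\<close> eq by (auto simp: adjoin_def)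
    next
      case False
      have "r * scale a 1 \<in> G n"
        using component_mult[OF r scalar_component, of a] by simp
      then have "sc (r * scale a 1) v \<in> N (int n + e)" using v False by simp
      then show ?thesis using eq rm True by (auto intro!: adjoin_base graded_family_add[OF fam])
    qed
  next
    case False
    then have "x \<in> N d" using x by (simp add: adjoin_def)
    then show ?thesis by (intro adjoin_base graded_family_scale[OF fam r])
  qed
qed

text \<open>
  If \<open>v\<close> is not in \<open>N\<close>, the quotient is a copy of \<open>K\<close> generated in degree \<open>e\<close>, and \<open>r \<mapsto> r v\<close>
  induces the isomorphism.
\<close>

lemma tor_vanishes_adjoin:
  assumes "residue_tor_vanishes j (d - e)"
  shows "tor_vanishes sc (adjoin scale sc N e v) N j d"
proof (cases "v \<in> N e")
  case True
  have "adjoin scale sc N e v d = N d" for d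
    using adjoin_base[of _ d] True by (auto simp: adjoin_def intro!: graded_family_add[OF fam] graded_family_scalar[OF fam])
  then show ?thesis
    using tor_vanishes_same[OF sc fam, of j d] tor_vanishes_cong[of "adjoin scale sc N e v" N N N] by simp
next
  case False
  interpret sc: module sc by (rule sc)
  have "tor_vanishes sc (adjoin scale sc N e v) N j (d - e + e)"
  proof (rule tor_vanishes_iso[where f = "\<lambda>r. sc r v" and s = e, OF module_ring_mult sc graded_family_ring
        graded_family_positive_part graded_family_adjoin fam _ _ _ _ _ _ assms])
    fix x y show "sc (x + y) v = sc x v + sc y v" by (simp add: algebra_simps)
  next
    fix r x show "sc (r * x) v = sc r (sc x v)" by simp
  next
    fix d' x assume x: "x \<in> int_component G d'"
    show "sc x v \<in> adjoin scale sc N e v (d' + e)"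
      using graded_family_scale_int[OF sc graded_family_adjoin x adjoin_generator] .
  next
    fix d' x assume x: "x \<in> positive_part G d'"
    then show "sc x v \<in> N (d' + e)"
      using v[of "nat d'" x] by (cases "d' \<le> 0") (auto simp: positive_part_def graded_family_zero[OF fam])
  next
    fix d' x assume x: "x \<in> int_component G d'" "sc x v \<in> N (d' + e)"
    show "x \<in> positive_part G d'"
    proof (cases "d' = 0")
      case True
      then obtain a where a: "x = scale a 1" using x component_0 by (auto simp: int_component_def)
      have "a = 0"
      proof (rule ccontr)
        assume "a \<noteq> 0"
        have "sc (scale (inverse a) 1) (sc x v) \<in> N e"
          using x True by (intro graded_family_scalar[OF fam]) simp
        moreover have "scale (inverse a) 1 * scale a 1 = 1"
          using scale_mult[of "inverse a" 1 "scale a 1"] \<open>a \<noteq> 0\<close> by simp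
        ultimately show False using False a by simp
      qed
      then show ?thesis using a True by (simp add: positive_part_def)
    qed (use x in \<open>auto simp: positive_part_def int_component_def split: if_splits\<close>)
  next
    fix d' y assume y: "y \<in> adjoin scale sc N e v (d' + e)"
    show "\<exists>x\<in>int_component G d'. y - sc x v \<in> N (d' + e)"
    proof (cases "d' = 0")
      case True
      then obtain n a where "n \<in> N e" "y = n + sc (scale a 1) v" using y by (auto simp: adjoin_def)
      then show ?thesis using True scalar_component by (intro bexI[of _ "scale a 1"]) (auto simp: int_component_def)
    next
      case False
      then show ?thesis using y graded_family_zero[OF graded_family_ring]
        by (intro bexI[of _ 0]) (auto simp: adjoin_def)
    qed
  qed
  then show ?thesis by simp
qed

end

text \<open>
  A module in a single degree is a \<open>K\<close>-vector space of arbitrary dimension. An element of \<open>M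
  \<otimes> P\<^sub>j\<close> has finitely many coefficients, and these lie in a submodule obtained by adjoining
  finitely many elements of degree \<open>e\<close> to \<open>N\<close>.
\<close>

lemma tor_vanishes_concentrated:
  assumes sc: "module sc" and fam: "graded_family G sc M" "graded_family G sc N"
    and sub: "\<And>d. N d \<subseteq> M d" and eq: "\<And>d. d \<noteq> e \<Longrightarrow> M d = N d"
    and t: "residue_tor_vanishes j (d - e)"
  shows "tor_vanishes sc M N j d"
proof (rule tor_vanishesI)
  have fin: "\<exists>W. graded_family G sc W \<and> (\<forall>d. N d \<subseteq> W d \<and> W d \<subseteq> M d) \<and> X \<subseteq> W e \<and> tor_vanishes sc W N j d"
    if "finite X" "X \<subseteq> M e" for X
    using that
  proof (induction X)
    case empty
    show ?case
      by (rule exI[of _ N]) (use fam sub tor_vanishes_same[OF sc fam(2)] in auto)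
  next
    case (insert v X)
    then obtain W where W: "graded_family G sc W" "\<And>d. N d \<subseteq> W d" "\<And>d. W d \<subseteq> M d" "X \<subseteq> W e"
      "tor_vanishes sc W N j d" by auto
    have v: "sc r v \<in> W (int n + e)" if "n \<ge> 1" "r \<in> G n" for n r
      using graded_family_scale[OF fam(1) that(2), of v e] insert.prems eq[of "int n + e"] W(2) that by auto
    let ?W = "adjoin scale sc W e v"
    have a: "tor_vanishes sc ?W W j d" by (rule tor_vanishes_adjoin[OF sc W(1) v t])
    have f: "graded_family G sc ?W" by (rule graded_family_adjoin[OF sc W(1) v])
    have WW: "W d \<subseteq> ?W d" for d using adjoin_base[OF sc W(1) v] by blast
    have WM: "?W d \<subseteq> M d" for d
      using W(3)[of d] insert.prems by (auto simp: adjoin_def intro!: graded_family_add[OF fam(1)] graded_family_scalar[OF fam(1)])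
    have "tor_vanishes sc ?W N j d"
      by (rule tor_vanishes_middle[OF sc fam(2) W(1) f W(2) WW W(5) a])
    moreover have "v \<in> ?W e" by (rule adjoin_generator[OF sc W(1) v])
    ultimately show ?case
      using f W(2,4) WW WM by (intro exI[of _ ?W]) blast
  qed
  fix z assume z: "z \<in> T M j d" "\<And>k. j = Suc k \<Longrightarrow> tensor_map sc (g k) z \<in> T N k d"
  have "finite (lookup z ` keys z \<inter> M e)" by simp
  from fin[OF this] obtain W where W: "graded_family G sc W" "\<And>d. N d \<subseteq> W d" "\<And>d. W d \<subseteq> M d"
    "lookup z ` keys z \<inter> M e \<subseteq> W e" "tor_vanishes sc W N j d" by auto
  have "z \<in> T W j d"
  proof (rule tensor_partI)
    fix b assume b: "b \<in> B j"
    have m: "lookup z b \<in> M (d - \<delta> j b)" by (rule tensor_partD(1)[OF z(1) b])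
    show "lookup z b \<in> W (d - \<delta> j b)"
    proof (cases "d - \<delta> j b = e \<and> b \<in> keys z")
      case True
      then show ?thesis using m W(4) by auto
    next
      case False
      then show ?thesis using m eq[of "d - \<delta> j b"] W(2) graded_family_zero[OF W(1)] by (auto simp: in_keys_iff)
    qed
  qed (rule tensor_partD(2)[OF z(1)])
  from tor_vanishesE[OF W(5) this z(2)] obtain y where "y \<in> T W (Suc j) d" "z - tensor_map sc (g j) y \<in> T N j d" .
  then show "\<exists>y\<in>T M (Suc j) d. z - tensor_map sc (g j) y \<in> T N j d"
    using tensor_part_mono[of _ _ _ W _ M] W(3) by blast
qed

text \<open>
  A module in boundedly many degrees is filtered by its truncations, whose successive
  quotients are concentrated in one degree.
\<close>

lemma tor_vanishes_bounded:
  assumes sc: "module sc" and fam: "graded_family G sc M" "graded_family G sc N"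
    and sub: "\<And>d. N d \<subseteq> M d" and lo: "\<And>d. d < lo \<Longrightarrow> M d = N d" and hi: "\<And>d. d > hi \<Longrightarrow> M d = N d"
    and t: "\<And>e. e \<le> hi \<Longrightarrow> residue_tor_vanishes j (d - e)"
  shows "tor_vanishes sc M N j d"
proof -
  (* the truncation of M to its n highest degrees *)
  define F where "F n = (\<lambda>d. if d > hi - int n then M d else N d)" for n
  have famF: "graded_family G sc (F n)" for n
  proof (rule graded_familyI)
    fix k d' r x assume r: "r \<in> G k" and x: "x \<in> F n d'"
    have "sc r x \<in> M (int k + d')"
      using x sub graded_family_scale[OF fam(1) r, of x d'] by (auto simp: F_def split: if_splits)
    then show "sc r x \<in> F n (int k + d')"
      using x graded_family_scale[OF fam(2) r, of x d'] by (auto simp: F_def split: if_splits)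
  qed (auto simp: F_def graded_family_zero[OF fam(1)] graded_family_zero[OF fam(2)]
      graded_family_diff[OF fam(1)] graded_family_diff[OF fam(2)])
  have step: "tor_vanishes sc (F n) N j d" for n
  proof (induction n)
    case 0
    have "F 0 d = N d" for d using hi by (auto simp: F_def)
    then show ?case using tor_vanishes_same[OF sc fam(2), of j d] tor_vanishes_cong[of "F 0" N N N] by simp
  next
    case (Suc n)
    have "tor_vanishes sc (F (Suc n)) (F n) j d"
      by (rule tor_vanishes_concentrated[OF sc famF famF, where e = "hi - int n"])
        (use sub t in \<open>auto simp: F_def\<close>)
    then show ?case
      by (intro tor_vanishes_middle[OF sc fam(2) famF famF _ _ Suc]) (use sub in \<open>auto simp: F_def\<close>)
  qed
  have "F (nat (hi - lo + 1)) d = M d" for d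
    using lo[of d] by (auto simp: F_def)
  then show ?thesis
    using step[of "nat (hi - lo + 1)"] tor_vanishes_cong[of "F (nat (hi - lo + 1))" M N N] by simp
qed

text \<open>
  The module is the direct sum of copies of \<open>M\<close> shifted by \<open>\<gamma> b\<close>, one for each \<open>b\<close> in \<open>C\<close>.
  Any given tensor involves finitely many of the summands, and these are split off one by
  one.
\<close>

lemma tor_vanishes_direct_sum:
  assumes sc: "module sc" and fam: "graded_family G sc M"
    and t: "\<And>b. b \<in> C \<Longrightarrow> tor_vanishes sc M (\<lambda>d. {0}) j (d - \<gamma> b)"
  shows "tor_vanishes (\<lambda>r. Poly_Mapping.map (sc r)) (tensor_part C \<gamma> M) (\<lambda>d. {0}) j d"
proof (rule tor_vanishesI)
  interpret sc: module sc by (rule sc)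
  let ?sc = "\<lambda>r. Poly_Mapping.map (sc r)"
  note sc' = module_map[OF sc]
  have fam': "graded_family G ?sc (tensor_part D \<gamma> M)" for D by (rule graded_family_tensor_part[OF sc fam])
  have fam0: "graded_family G ?sc (\<lambda>d. {0})" by (rule graded_family_trivial[OF sc'])
  have fin: "tor_vanishes ?sc (tensor_part D \<gamma> M) (\<lambda>d. {0}) j d" if "finite D" "D \<subseteq> C" for D
    using that
  proof (induction D)
    case empty
    have "tensor_part {} \<gamma> M d = {0}" for d
      by (auto simp: tensor_part_def intro!: poly_mapping_eqI)
    then show ?case
      using tor_vanishes_same[OF sc' fam0, of j d] tor_vanishes_cong[of "tensor_part {} \<gamma> M" "\<lambda>d. {0}" "\<lambda>d. {0}" "\<lambda>d. {0}"] by simp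
  next
    case (insert b D)
    have "tor_vanishes ?sc (tensor_part (insert b D) \<gamma> M) (tensor_part D \<gamma> M) j (d - \<gamma> b + \<gamma> b)"
    proof (rule tor_vanishes_iso[where f = "single b" and s = "\<gamma> b", OF sc sc' fam
          graded_family_trivial[OF sc] fam' fam'])
      show "tor_vanishes sc M (\<lambda>d. {0}) j (d - \<gamma> b)" using t insert by auto
    next
      fix d' y assume y: "y \<in> tensor_part (insert b D) \<gamma> M (d' + \<gamma> b)"
      show "\<exists>x\<in>M d'. y - single b x \<in> tensor_part D \<gamma> M (d' + \<gamma> b)"
        by (rule bexI[of _ "lookup y b"])
          (use y insert.hyps in \<open>auto simp: tensor_part_def lookup_minus lookup_single when_def\<close>)
    next
      fix d' x assume x: "x \<in> M d'" "single b x \<in> tensor_part D \<gamma> M (d' + \<gamma> b)"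
      then show "x \<in> {0}" using insert.hyps by (auto simp: tensor_part_def lookup_single when_def)
    qed (auto simp: single_add tensor_part_def lookup_single when_def graded_family_zero[OF fam])
    then have step: "tor_vanishes ?sc (tensor_part (insert b D) \<gamma> M) (tensor_part D \<gamma> M) j d" by simp
    have sub: "tensor_part D \<gamma> M e \<subseteq> tensor_part (insert b D) \<gamma> M e" for e
      by (auto simp: tensor_part_def graded_family_zero[OF fam])
    have sub0: "{0} \<subseteq> tensor_part D \<gamma> M e" for e
      by (simp add: tensor_part_def graded_family_zero[OF fam])
    have "tor_vanishes ?sc (tensor_part D \<gamma> M) (\<lambda>d. {0}) j d"
      by (rule insert.IH) (use insert.prems in simp)
    then show ?case
      by (rule tor_vanishes_middle[OF sc' fam0 fam' fam' sub0 sub _ step])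
  qed
  fix z assume z: "z \<in> T (tensor_part C \<gamma> M) j d" "\<And>k. j = Suc k \<Longrightarrow> tensor_map ?sc (g k) z \<in> T (\<lambda>d. {0}) k d"
  define D where "D = (\<Union>b\<in>keys z. keys (lookup z b))"
  have D: "finite D" "D \<subseteq> C"
    using tensor_partD(1,3)[OF z(1)] by (auto simp: D_def tensor_part_def in_keys_iff)
  have "z \<in> T (tensor_part D \<gamma> M) j d"
  proof (rule tensor_partI)
    fix b assume b: "b \<in> B j"
    have "lookup (lookup z b) c = 0" if "c \<notin> D" for c
      using that by (cases "b \<in> keys z") (auto simp: D_def in_keys_iff)
    then show "lookup z b \<in> tensor_part D \<gamma> M (d - \<delta> j b)"
      using tensor_partD(1)[OF z(1) b] D(2) by (auto simp: tensor_part_def)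
  qed (rule tensor_partD(2)[OF z(1)])
  from tor_vanishesE[OF fin[OF D] this z(2)] obtain y where
    y: "y \<in> T (tensor_part D \<gamma> M) (Suc j) d" "z - tensor_map ?sc (g j) y \<in> T (\<lambda>d. {0}) j d" .
  have "tensor_part D \<gamma> M e \<subseteq> tensor_part C \<gamma> M e" for e
  proof
    fix x assume x: "x \<in> tensor_part D \<gamma> M e"
    show "x \<in> tensor_part C \<gamma> M e"
    proof (rule tensor_partI)
      fix b show "lookup x b \<in> M (e - \<gamma> b)"
        using tensor_partD(1,2)[OF x, of b] graded_family_zero[OF fam] by (cases "b \<in> D") auto
    qed (use tensor_partD(2)[OF x] D(2) in blast)
  qed
  then show "\<exists>y\<in>T (tensor_part C \<gamma> M) (Suc j) d. z - tensor_map ?sc (g j) y \<in> T (\<lambda>d. {0}) j d"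
    using y tensor_part_mono[of y _ _ "tensor_part D \<gamma> M" d "tensor_part C \<gamma> M"] by blast
qed

end

section \<open>Homogeneous components, the maximal ideal and the residue map\<close>

definition independent_family :: "(int \<Rightarrow> 'm::ab_group_add set) \<Rightarrow> bool" where
  "independent_family M \<longleftrightarrow> (\<forall>D f. finite D \<longrightarrow> (\<forall>d\<in>D. f d \<in> M d) \<longrightarrow> sum f D = 0 \<longrightarrow> (\<forall>d\<in>D. f d = 0))"

lemma independent_familyD:
  "independent_family M \<Longrightarrow> finite D \<Longrightarrow> (\<And>d. d \<in> D \<Longrightarrow> f d \<in> M d) \<Longrightarrow> sum f D = 0 \<Longrightarrow> d \<in> D \<Longrightarrow> f d = 0"
  unfolding independent_family_def by blast

lemma independent_family_mono:
  "independent_family M \<Longrightarrow> (\<And>d. N d \<subseteq> M d) \<Longrightarrow> independent_family N"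
  unfolding independent_family_def by (meson subsetD)

lemma independent_family_tensor_part:
  assumes "independent_family M"
  shows "independent_family (tensor_part B \<delta> M)"
  unfolding independent_family_def
proof (intro allI impI ballI)
  fix D :: "int set" and f d
  assume D: "finite D" "\<forall>d\<in>D. f d \<in> tensor_part B \<delta> M d" "sum f D = 0" "d \<in> D"
  show "f d = 0"
  proof (rule poly_mapping_eqI)
    fix b
    have s: "(\<Sum>d\<in>D. lookup (f d) b) = 0"
      using arg_cong[OF D(3), of "\<lambda>x. lookup x b"] by (simp add: lookup_sum)
    show "lookup (f d) b = lookup 0 b"
    proof (cases "b \<in> B")
      case True
      have "lookup (f (d - \<delta> b + \<delta> b)) b = 0"
      proof (rule independent_familyD[OF assms, of "(\<lambda>d. d - \<delta> b) ` D" "\<lambda>e. lookup (f (e + \<delta> b)) b"])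
        show "(\<Sum>e\<in>(\<lambda>d. d - \<delta> b) ` D. lookup (f (e + \<delta> b)) b) = 0"
          using s by (subst sum.reindex) (auto simp: inj_on_def)
      qed (use D True in \<open>auto simp: tensor_part_def\<close>)
      then show ?thesis by simp
    next
      case False
      then show ?thesis using D by (auto simp: tensor_part_def)
    qed
  qed
qed

context standard_graded_algebra
begin

definition homogeneous_part :: "'r \<Rightarrow> nat \<Rightarrow> 'r" where
  "homogeneous_part x = (THE f. (\<forall>d. f d \<in> G d) \<and> finite {d. f d \<noteq> 0} \<and> x = (\<Sum>d\<in>{d. f d \<noteq> 0}. f d))"

lemma homogeneous_part:
  "homogeneous_part x d \<in> G d" "finite {d. homogeneous_part x d \<noteq> 0}"
  "(\<Sum>d\<in>{d. homogeneous_part x d \<noteq> 0}. homogeneous_part x d) = x"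
  using theI'[OF decomposition[of x]] unfolding homogeneous_part_def by auto

text \<open>
  Allowing any finite set \<open>D\<close> containing the support makes the components of a sum
  computable.
\<close>

lemma homogeneous_part_unique:
  assumes "\<And>d. f d \<in> G d" "finite D" "\<And>d. d \<notin> D \<Longrightarrow> f d = 0" "x = sum f D"
  shows "homogeneous_part x = f"
proof -
  have s: "{d. f d \<noteq> 0} \<subseteq> D" using assms(3) by auto
  then have "finite {d. f d \<noteq> 0}" using assms(2) finite_subset by blast
  moreover have "x = (\<Sum>d\<in>{d. f d \<noteq> 0}. f d)"
    unfolding assms(4) by (rule sum.mono_neutral_right) (use assms(2) s in auto)
  ultimately show ?thesis
    unfolding homogeneous_part_def by (intro the1_equality[OF decomposition]) (use assms(1) in auto)
qed

lemma component_add: "x \<in> G d \<Longrightarrow> y \<in> G d \<Longrightarrow> x + y \<in> G d"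
  using component_subspace subspace_add by blast

lemma homogeneous_part_sum_superset:
  assumes "finite D" "{d. homogeneous_part x d \<noteq> 0} \<subseteq> D"
  shows "sum (homogeneous_part x) D = x"
  using sum.mono_neutral_right[OF assms, of "homogeneous_part x"] homogeneous_part(3)[of x] by auto

lemma homogeneous_part_add: "homogeneous_part (x + y) d = homogeneous_part x d + homogeneous_part y d"
proof -
  let ?D = "{d. homogeneous_part x d \<noteq> 0} \<union> {d. homogeneous_part y d \<noteq> 0}"
  have "homogeneous_part (x + y) = (\<lambda>d. homogeneous_part x d + homogeneous_part y d)"
    by (rule homogeneous_part_unique[of _ ?D])
      (auto simp: homogeneous_part component_add sum.distrib homogeneous_part_sum_superset)
  then show ?thesis by simp
qed

lemma homogeneous_part_homogeneous:
  assumes "x \<in> G d"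
  shows "homogeneous_part x e = (if e = d then x else 0)"
proof -
  have "homogeneous_part x = (\<lambda>e. if e = d then x else 0)"
    by (rule homogeneous_part_unique[of _ "{d}"]) (use assms in auto)
  then show ?thesis by simp
qed

lemma homogeneous_part_0 [simp]: "homogeneous_part 0 d = 0"
  using homogeneous_part_homogeneous[of 0 d d] by simp

lemma homogeneous_part_sum: "homogeneous_part (sum f S) d = (\<Sum>a\<in>S. homogeneous_part (f a) d)"
  by (induction S rule: infinite_finite_induct) (auto simp: homogeneous_part_add)

lemma independent_ring: "independent_family (int_component G)"
  unfolding independent_family_def
proof (intro allI impI ballI)
  fix D :: "int set" and f :: "int \<Rightarrow> 'r" and d
  assume D: "finite D" "\<forall>d\<in>D. f d \<in> int_component G d" "sum f D = 0" "d \<in> D"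
  show "f d = 0"
  proof (cases "d < 0")
    case True
    then show ?thesis using D(2,4) by (auto simp: int_component_def)
  next
    case False
    have "homogeneous_part (f e) (nat d) = (if e = d then f d else 0)" if "e \<in> D" for e
    proof (cases "e < 0")
      case True
      then have "f e = 0" using D(2) that by (auto simp: int_component_def)
      then show ?thesis using True False by auto
    next
      case e: False
      then have "f e \<in> G (nat e)" using D(2) that by (auto simp: int_component_def)
      from homogeneous_part_homogeneous[OF this] show ?thesis using e False by auto
    qed
    then have "(\<Sum>e\<in>D. homogeneous_part (f e) (nat d)) = (\<Sum>e\<in>D. if e = d then f d else 0)"
      by (intro sum.cong) auto
    also have "\<dots> = f d" unfolding sum.delta[OF D(1)] using D(4) by (simp only: if_True)
    finally show ?thesis using D(3) homogeneous_part_sum[of f D "nat d"] by simp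
  qed
qed

abbreviation "max_ideal \<equiv> max_homogeneous_ideal G"

lemma max_ideal_subspace: "module.subspace (*) max_ideal"
  unfolding max_homogeneous_ideal_def by (rule module.subspace_span[OF module_ring_mult])

lemma max_ideal_positive: "x \<in> G d \<Longrightarrow> d \<ge> 1 \<Longrightarrow> x \<in> max_ideal"
  unfolding max_homogeneous_ideal_def by (rule module.span_base[OF module_ring_mult]) auto

lemma homogeneous_part_mult_positive:
  assumes "x \<in> G d" "d \<ge> 1"
  shows "homogeneous_part (c * x) 0 = 0"
proof -
  let ?D = "{e. homogeneous_part c e \<noteq> 0}"
  have "c * x = sum (homogeneous_part c) ?D * x"
    by (simp only: homogeneous_part(3))
  then have "homogeneous_part (c * x) 0 = (\<Sum>e\<in>?D. homogeneous_part (homogeneous_part c e * x) 0)"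
    by (simp only: sum_distrib_right homogeneous_part_sum)
  also have "\<dots> = 0"
  proof (rule sum.neutral, rule ballI)
    fix e
    have "homogeneous_part c e * x \<in> G (e + d)"
      by (rule component_mult[OF homogeneous_part(1) assms(1)])
    from homogeneous_part_homogeneous[OF this, of 0]
    show "homogeneous_part (homogeneous_part c e * x) 0 = 0"
      using assms(2) by simp
  qed
  finally show ?thesis .
qed

lemma max_ideal_iff: "x \<in> max_ideal \<longleftrightarrow> homogeneous_part x 0 = 0"
proof
  assume x: "x \<in> max_ideal"
  show "homogeneous_part x 0 = 0"
  proof (rule module.span_induct_alt[OF module_ring_mult x[unfolded max_homogeneous_ideal_def],
        where h = "\<lambda>x. homogeneous_part x 0 = 0"])
    fix c x y assume "x \<in> (\<Union>d\<in>{1..}. G d)" and y: "homogeneous_part y 0 = 0"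
    then obtain d where "x \<in> G d" "d \<ge> 1" by auto
    from homogeneous_part_mult_positive[OF this] show "homogeneous_part (c * x + y) 0 = 0"
      using y by (simp only: homogeneous_part_add add_0)
  qed (rule homogeneous_part_0)
next
  assume *: "homogeneous_part x 0 = 0"
  have "(\<Sum>d\<in>{d. homogeneous_part x d \<noteq> 0}. homogeneous_part x d) \<in> max_ideal"
  proof (rule module.subspace_sum[OF module_ring_mult max_ideal_subspace])
    fix d assume "d \<in> {d. homogeneous_part x d \<noteq> 0}"
    then have "d \<ge> 1" using * by (cases d) auto
    then show "homogeneous_part x d \<in> max_ideal"
      by (rule max_ideal_positive[OF homogeneous_part(1)])
  qed
  then show "x \<in> max_ideal" by (simp only: homogeneous_part(3))
qed

text \<open>
  In single degrees the maximal ideal is everything or zero.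
\<close>

lemma max_ideal_int_component: "x \<in> int_component G d \<Longrightarrow> x \<in> max_ideal \<longleftrightarrow> x \<in> positive_part G d"
  using homogeneous_part_homogeneous[of x "nat d" 0]
  by (auto simp: max_ideal_iff int_component_def positive_part_def split: if_splits)

lemma scalar_inject: "scale a 1 = scale b 1 \<Longrightarrow> a = b"
proof -
  assume "scale a 1 = scale b 1"
  then have "scale (a - b) 1 = 0" by (simp add: scale_left_diff_distrib)
  then show "a = b" using scale_eq_0_iff by auto
qed

lemma scalar_mult: "scale a 1 * scale b 1 = scale (a * b) 1"
  using scale_mult[of a 1 "scale b 1"] by simp

abbreviation "res \<equiv> residue scale G"

lemma residue_in: "r - scale (res r) 1 \<in> max_ideal"
proof -
  have ex1: "\<exists>!a. r - scale a 1 \<in> max_ideal"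
  proof -
    obtain a where a: "homogeneous_part r 0 = scale a 1"
      using homogeneous_part(1)[of r 0] component_0 by auto
    have *: "homogeneous_part (r - scale b 1) 0 = homogeneous_part r 0 - scale b 1" for b
      using homogeneous_part_add[of "r - scale b 1" "scale b 1" 0]
        homogeneous_part_homogeneous[OF scalar_component, of b 0] by simp
    show ?thesis
      by (rule ex1I[of _ a]) (use scalar_inject in \<open>auto simp: max_ideal_iff * a\<close>)
  qed
  show ?thesis unfolding residue_def by (rule theI'[OF ex1])
qed

lemma residue_unique:
  assumes "r - scale a 1 \<in> max_ideal"
  shows "res r = a"
proof -
  have "(r - scale (res r) 1) - (r - scale a 1) \<in> max_ideal"
    by (rule module.subspace_diff[OF module_ring_mult max_ideal_subspace residue_in assms])
  then have "scale (a - res r) 1 \<in> max_ideal" by (simp add: scale_left_diff_distrib)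
  then have "scale (a - res r) 1 = 0"
    using homogeneous_part_homogeneous[OF scalar_component] by (simp add: max_ideal_iff)
  then show ?thesis using scalar_inject[of "a - res r" 0] by simp
qed

lemma residue_scalar [simp]: "res (scale a 1) = a"
  by (rule residue_unique) (simp add: module.subspace_0[OF module_ring_mult max_ideal_subspace])

lemma residue_positive: "x \<in> G d \<Longrightarrow> d \<ge> 1 \<Longrightarrow> res x = 0"
  by (rule residue_unique) (simp add: max_ideal_positive)

lemma residue_0 [simp]: "res 0 = 0" and residue_1 [simp]: "res 1 = 1"
  using residue_scalar[of 0] residue_scalar[of 1] by auto

lemma residue_add: "res (r + s) = res r + res s"
proof (rule residue_unique)
  have "(r - scale (res r) 1) + (s - scale (res s) 1) \<in> max_ideal"
    by (rule module.subspace_add[OF module_ring_mult max_ideal_subspace residue_in residue_in])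
  then show "r + s - scale (res r + res s) 1 \<in> max_ideal"
    by (simp add: scale_left_distrib algebra_simps)
qed

lemma residue_mult: "res (r * s) = res r * res s"
proof (rule residue_unique)
  have eq: "s * (r - A) + A * (s - B) = r * s - A * B" for A B :: 'r
    by (simp add: algebra_simps)
  have "s * (r - scale (res r) 1) + scale (res r) 1 * (s - scale (res s) 1) \<in> max_ideal"
    by (intro module.subspace_add[OF module_ring_mult max_ideal_subspace]
        module.subspace_scale[OF module_ring_mult max_ideal_subspace] residue_in)
  then show "r * s - scale (res r * res s) 1 \<in> max_ideal"
    unfolding eq scalar_mult .
qed

lemma residue_sum: "res (sum f S) = (\<Sum>a\<in>S. res (f a))"
  by (induction S rule: infinite_finite_induct) (auto simp: residue_add)

lemma module_residue: "module (\<lambda>r a. res r * a)"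
  by standard (simp_all add: residue_add residue_mult distrib_left distrib_right)

text \<open>
  \<open>P n\<close> is the set of products of \<open>n\<close> generators of degree \<open>1\<close>. Their span over all \<open>n\<close> is a
  subalgebra containing the generators, hence everything, and a product of \<open>m + n\<close>
  generators can be cut after the first \<open>m\<close> factors.
\<close>

lemma generating_monomials:
  obtains P where "\<And>n. finite (P n)" "\<And>n. P n \<subseteq> G n" "\<And>n. G n = span (P n)"
    "\<And>m n. P (m + n) \<subseteq> {x * y | x y. x \<in> P m \<and> y \<in> P n}"
proof -
  obtain X where X: "finite X" "X \<subseteq> G 1"
    "\<forall>A. X \<subseteq> A \<and> 1 \<in> A \<and> subspace A \<and> (\<forall>x\<in>A. \<forall>y\<in>A. x * y \<in> A) \<longrightarrow> A = UNIV"
    using generated_in_degree_1 by (elim exE conjE)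
  define P where "P n = prod_list ` {xs. set xs \<subseteq> X \<and> length xs = n}" for n
  have fin: "finite (P n)" for n
    unfolding P_def by (intro finite_imageI finite_lists_length_eq X)
  have "prod_list xs \<in> G (length xs)" if "set xs \<subseteq> X" for xs
    using that
  proof (induction xs)
    case (Cons x xs)
    then show ?case using component_mult[of x 1 "prod_list xs" "length xs"] X(2) by auto
  qed (simp add: one_in_component_0)
  then have PG: "P n \<subseteq> G n" for n unfolding P_def by auto
  let ?Q = "\<Union>n. P n"
  have Qmult: "x * y \<in> ?Q" if xy: "x \<in> ?Q" "y \<in> ?Q" for x y
  proof -
    obtain xs ys where "set xs \<subseteq> X" "set ys \<subseteq> X" "x = prod_list xs" "y = prod_list ys"
      using xy by (auto simp: P_def)
    then have "x * y = prod_list (xs @ ys) \<and> set (xs @ ys) \<subseteq> X" by simp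
    then show ?thesis unfolding P_def by blast
  qed
  have mult1: "x * y \<in> span ?Q" if "x \<in> ?Q" "y \<in> span ?Q" for x y
    using that(2)
  proof (induction rule: span_induct_alt)
    case (step c q y)
    then have "x * q \<in> span ?Q" using Qmult[OF that(1)] span_base by blast
    moreover have "x * (scale c q + y) = scale c (x * q) + x * y"
      using scale_mult[of c q x] by (simp add: algebra_simps)
    ultimately show ?case using step by (simp add: span_add span_scale)
  qed (simp add: span_zero)
  have mult: "x * y \<in> span ?Q" if "x \<in> span ?Q" "y \<in> span ?Q" for x y
    using that(1)
  proof (induction rule: span_induct_alt)
    case (step c q x)
    have "(scale c q + x) * y = scale c (q * y) + x * y"
      using scale_mult[of c q y] by (simp add: algebra_simps)
    then show ?case using step mult1[OF _ that(2)] by (simp add: span_add span_scale)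
  qed (simp add: span_zero)
  have X1: "x \<in> P 1" if "x \<in> X" for x
    using that unfolding P_def by (auto intro!: image_eqI[of _ _ "[x]"])
  have "1 \<in> P 0" unfolding P_def by (auto intro!: image_eqI[of _ _ "[]"])
  then have all: "span ?Q = UNIV"
    by (intro X(3)[rule_format]) (use X1 mult in \<open>auto intro!: span_base\<close>)
  have part: "homogeneous_part x n \<in> span (P n)" for x n
  proof -
    have "x \<in> span ?Q" using all by simp
    then show ?thesis
    proof (induction rule: span_induct_alt)
      case (step c q x)
      then obtain m where m: "q \<in> P m" by auto
      then have "scale c q \<in> G m" using PG component_subspace subspace_scale by blast
      moreover have "scale c q \<in> span (P m)" using m by (intro span_scale span_base)
      ultimately have "homogeneous_part (scale c q) n \<in> span (P n)"
        by (simp add: homogeneous_part_homogeneous span_zero)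
      then show ?case using step by (auto simp: homogeneous_part_add intro: span_add)
    qed (simp add: span_zero)
  qed
  show thesis
  proof (rule that[of P])
    show "G n = span (P n)" for n
    proof
      show "G n \<subseteq> span (P n)"
      proof
        fix x assume "x \<in> G n"
        then show "x \<in> span (P n)" using part[of x n] homogeneous_part_homogeneous[of x n n] by simp
      qed
      show "span (P n) \<subseteq> G n"
        by (rule span_minimal[OF PG component_subspace])
    qed
    show "P (m + n) \<subseteq> {x * y | x y. x \<in> P m \<and> y \<in> P n}" for m n
    proof
      fix p assume "p \<in> P (m + n)"
      then obtain xs where xs: "set xs \<subseteq> X" "length xs = m + n" "p = prod_list xs" by (auto simp: P_def)
      then have "p = prod_list (take m xs) * prod_list (drop m xs)"
        by (simp flip: prod_list.append)
      moreover have "prod_list (take m xs) \<in> P m" "prod_list (drop m xs) \<in> P n"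
        using xs set_take_subset[of m xs] set_drop_subset[of m xs] by (auto simp: P_def intro!: imageI)
      ultimately show "p \<in> {x * y | x y. x \<in> P m \<and> y \<in> P n}" by blast
    qed
  qed (use fin PG in auto)
qed

lemma component_finite_span: "\<exists>X. finite X \<and> G n \<subseteq> span X"
  by (rule generating_monomials) (metis order_refl)

text \<open>
  Cut a product of \<open>c + m\<close> generators of degree \<open>1\<close> after \<open>c\<close> factors and expand the first
  part in the elements of \<open>bs\<close>. In other words, the ideal generated by \<open>bs\<close> contains every
  component of degree at least \<open>c\<close>.
\<close>

lemma component_sum_split:
  assumes bs: "span (set bs) = G c" and x: "x \<in> G (c + m)"
  shows "\<exists>s. (\<forall>k. s k \<in> G m) \<and> x = (\<Sum>k<length bs. bs ! k * s k)"
proof -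
  obtain P where "\<And>n. finite (P n)" and P: "\<And>n. P n \<subseteq> G n" "\<And>n. G n = span (P n)"
    "\<And>m n. P (m + n) \<subseteq> {x * y | x y. x \<in> P m \<and> y \<in> P n}"
    by (rule generating_monomials) blast
  let ?S = "{x. \<exists>s. (\<forall>k. s k \<in> G m) \<and> x = (\<Sum>k<length bs. bs ! k * s k)}"
  have "subspace ?S"
  proof (rule subspaceI)
    show "0 \<in> ?S" by (auto intro!: exI[of _ "\<lambda>_. 0"])
  next
    fix x y assume "x \<in> ?S" "y \<in> ?S"
    then obtain s t where "\<forall>k. s k \<in> G m" "\<forall>k. t k \<in> G m"
      "x = (\<Sum>k<length bs. bs ! k * s k)" "y = (\<Sum>k<length bs. bs ! k * t k)" by auto
    then show "x + y \<in> ?S"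
      by (auto intro!: exI[of _ "\<lambda>k. s k + t k"] component_add simp: sum.distrib algebra_simps)
  next
    fix a x assume "x \<in> ?S"
    then obtain s where s: "\<forall>k. s k \<in> G m" "x = (\<Sum>k<length bs. bs ! k * s k)" by auto
    have "scale a (y * z) = y * scale a z" for y z
      using scale_mult[of a z y] by (simp add: mult.commute)
    then have "scale a x = (\<Sum>k<length bs. bs ! k * scale a (s k))"
      unfolding s(2) scale_sum_right by simp
    moreover have "scale a (s k) \<in> G m" for k
      using s(1) component_subspace subspace_scale by blast
    ultimately show "scale a x \<in> ?S" by (intro CollectI exI[of _ "\<lambda>k. scale a (s k)"] conjI allI)
  qed
  moreover have "P (c + m) \<subseteq> ?S"
  proof
    fix p assume "p \<in> P (c + m)"
    then obtain y z where p: "p = y * z" "y \<in> P c" "z \<in> P m" using P(3) by blast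
    have z: "z \<in> G m" using p P(1) by blast
    have "y \<in> span (set bs)" using p P(1) bs by blast
    then have "y * z \<in> ?S"
    proof (induction rule: span_induct_alt)
      case base
      show ?case using subspace_0[OF \<open>subspace ?S\<close>] by simp
    next
      case (step a v y)
      then obtain k where k: "k < length bs" "v = bs ! k" by (auto simp: in_set_conv_nth)
      have "scale a (v * z) \<in> ?S"
      proof (rule subspace_scale[OF \<open>subspace ?S\<close>])
        have "v * z = (\<Sum>j<length bs. bs ! j * (if j = k then z else 0))"
          using k by (simp add: if_distrib cong: if_cong)
        then show "v * z \<in> ?S" using z by (auto intro!: exI[of _ "\<lambda>j. if j = k then z else 0"])
      qed
      moreover have "(scale a v + y) * z = scale a (v * z) + y * z"
        using scale_mult[of a v z] by (simp add: algebra_simps)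
      ultimately show ?case using step subspace_add[OF \<open>subspace ?S\<close>] by simp
    qed
    then show "p \<in> ?S" using p by simp
  qed
  ultimately have "span (P (c + m)) \<subseteq> ?S" by (intro span_minimal)
  then show ?thesis using x P(2) by blast
qed

end

section \<open>Graded free resolutions\<close>

definition linear_extension :: "('r::zero \<Rightarrow> 'm::comm_monoid_add \<Rightarrow> 'm) \<Rightarrow> ('b \<Rightarrow> 'm) \<Rightarrow> ('b \<Rightarrow>\<^sub>0 'r) \<Rightarrow> 'm" where
  "linear_extension sc g x = (\<Sum>b\<in>keys x. sc (lookup x b) (g b))"

lemma linear_extension_superset:
  assumes "module sc" "finite S" "keys x \<subseteq> S"
  shows "linear_extension sc g x = (\<Sum>b\<in>S. sc (lookup x b) (g b))"
  unfolding linear_extension_def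
  by (rule sum.mono_neutral_left) (use assms in \<open>auto simp: in_keys_iff module.scale_zero_left\<close>)

lemma keys_fscale: "keys (fscale r x) \<subseteq> keys x"
  by (auto simp: in_keys_iff)

lemma linear_extension_single: "module sc \<Longrightarrow> linear_extension sc g (single b r) = sc r (g b)"
  by (subst linear_extension_superset[of sc "{b}"]) auto

lemma linear_extension_add:
  assumes "module sc"
  shows "linear_extension sc g (x + y) = linear_extension sc g x + linear_extension sc g y"
proof -
  have "keys (x + y) \<subseteq> keys x \<union> keys y" by (rule Poly_Mapping.keys_add)
  then show ?thesis
    by (simp add: linear_extension_superset[OF assms, of "keys x \<union> keys y"] lookup_add
        module.scale_left_distrib[OF assms] sum.distrib)
qed

lemma module_hom_linear_extension:
  fixes g :: "'b \<Rightarrow> 'm::ab_group_add" and sc :: "'r::comm_ring_1 \<Rightarrow> 'm \<Rightarrow> 'm"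
  assumes "module sc"
  shows "module_hom fscale sc (linear_extension sc g)"
proof (rule module_hom.intro[OF module_fscale assms], rule module_hom_axioms.intro)
  fix x y show "linear_extension sc g (x + y) = linear_extension sc g x + linear_extension sc g y"
    by (rule linear_extension_add[OF assms])
next
  fix r and x :: "'b \<Rightarrow>\<^sub>0 'r"
  have "keys (fscale r x) \<subseteq> keys x" by (auto simp: in_keys_iff)
  then show "linear_extension sc g (fscale r x) = sc r (linear_extension sc g x)"
    by (simp add: linear_extension_superset[OF assms, of "keys x"] module.scale_sum_right[OF assms]
        module.scale_scale[OF assms])
qed

lemma linear_extension_eq_tensor_map: "linear_extension fscale g = tensor_map (*) g"
proof (rule ext, rule poly_mapping_eqI)
  fix x c show "lookup (linear_extension fscale g x) c = lookup (tensor_map (*) g x) c"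
    by (simp add: linear_extension_def lookup_sum lookup_tensor_map[OF module_ring_mult finite_keys order_refl] mult.commute)
qed

text \<open>
  A linear map on a free module is determined by its values on the basis.
\<close>

lemma module_hom_eq_linear_extension:
  assumes "module_hom fscale sc h"
  shows "h x = linear_extension sc (\<lambda>b. h (single b 1)) x"
proof -
  interpret module_hom fscale sc h by fact
  have s: "single b r = fscale r (single b 1)" for b and r :: 'a
    by (rule poly_mapping_eqI) (simp add: lookup_single when_def)
  have "h x = h (\<Sum>b\<in>keys x. single b (lookup x b))"
    using poly_mapping_sum_singles[of x] by simp
  also have "\<dots> = (\<Sum>b\<in>keys x. h (single b (lookup x b)))" by (rule sum)
  also have "\<dots> = (\<Sum>b\<in>keys x. sc (lookup x b) (h (single b 1)))"
  proof (rule sum.cong[OF refl])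
    fix b
    show "h (single b (lookup x b)) = sc (lookup x b) (h (single b 1))"
      using scale[of "lookup x b" "single b 1"] s[of b "lookup x b"] by simp
  qed
  finally show ?thesis by (simp add: linear_extension_def)
qed

lemma free_component_eq: "free_component G B \<delta> d = tensor_part B \<delta> (int_component G) d"
  by (auto simp: free_component_def tensor_part_def free_on_def in_keys_iff)

lemma res_component_eq: "res_component G F i d = tensor_part (basis F i) (bdeg F i) (int_component G) d"
  by (simp add: res_component_def free_component_eq)

lemma graded_family_fscale:
  "graded_family G (*) M \<Longrightarrow> graded_family G fscale (tensor_part B \<delta> M)"
  using graded_family_tensor_part[OF module_ring_mult, of G M B \<delta>]
  by (simp add: fscale_def[abs_def])

lemma tensor_part_subset_free_on: "tensor_part B \<delta> M d \<subseteq> free_on B"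
  by (auto simp: tensor_part_def free_on_def in_keys_iff)

context standard_graded_algebra
begin

definition free_part :: "('b \<Rightarrow> int) \<Rightarrow> int \<Rightarrow> ('b \<Rightarrow>\<^sub>0 'r) \<Rightarrow> ('b \<Rightarrow>\<^sub>0 'r)" where
  "free_part \<delta> d x = Poly_Mapping.mapp (\<lambda>b r. if d < \<delta> b then 0 else homogeneous_part r (nat (d - \<delta> b))) x"

lemma lookup_free_part:
  "lookup (free_part \<delta> d x) b = (if d < \<delta> b then 0 else homogeneous_part (lookup x b) (nat (d - \<delta> b)))"
  by (auto simp: free_part_def lookup_mapp when_def in_keys_iff)

lemma free_part_in:
  assumes "x \<in> free_on B"
  shows "free_part \<delta> d x \<in> tensor_part B \<delta> (int_component G) d"
proof (rule tensor_partI)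
  fix b assume "b \<notin> B"
  then have "lookup x b = 0" using assms by (auto simp: free_on_def in_keys_iff)
  then show "lookup (free_part \<delta> d x) b = 0" by (simp add: lookup_free_part)
qed (simp add: lookup_free_part int_component_def homogeneous_part(1))

text \<open>
  Elements of a free module have homogeneous components, because each of their finitely many
  coefficients has.
\<close>

lemma free_part_sum:
  shows "\<exists>D. finite D \<and> (\<forall>d. d \<notin> D \<longrightarrow> free_part \<delta> d x = 0) \<and> x = (\<Sum>d\<in>D. free_part \<delta> d x)"
proof -
  define S where "S b = {n. homogeneous_part (lookup x b) n \<noteq> 0}" for b
  define E where "E b = (\<lambda>n. \<delta> b + int n) ` S b" for b
  define D where "D = (\<Union>b\<in>keys x. E b)"
  have fS: "finite (S b)" for b unfolding S_def by (rule homogeneous_part(2))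
  have fD: "finite D" unfolding D_def E_def using fS by auto
  have zero: "lookup (free_part \<delta> d x) b = 0" if "d \<notin> E b" for d b
  proof (rule ccontr)
    assume *: "lookup (free_part \<delta> d x) b \<noteq> 0"
    then have "\<not> d < \<delta> b" "nat (d - \<delta> b) \<in> S b" by (auto simp: lookup_free_part S_def split: if_splits)
    then have "d \<in> E b" unfolding E_def by (intro image_eqI[of _ _ "nat (d - \<delta> b)"]) auto
    then show False using that by simp
  qed
  have E0: "E b = {}" if "b \<notin> keys x" for b
    using that by (simp add: E_def S_def in_keys_iff)
  have "x = (\<Sum>d\<in>D. free_part \<delta> d x)"
  proof (rule poly_mapping_eqI)
    fix b
    have ED: "E b \<subseteq> D" using E0[of b] by (cases "b \<in> keys x") (auto simp: D_def)
    have "lookup (\<Sum>d\<in>D. free_part \<delta> d x) b = (\<Sum>d\<in>D. lookup (free_part \<delta> d x) b)"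
      by (rule lookup_sum)
    also have "\<dots> = (\<Sum>d\<in>E b. lookup (free_part \<delta> d x) b)"
      by (rule sum.mono_neutral_right) (use fD ED zero in auto)
    also have "\<dots> = (\<Sum>n\<in>S b. homogeneous_part (lookup x b) n)"
      unfolding E_def by (subst sum.reindex) (auto simp: inj_on_def lookup_free_part)
    also have "\<dots> = lookup x b" unfolding S_def by (rule homogeneous_part(3))
    finally show "lookup x b = lookup (\<Sum>d\<in>D. free_part \<delta> d x) b" by simp
  qed
  moreover have "free_part \<delta> d x = 0" if "d \<notin> D" for d
  proof (rule poly_mapping_eqI)
    fix b
    have "d \<notin> E b" using that E0[of b] by (cases "b \<in> keys x") (auto simp: D_def)
    then show "lookup (free_part \<delta> d x) b = lookup 0 b" using zero by simp
  qed
  ultimately show ?thesis using fD by blast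
qed

text \<open>
  The components of \<open>x\<close> have images in distinct degrees. If the image of \<open>x\<close> is homogeneous,
  independence leaves nothing but the component of that degree.
\<close>

lemma graded_hom_free_part:
  assumes add: "\<And>x y. h (x + y) = h x + h y"
    and deg: "\<And>d x. x \<in> tensor_part B \<delta> (int_component G) d \<Longrightarrow> h x \<in> M d"
    and fam: "graded_family G sc M" and ind: "independent_family M"
    and x: "x \<in> free_on B" and hx: "h x \<in> M j"
  shows "h (free_part \<delta> j x) = h x"
proof -
  have h0: "h 0 = 0" using add[of 0 0] by simp
  have hs: "h (sum f S) = (\<Sum>a\<in>S. h (f a))" for f and S :: "int set"
    by (induction S rule: infinite_finite_induct) (simp_all add: h0 add)
  obtain D where D: "finite D" "\<And>d. d \<notin> D \<Longrightarrow> free_part \<delta> d x = 0" "x = (\<Sum>d\<in>D. free_part \<delta> d x)"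
    using free_part_sum by blast
  let ?D = "insert j D"
  have "h x = (\<Sum>d\<in>D. h (free_part \<delta> d x))" by (subst D(3)) (rule hs)
  also have "\<dots> = (\<Sum>d\<in>?D. h (free_part \<delta> d x))"
    by (rule sum.mono_neutral_left) (use D(1,2) h0 in auto)
  finally have "(\<Sum>d\<in>?D. h (free_part \<delta> d x) - (if d = j then h x else 0)) = 0"
    using D(1) by (simp add: sum_subtractf del: sum.insert)
  from independent_familyD[OF ind _ _ this, of j] have "h (free_part \<delta> j x) - h x = 0"
    using D(1) deg[OF free_part_in[OF x]] hx graded_family_diff[OF fam] by simp
  then show ?thesis by simp
qed

lemma single_in_tensor_part: "b \<in> B \<Longrightarrow> single b 1 \<in> tensor_part B \<delta> (int_component G) (\<delta> b)"
  using one_in_component_0 by (auto simp: tensor_part_def lookup_single when_def int_component_def)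

text \<open>
  Exactness of a resolution is stated for the modules as a whole. As the maps are
  homogeneous, homogeneous elements in an image have homogeneous preimages, so a resolution
  is exact in each degree.
\<close>

context
  fixes sc :: "'r \<Rightarrow> 'm::ab_group_add \<Rightarrow> 'm" and M :: "int \<Rightarrow> 'm set" and F :: "('r, 'm) free_resolution"
  assumes F: "graded_free_resolution G sc M F"
    and fam: "graded_family G sc M" and ind: "independent_family M"
begin

lemmas resolution_parts =
  F[unfolded graded_free_resolution_def, THEN conjunct1]
  F[unfolded graded_free_resolution_def, THEN conjunct2, THEN conjunct1]
  F[unfolded graded_free_resolution_def, THEN conjunct2, THEN conjunct2, THEN conjunct1]
  F[unfolded graded_free_resolution_def, THEN conjunct2, THEN conjunct2, THEN conjunct2, THEN conjunct1]
  F[unfolded graded_free_resolution_def, THEN conjunct2, THEN conjunct2, THEN conjunct2, THEN conjunct2, THEN conjunct1]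
  F[unfolded graded_free_resolution_def, THEN conjunct2, THEN conjunct2, THEN conjunct2, THEN conjunct2, THEN conjunct2, THEN conjunct1]
  F[unfolded graded_free_resolution_def, THEN conjunct2, THEN conjunct2, THEN conjunct2, THEN conjunct2, THEN conjunct2, THEN conjunct2]

lemma resolution_hom:
  "module_hom fscale sc (aug F)" "module_hom fscale fscale (diff F i)"
  using resolution_parts(1,2) by simp_all

lemma resolution_module: "module sc"
  using resolution_hom(1) by (simp add: module_hom_def)

lemma resolution_degree:
  "x \<in> res_component G F 0 d \<Longrightarrow> aug F x \<in> M d"
  "x \<in> res_component G F (Suc i) d \<Longrightarrow> diff F i x \<in> res_component G F i d"
  using resolution_parts(3,4) by (simp_all add: image_subset_iff)

lemma diff_eq_tensor_map: "diff F i x = tensor_map (*) (\<lambda>b. diff F i (single b 1)) x"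
  unfolding linear_extension_eq_tensor_map[symmetric]
  by (rule module_hom_eq_linear_extension[OF resolution_hom(2)])

lemma free_family: "graded_family G fscale (res_component G F i)" "independent_family (res_component G F i)"
  using graded_family_fscale[OF graded_family_ring] independent_family_tensor_part[OF independent_ring]
  by (simp_all add: res_component_eq[abs_def])

lemma aug_surj:
  assumes "m \<in> M d"
  shows "\<exists>x\<in>res_component G F 0 d. aug F x = m"
proof -
  have "m \<in> carrier_of sc M"
    unfolding carrier_of_def by (rule module.span_base[OF resolution_module]) (use assms in auto)
  then obtain x where x: "x \<in> free_on (basis F 0)" "aug F x = m"
    using resolution_parts(5) by (metis imageE)
  have "aug F (free_part (bdeg F 0) d x) = aug F x"
    by (rule graded_hom_free_part[OF module_hom.add[OF resolution_hom(1)] _ fam ind x(1)])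
      (use resolution_degree(1) x assms in \<open>auto simp: res_component_eq\<close>)
  then show ?thesis
    using free_part_in[OF x(1)] x(2) by (auto simp: res_component_eq)
qed

lemma diff_surj:
  assumes "x \<in> res_component G F i d" "y \<in> free_on (basis F (Suc i))" "diff F i y = x"
  shows "\<exists>y\<in>res_component G F (Suc i) d. diff F i y = x"
proof -
  have "diff F i (free_part (bdeg F (Suc i)) d y) = diff F i y"
    by (rule graded_hom_free_part[OF module_hom.add[OF resolution_hom(2)] _ free_family(1) free_family(2) assms(2)])
      (use resolution_degree(2) assms in \<open>auto simp: res_component_eq\<close>)
  then show ?thesis
    using free_part_in[OF assms(2)] assms(3) by (auto simp: res_component_eq)
qed

lemma res_component_free_on: "x \<in> res_component G F i d \<Longrightarrow> x \<in> free_on (basis F i)"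
  unfolding res_component_eq using tensor_part_subset_free_on by blast

lemma resolution_exact:
  "x \<in> res_component G F 0 d \<Longrightarrow> aug F x = 0 \<Longrightarrow> \<exists>y\<in>res_component G F 1 d. diff F 0 y = x"
  "x \<in> res_component G F (Suc i) d \<Longrightarrow> diff F i x = 0 \<Longrightarrow> \<exists>y\<in>res_component G F (Suc (Suc i)) d. diff F (Suc i) y = x"
proof -
  assume x: "x \<in> res_component G F 0 d" "aug F x = 0"
  then have "x \<in> diff F 0 ` free_on (basis F 1)"
    using resolution_parts(6) res_component_free_on[OF x(1)] by (metis (mono_tags, lifting) mem_Collect_eq)
  then show "\<exists>y\<in>res_component G F 1 d. diff F 0 y = x"
    using diff_surj[OF x(1)] by auto
next
  assume x: "x \<in> res_component G F (Suc i) d" "diff F i x = 0"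
  then have "x \<in> {x \<in> free_on (basis F (Suc i)). diff F i x = 0}"
    using res_component_free_on[OF x(1)] by auto
  then have "x \<in> diff F (Suc i) ` free_on (basis F (Suc (Suc i)))"
    unfolding resolution_parts(7)[rule_format] .
  then show "\<exists>y\<in>res_component G F (Suc (Suc i)) d. diff F (Suc i) y = x"
    using diff_surj[OF x(1)] by auto
qed

lemma resolution_complex:
  "x \<in> free_on (basis F 1) \<Longrightarrow> aug F (diff F 0 x) = 0"
  "x \<in> free_on (basis F (Suc (Suc i))) \<Longrightarrow> diff F i (diff F (Suc i) x) = 0"
  using resolution_parts(6) resolution_parts(7)[rule_format, of i]
  by (metis (mono_tags, lifting) imageI mem_Collect_eq)+

end

text \<open>
  Each piece is contained in the \<open>K\<close>-span of a finite set. Finite dimension makes it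
  possible to index the generators of all syzygy modules by natural numbers.
\<close>

definition finite_dimensional_family :: "('r \<Rightarrow> 'm::ab_group_add \<Rightarrow> 'm) \<Rightarrow> (int \<Rightarrow> 'm set) \<Rightarrow> bool" where
  "finite_dimensional_family sc M \<longleftrightarrow>
     (\<forall>d. \<exists>X. finite X \<and> M d \<subseteq> module.span (\<lambda>a. sc (scale a 1)) X)"

text \<open>
  Homogeneous generators of degrees at least \<open>e\<close>, finitely many up to each degree. The last
  clause asks for a preimage of the same degree.
\<close>

definition generators ::
  "('r \<Rightarrow> 'm::ab_group_add \<Rightarrow> 'm) \<Rightarrow> (int \<Rightarrow> 'm set) \<Rightarrow> int \<Rightarrow> nat set \<Rightarrow> (nat \<Rightarrow> int) \<Rightarrow> (nat \<Rightarrow> 'm) \<Rightarrow> bool" where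
  "generators sc M e B \<delta> g \<longleftrightarrow>
     (\<forall>b\<in>B. \<delta> b \<ge> e \<and> g b \<in> M (\<delta> b)) \<and> (\<forall>d. finite {b \<in> B. \<delta> b \<le> d}) \<and>
     (\<forall>d. \<forall>m\<in>M d. \<exists>x\<in>tensor_part B \<delta> (int_component G) d. linear_extension sc g x = m)"

lemma vector_space_scalars:
  assumes "module sc"
  shows "vector_space (\<lambda>a. sc (scale a 1))"
proof -
  interpret sc: module sc by fact
  show ?thesis
    by standard
      (simp_all add: sc.scale_right_distrib sc.scale_left_distrib scale_left_distrib scalar_mult[symmetric])
qed

text \<open>
  A basis of each piece gives such generators. The pair of a degree and a position in the
  basis of that degree is coded as one number.
\<close>

lemma generators_exist:
  assumes sc: "module sc" and fam: "graded_family G sc M" and fd: "finite_dimensional_family sc M"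
    and lo: "\<And>d. d < e \<Longrightarrow> M d = {0}"
  shows "\<exists>B \<delta> g. generators sc M e B \<delta> g"
proof -
  interpret V: vector_space "\<lambda>a. sc (scale a 1)" by (rule vector_space_scalars[OF sc])
  have ex: "\<exists>xs. set xs \<subseteq> M d \<and> M d \<subseteq> V.span (set xs)" for d
  proof -
    obtain X where X: "finite X" "M d \<subseteq> V.span X" using fd by (auto simp: finite_dimensional_family_def)
    obtain Y where Y: "Y \<subseteq> M d" "V.independent Y" "M d \<subseteq> V.span Y" by (rule V.maximal_independent_subset)
    have "finite Y" using V.independent_span_bound[OF X(1) Y(2)] X(2) Y(1) by auto
    then obtain xs where "set xs = Y" using finite_list by blast
    then show ?thesis using Y by blast
  qed
  have "\<exists>xs. \<forall>d. set (xs d) \<subseteq> M d \<and> M d \<subseteq> V.span (set (xs d))"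
    by (intro choice allI ex)
  then obtain xs where xs': "\<forall>d. set (xs d) \<subseteq> M d \<and> M d \<subseteq> V.span (set (xs d))" by (elim exE)
  note xs = xs'[THEN spec, THEN conjunct1] xs'[THEN spec, THEN conjunct2]
  define \<delta> where "\<delta> b = e + int (fst (prod_decode b))" for b
  define g where "g b = xs (\<delta> b) ! snd (prod_decode b)" for b
  define B where "B = {b. snd (prod_decode b) < length (xs (\<delta> b))}"
  have "finite {b \<in> B. \<delta> b \<le> d}" for d
  proof (rule finite_subset)
    show "{b \<in> B. \<delta> b \<le> d} \<subseteq> prod_encode ` (SIGMA n:{..nat (d - e)}. {..<length (xs (e + int n))})"
    proof
      fix b assume "b \<in> {b \<in> B. \<delta> b \<le> d}"
      moreover obtain n k where nk: "prod_decode b = (n, k)" by fastforce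
      moreover have "b = prod_encode (n, k)" by (metis nk prod_decode_inverse)
      ultimately show "b \<in> prod_encode ` (SIGMA n:{..nat (d - e)}. {..<length (xs (e + int n))})"
        by (intro image_eqI[of _ _ "(n, k)"]) (auto simp: B_def \<delta>_def)
    qed
  qed simp
  moreover have "g b \<in> M (\<delta> b)" if "b \<in> B" for b
    using that xs(1)[of "\<delta> b"] by (auto simp: B_def g_def)
  moreover have "\<exists>x\<in>tensor_part B \<delta> (int_component G) d. linear_extension sc g x = m" if m: "m \<in> M d" for d m
  proof (cases "d < e")
    case True
    then show ?thesis using lo m tensor_part_zero[OF graded_family_ring]
      by (intro bexI[of _ 0]) (auto simp: linear_extension_def)
  next
    case False
    have "m \<in> V.span (set (xs d))" using m xs(2) by blast
    then show ?thesis
    proof (induction rule: V.span_induct_alt)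
      case base
      show ?case using tensor_part_zero[OF graded_family_ring]
        by (intro bexI[of _ 0]) (auto simp: linear_extension_def)
    next
      case (step a v y)
      then obtain x where x: "x \<in> tensor_part B \<delta> (int_component G) d" "linear_extension sc g x = y" by blast
      obtain k where k: "k < length (xs d)" "v = xs d ! k" using step(1) by (auto simp: in_set_conv_nth)
      let ?b = "prod_encode (nat (d - e), k)"
      have db: "\<delta> ?b = d" using False by (simp add: \<delta>_def)
      then have b: "?b \<in> B" "g ?b = v" using k by (auto simp: B_def g_def)
      have s: "single ?b (scale a 1) \<in> tensor_part B \<delta> (int_component G) d"
        using b(1) db scalar_component by (auto simp: tensor_part_def lookup_single when_def int_component_def)
      show ?case
        by (rule bexI[OF _ tensor_part_add[OF graded_family_ring s x(1)]])
          (simp add: linear_extension_add[OF sc] linear_extension_single[OF sc] b(2) x(2))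
    qed
  qed
  ultimately have "generators sc M e B \<delta> g"
    unfolding generators_def by (simp add: \<delta>_def)
  then show ?thesis by blast
qed

definition syzygies ::
  "('r \<Rightarrow> 'm::ab_group_add \<Rightarrow> 'm) \<Rightarrow> nat set \<Rightarrow> (nat \<Rightarrow> int) \<Rightarrow> (nat \<Rightarrow> 'm) \<Rightarrow> int \<Rightarrow> (nat \<Rightarrow>\<^sub>0 'r) set" where
  "syzygies sc B \<delta> g d = {x \<in> tensor_part B \<delta> (int_component G) d. linear_extension sc g x = 0}"

text \<open>
  In a given degree only the finitely many basis elements of at most that degree contribute.
\<close>

lemma finite_dimensional_free:
  assumes fin: "\<And>d. finite {b \<in> B. \<delta> b \<le> d}"
  shows "finite_dimensional_family fscale (tensor_part B \<delta> (int_component G))"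
  unfolding finite_dimensional_family_def
proof
  fix d
  interpret V: vector_space "\<lambda>a. fscale (scale a 1)" by (rule vector_space_scalars[OF module_fscale])
  obtain X where X: "\<And>n. finite (X n)" "\<And>n. G n \<subseteq> span (X n)" using component_finite_span by metis
  let ?Y = "\<Union>b\<in>{b \<in> B. \<delta> b \<le> d}. single b ` X (nat (d - \<delta> b))"
  have mem: "single b r \<in> V.span ?Y" if "b \<in> B" "\<delta> b \<le> d" "r \<in> span (X (nat (d - \<delta> b)))" for b r
    using that(3)
  proof (induction rule: span_induct_alt)
    case base
    show ?case using V.span_zero by simp
  next
    case (step a x y)
    have "single b x \<in> V.span ?Y"
      by (rule V.span_base) (use that step in auto)
    then have "fscale (scale a 1) (single b x) + single b y \<in> V.span ?Y"
      by (intro V.span_add V.span_scale step(2))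
    moreover have "single b (scale a 1 * x) = fscale (scale a 1) (single b x)"
      by (rule poly_mapping_eqI) (simp add: lookup_single when_def)
    ultimately show ?case unfolding single_add scale_eq_mult[of a x] by simp
  qed
  have "tensor_part B \<delta> (int_component G) d \<subseteq> V.span ?Y"
  proof
    fix x assume x: "x \<in> tensor_part B \<delta> (int_component G) d"
    have "(\<Sum>b\<in>keys x. single b (lookup x b)) \<in> V.span ?Y"
    proof (rule V.span_sum)
      fix b assume b: "b \<in> keys x"
      then have "b \<in> B" using tensor_partD(3)[OF x] by auto
      moreover have "\<delta> b \<le> d" "lookup x b \<in> G (nat (d - \<delta> b))"
        using tensor_partD(1)[OF x \<open>b \<in> B\<close>] b by (auto simp: int_component_def in_keys_iff split: if_splits)
      ultimately show "single b (lookup x b) \<in> V.span ?Y" using X(2) by (intro mem) auto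
    qed
    then show "x \<in> V.span ?Y" using poly_mapping_sum_singles[of x] by simp
  qed
  moreover have "finite ?Y" using fin X(1) by auto
  ultimately show "\<exists>X. finite X \<and> tensor_part B \<delta> (int_component G) d \<subseteq> V.span X" by blast
qed

lemma generators_syzygies:
  assumes sc: "module sc" and g: "generators sc M e B \<delta> g"
  shows "\<exists>B' \<delta>' g'. generators fscale (syzygies sc B \<delta> g) e B' \<delta>' g'"
proof (rule generators_exist[OF module_fscale])
  interpret h: module_hom fscale sc "linear_extension sc g" by (rule module_hom_linear_extension[OF sc])
  have fam: "graded_family G fscale (tensor_part B \<delta> (int_component G))"
    by (rule graded_family_fscale[OF graded_family_ring])
  show "graded_family G fscale (syzygies sc B \<delta> g)"
    by (rule graded_familyI)
      (auto simp: syzygies_def h.zero h.diff h.scale graded_family_zero[OF fam] graded_family_diff[OF fam] graded_family_scale[OF fam])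
  have "finite_dimensional_family fscale (tensor_part B \<delta> (int_component G))"
    by (rule finite_dimensional_free) (use g in \<open>auto simp: generators_def\<close>)
  moreover have "syzygies sc B \<delta> g d \<subseteq> tensor_part B \<delta> (int_component G) d" for d
    by (auto simp: syzygies_def)
  ultimately show "finite_dimensional_family fscale (syzygies sc B \<delta> g)"
    unfolding finite_dimensional_family_def by (meson order_trans)
  fix d assume d: "d < e"
  have "x = 0" if x: "x \<in> tensor_part B \<delta> (int_component G) d" for x
  proof (rule poly_mapping_eqI)
    fix b
    show "lookup x b = lookup 0 b"
    proof (cases "b \<in> B")
      case True
      then have "d - \<delta> b < 0" using g d by (auto simp: generators_def)
      then show ?thesis using tensor_partD(1)[OF x True] by (simp add: int_component_def)
    qed (use tensor_partD(2)[OF x] in simp)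
  qed
  moreover have "0 \<in> syzygies sc B \<delta> g d" by (simp add: syzygies_def h.zero graded_family_zero[OF fam])
  ultimately show "syzygies sc B \<delta> g d = {0}" by (auto simp: syzygies_def)
qed

text \<open>
  An inhomogeneous element of the kernel is the sum of its components, which lie in the
  kernel too.
\<close>

lemma kernel_in_image_of_syzygies:
  assumes sc: "module sc" and fam: "graded_family G sc M" and ind: "independent_family M"
    and g: "\<And>b. b \<in> B \<Longrightarrow> g b \<in> M (\<delta> b)" and x: "x \<in> free_on B" "linear_extension sc g x = 0"
    and gen: "generators fscale (syzygies sc B \<delta> g) e B' \<delta>' g'"
  shows "x \<in> linear_extension fscale g' ` free_on B'"
proof -
  interpret h: module_hom fscale fscale "linear_extension fscale g'"
    by (rule module_hom_linear_extension[OF module_fscale])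
  have deg: "linear_extension sc g x \<in> M d" if x: "x \<in> tensor_part B \<delta> (int_component G) d" for x d
    unfolding linear_extension_def
  proof (rule graded_family_sum[OF fam])
    fix b assume "b \<in> keys x"
    then have b: "b \<in> B" using tensor_partD(3)[OF x] by auto
    show "sc (lookup x b) (g b) \<in> M d"
      using graded_family_scale_int[OF sc fam tensor_partD(1)[OF x b] g[OF b]] by simp
  qed
  obtain D where D: "finite D" "x = (\<Sum>d\<in>D. free_part \<delta> d x)" using free_part_sum by blast
  have "\<exists>y\<in>free_on B'. linear_extension fscale g' y = free_part \<delta> d x" for d
  proof -
    have "linear_extension sc g (free_part \<delta> d x) = linear_extension sc g x"
      by (rule graded_hom_free_part[OF linear_extension_add[OF sc] deg fam ind x(1)])
        (use x(2) graded_family_zero[OF fam] in auto)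
    then have "free_part \<delta> d x \<in> syzygies sc B \<delta> g d"
      using free_part_in[OF x(1)] x(2) by (simp add: syzygies_def)
    then show ?thesis using gen tensor_part_subset_free_on unfolding generators_def by blast
  qed
  then obtain y where y: "\<And>d. y d \<in> free_on B'" "\<And>d. linear_extension fscale g' (y d) = free_part \<delta> d x" by metis
  have "sum y D \<in> free_on B'"
    using D(1) by (induction D) (use y(1) Poly_Mapping.keys_add in \<open>force simp: free_on_def\<close>)+
  moreover have "linear_extension fscale g' (sum y D) = x"
    unfolding h.sum y(2) using D(2) by simp
  ultimately show ?thesis by blast
qed

text \<open>
  Take generators of \<open>M\<close>, then of their syzygies, and so on. All modules stay finite
  dimensional in each degree and bounded below by \<open>e\<close>, so the construction can be iterated.
  The lower bound is kept in the conclusion because it forces \<open>Tor\<close> to vanish in degrees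
  below \<open>e\<close>.
\<close>

theorem resolution_exists:
  assumes sc: "module sc" and fam: "graded_family G sc M" and ind: "independent_family M"
    and fd: "finite_dimensional_family sc M" and lo: "\<And>d. d < e \<Longrightarrow> M d = {0}"
  shows "\<exists>F. graded_free_resolution G sc M F \<and> (\<forall>i. \<forall>b\<in>basis F i. bdeg F i b \<ge> e)"
proof -
  obtain B0 \<delta>0 g0 where g0: "generators sc M e B0 \<delta>0 g0" using generators_exist[OF assms(1,2,4,5)] by blast
  (* a state consists of a basis, its degrees and the syzygy module that the next basis generates *)
  define P where "P = (\<lambda>(n::nat) (B, \<delta>, N :: int \<Rightarrow> (nat \<Rightarrow>\<^sub>0 'r) set). \<exists>g. generators fscale N e B \<delta> g)"
  define Q where "Q = (\<lambda>(n::nat) (B, \<delta>, N :: int \<Rightarrow> (nat \<Rightarrow>\<^sub>0 'r) set) (B' :: nat set, \<delta>' :: nat \<Rightarrow> int, N'). \<exists>g. generators fscale N e B \<delta> g \<and> N' = syzygies fscale B \<delta> g)"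
  have "\<exists>s. \<forall>n. (P n (s n) \<and> (n = 0 \<longrightarrow> snd (snd (s n)) = syzygies sc B0 \<delta>0 g0)) \<and> Q n (s n) (s (Suc n))"
  proof (rule dependent_nat_choice)
    obtain B \<delta> g where "generators fscale (syzygies sc B0 \<delta>0 g0) e B \<delta> g" using generators_syzygies[OF sc g0] by blast
    then show "\<exists>x. P 0 x \<and> (0 = 0 \<longrightarrow> snd (snd x) = syzygies sc B0 \<delta>0 g0)"
      by (intro exI[of _ "(B, \<delta>, syzygies sc B0 \<delta>0 g0)"]) (auto simp: P_def)
  next
    fix x n assume "P n x \<and> (n = 0 \<longrightarrow> snd (snd x) = syzygies sc B0 \<delta>0 g0)"
    then obtain B \<delta> N g where x: "x = (B, \<delta>, N)" "generators fscale N e B \<delta> g" by (auto simp: P_def split: prod.splits)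
    obtain B' \<delta>' g' where "generators fscale (syzygies fscale B \<delta> g) e B' \<delta>' g'"
      using generators_syzygies[OF module_fscale x(2)] by blast
    then show "\<exists>y. (P (Suc n) y \<and> (Suc n = 0 \<longrightarrow> snd (snd y) = syzygies sc B0 \<delta>0 g0)) \<and> Q n x y"
      using x by (intro exI[of _ "(B', \<delta>', syzygies fscale B \<delta> g)"]) (auto simp: P_def Q_def)
  qed
  then obtain s where s: "\<And>n. Q n (s n) (s (Suc n))" "snd (snd (s 0)) = syzygies sc B0 \<delta>0 g0" by blast
  define B where "B n = (case n of 0 \<Rightarrow> B0 | Suc m \<Rightarrow> fst (s m))" for n
  define \<delta> where "\<delta> n = (case n of 0 \<Rightarrow> \<delta>0 | Suc m \<Rightarrow> fst (snd (s m)))" for n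
  define N where "N n = snd (snd (s n))" for n
  have "\<exists>g. generators fscale (N n) e (B (Suc n)) (\<delta> (Suc n)) g \<and> N (Suc n) = syzygies fscale (B (Suc n)) (\<delta> (Suc n)) g" for n
    using s(1)[of n] by (auto simp: Q_def B_def \<delta>_def N_def split: prod.splits)
  then obtain g where g: "\<And>n. generators fscale (N n) e (B (Suc n)) (\<delta> (Suc n)) (g n)"
    "\<And>n. N (Suc n) = syzygies fscale (B (Suc n)) (\<delta> (Suc n)) (g n)" by metis
  have N0: "N 0 = syzygies sc (B 0) (\<delta> 0) g0" using s(2) by (simp add: N_def B_def \<delta>_def)
  have gen0: "generators sc M e (B 0) (\<delta> 0) g0" using g0 by (simp add: B_def \<delta>_def)
  define F where "F = \<lparr>basis = B, bdeg = \<delta>, diff = (\<lambda>i. linear_extension fscale (g i)), aug = linear_extension sc g0\<rparr>"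
  have Fsel: "basis F = B" "bdeg F = \<delta>" "diff F = (\<lambda>i. linear_extension fscale (g i))" "aug F = linear_extension sc g0"
    by (simp_all add: F_def)
  have famF: "graded_family G fscale (tensor_part (B i) (\<delta> i) (int_component G))" for i
    by (rule graded_family_fscale[OF graded_family_ring])
  have indF: "independent_family (tensor_part (B i) (\<delta> i) (int_component G))" for i
    by (rule independent_family_tensor_part[OF independent_ring])
  have Nsub: "N i d \<subseteq> tensor_part (B i) (\<delta> i) (int_component G) d" for i d
    by (cases i) (auto simp: N0 g(2) syzygies_def)
  have g0M: "g0 b \<in> M (\<delta> 0 b)" if "b \<in> B 0" for b using gen0 that by (auto simp: generators_def)
  have gN: "g i b \<in> N i (\<delta> (Suc i) b)" if "b \<in> B (Suc i)" for i b using g(1) that by (auto simp: generators_def)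
  have gT: "g i b \<in> tensor_part (B i) (\<delta> i) (int_component G) (\<delta> (Suc i) b)" if "b \<in> B (Suc i)" for i b
    using gN[OF that] Nsub by blast
  have gK0: "linear_extension sc g0 (g 0 b) = 0" if "b \<in> B 1" for b
    using gN[of b 0] that N0 by (simp add: syzygies_def)
  have gK: "linear_extension fscale (g i) (g (Suc i) b) = 0" if "b \<in> B (Suc (Suc i))" for i b
    using gN[OF that] g(2) by (simp add: syzygies_def)
  interpret h0: module_hom fscale sc "linear_extension sc g0" by (rule module_hom_linear_extension[OF sc])
  interpret h: module_hom fscale fscale "linear_extension fscale (g i)" for i
    by (rule module_hom_linear_extension[OF module_fscale])
  have ext_deg: "linear_extension sc' k x \<in> M' d"
    if "module sc'" "graded_family G sc' M'" "\<And>b. b \<in> C \<Longrightarrow> k b \<in> M' (\<gamma> b)" "x \<in> tensor_part C \<gamma> (int_component G) d"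
    for sc' :: "'r \<Rightarrow> 'x::ab_group_add \<Rightarrow> 'x" and M' k d x and C :: "nat set" and \<gamma>
    unfolding linear_extension_def
  proof (rule graded_family_sum[OF that(2)])
    fix b assume "b \<in> keys x"
    then have b: "b \<in> C" using tensor_partD(3)[OF that(4)] by auto
    show "sc' (lookup x b) (k b) \<in> M' d"
      using graded_family_scale_int[OF that(1,2) tensor_partD(1)[OF that(4) b] that(3)[OF b]] by simp
  qed
  have a1: "module_hom fscale sc (linear_extension sc g0)"
    by (rule module_hom_linear_extension[OF sc])
  have a2: "module_hom fscale fscale (linear_extension fscale (g i))" for i
    by (rule module_hom_linear_extension[OF module_fscale])
  have a3: "linear_extension sc g0 ` tensor_part (B 0) (\<delta> 0) (int_component G) j \<subseteq> M j" for j
    by (rule image_subsetI, rule ext_deg[OF sc fam g0M])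
  have a4: "linear_extension fscale (g i) ` tensor_part (B (Suc i)) (\<delta> (Suc i)) (int_component G) j
      \<subseteq> tensor_part (B i) (\<delta> i) (int_component G) j" for i j
    by (rule image_subsetI, rule ext_deg[OF module_fscale famF gT])
  have a5: "linear_extension sc g0 ` free_on (B 0) = carrier_of sc M"
  proof
    show "linear_extension sc g0 ` free_on (B 0) \<subseteq> carrier_of sc M"
    proof clarify
      fix x :: "nat \<Rightarrow>\<^sub>0 'r" assume x: "x \<in> free_on (B 0)"
      show "linear_extension sc g0 x \<in> carrier_of sc M"
        unfolding carrier_of_def linear_extension_def
      proof (intro module.span_sum[OF sc] module.span_scale[OF sc] module.span_base[OF sc])
        fix b assume "b \<in> keys x"
        then show "g0 b \<in> (\<Union>j. M j)" using x g0M by (auto simp: free_on_def)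
      qed
    qed
    show "carrier_of sc M \<subseteq> linear_extension sc g0 ` free_on (B 0)"
      unfolding carrier_of_def
    proof (rule module.span_minimal[OF sc])
      show "(\<Union>j. M j) \<subseteq> linear_extension sc g0 ` free_on (B 0)"
      proof clarify
        fix m j assume "m \<in> M j"
        then obtain x where "x \<in> tensor_part (B 0) (\<delta> 0) (int_component G) j" "linear_extension sc g0 x = m"
          using gen0 unfolding generators_def by blast
        then show "m \<in> linear_extension sc g0 ` free_on (B 0)"
          using tensor_part_subset_free_on[of "B 0" "\<delta> 0" "int_component G" j] by blast
      qed
      have "module.subspace fscale (free_on (B 0) :: (nat \<Rightarrow>\<^sub>0 'r) set)"
      proof (rule module.subspaceI[OF module_fscale])
        fix c :: 'r and x :: "nat \<Rightarrow>\<^sub>0 'r" assume "x \<in> free_on (B 0)"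
        then show "fscale c x \<in> free_on (B 0)"
          using keys_fscale[of c x] by (auto simp: free_on_def)
      qed (use Poly_Mapping.keys_add in \<open>fastforce simp: free_on_def\<close>)+
      then show "module.subspace sc (linear_extension sc g0 ` free_on (B 0))"
        by (rule h0.subspace_image)
    qed
  qed
  have img: "linear_extension fscale (g i) y \<in> free_on (B i)" if "y \<in> free_on (B (Suc i))" for y i
  proof -
    have "lookup (linear_extension fscale (g i) y) c = 0" if "c \<notin> B i" for c
    proof -
      have "lookup (linear_extension fscale (g i) y) c = (\<Sum>b\<in>keys y. lookup y b * lookup (g i b) c)"
        by (simp add: linear_extension_def lookup_sum)
      also have "\<dots> = 0"
        using tensor_partD(2)[OF gT that] \<open>y \<in> free_on (B (Suc i))\<close>
        by (intro sum.neutral) (auto simp: free_on_def)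
      finally show ?thesis .
    qed
    then show ?thesis by (auto simp: free_on_def in_keys_iff)
  qed
  have a6: "{x \<in> free_on (B 0). linear_extension sc g0 x = 0} = linear_extension fscale (g 0) ` free_on (B 1)"
  proof
    show "{x \<in> free_on (B 0). linear_extension sc g0 x = 0} \<subseteq> linear_extension fscale (g 0) ` free_on (B 1)"
      using kernel_in_image_of_syzygies[OF sc fam ind g0M _ _ g(1)[of 0, unfolded N0]] by auto
    show "linear_extension fscale (g 0) ` free_on (B 1) \<subseteq> {x \<in> free_on (B 0). linear_extension sc g0 x = 0}"
    proof clarify
      fix y :: "nat \<Rightarrow>\<^sub>0 'r" assume y: "y \<in> free_on (B 1)"
      have "linear_extension sc g0 (linear_extension fscale (g 0) y)
          = (\<Sum>b\<in>keys y. sc (lookup y b) (linear_extension sc g0 (g 0 b)))"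
        unfolding linear_extension_def[of fscale] by (simp add: h0.sum h0.scale)
      also have "\<dots> = 0"
        using y gK0 by (intro sum.neutral) (auto simp: free_on_def module.scale_zero_right[OF sc])
      finally show "linear_extension fscale (g 0) y \<in> free_on (B 0) \<and> linear_extension sc g0 (linear_extension fscale (g 0) y) = 0"
        using img[of y 0] y by simp
    qed
  qed
  have a7: "{x \<in> free_on (B (Suc i)). linear_extension fscale (g i) x = 0}
      = linear_extension fscale (g (Suc i)) ` free_on (B (Suc (Suc i)))" for i
  proof
    show "{x \<in> free_on (B (Suc i)). linear_extension fscale (g i) x = 0}
        \<subseteq> linear_extension fscale (g (Suc i)) ` free_on (B (Suc (Suc i)))"
      using kernel_in_image_of_syzygies[OF module_fscale famF indF gT _ _ g(1)[of "Suc i", unfolded g(2)]] by auto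
    show "linear_extension fscale (g (Suc i)) ` free_on (B (Suc (Suc i)))
        \<subseteq> {x \<in> free_on (B (Suc i)). linear_extension fscale (g i) x = 0}"
    proof clarify
      fix y :: "nat \<Rightarrow>\<^sub>0 'r" assume y: "y \<in> free_on (B (Suc (Suc i)))"
      have "linear_extension fscale (g i) (linear_extension fscale (g (Suc i)) y)
          = (\<Sum>b\<in>keys y. fscale (lookup y b) (linear_extension fscale (g i) (g (Suc i) b)))"
        unfolding linear_extension_def[of fscale "g (Suc i)"] by (simp add: h.sum h.scale)
      also have "\<dots> = 0"
        using y gK by (intro sum.neutral) (auto simp: free_on_def module.scale_zero_right[OF module_fscale])
      finally show "linear_extension fscale (g (Suc i)) y \<in> free_on (B (Suc i))
          \<and> linear_extension fscale (g i) (linear_extension fscale (g (Suc i)) y) = 0"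
        using img[OF y] by simp
    qed
  qed
  have "graded_free_resolution G sc M F"
    unfolding graded_free_resolution_def Fsel res_component_eq
    by (intro conjI allI a1 a2 a3 a4 a5 a6 a7)
  moreover have "\<forall>i. \<forall>b\<in>basis F i. bdeg F i b \<ge> e"
  proof (intro allI ballI)
    fix i b assume "b \<in> basis F i"
    then show "bdeg F i b \<ge> e" using gen0 g(1) unfolding Fsel by (cases i) (auto simp: generators_def)
  qed
  ultimately show ?thesis by blast
qed

end

section \<open>Tor of a module through a resolution of the residue field\<close>

text \<open>
  The representation of a quotient by cosets has the coset of zero among its elements, so a
  single coset must be that one.
\<close>

lemma cosets_singleton_subset:
  assumes "is_singleton (cosets Z B)" "0 \<in> Z" "0 \<in> B"
  shows "Z \<subseteq> B"
proof
  fix z assume z: "z \<in> Z"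
  obtain C where C: "cosets Z B = {C}" using assms(1) by (auto simp: is_singleton_def)
  have "(\<lambda>b. z + b) ` B \<in> cosets Z B" "(\<lambda>b. 0 + b) ` B \<in> cosets Z B"
    using z assms(2) unfolding cosets_def by blast+
  then have "(\<lambda>b. z + b) ` B = B" unfolding C by simp
  moreover have "z + 0 \<in> (\<lambda>b. z + b) ` B" using assms(3) by (rule imageI)
  ultimately show "z \<in> B" by simp
qed

lemma subset_cosets_singleton:
  assumes "Z \<subseteq> B" "Z \<noteq> {}" "\<And>x y. x \<in> B \<Longrightarrow> y \<in> B \<Longrightarrow> x + y \<in> B" "\<And>x y. x \<in> B \<Longrightarrow> y \<in> B \<Longrightarrow> x - y \<in> B"
  shows "is_singleton (cosets Z (B :: 'm::ab_group_add set))"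
proof -
  have "(\<lambda>b. z + b) ` B = B" if "z \<in> Z" for z
  proof
    show "(\<lambda>b. z + b) ` B \<subseteq> B" using that assms(1,3) by blast
    show "B \<subseteq> (\<lambda>b. z + b) ` B"
    proof
      fix x assume "x \<in> B"
      then have "x - z \<in> B" using that assms(1,4) by blast
      moreover have "x = z + (x - z)" by simp
      ultimately show "x \<in> (\<lambda>b. z + b) ` B" by (intro image_eqI)
    qed
  qed
  then have "cosets Z B = {B}" using assms(2) by (auto simp: cosets_def)
  then show ?thesis by (simp add: is_singleton_def)
qed

context standard_graded_algebra
begin

lemma ideal_times_free_iff:
  assumes "x \<in> tensor_part B \<delta> (int_component G) d"
  shows "x \<in> ideal_times_free max_ideal B \<longleftrightarrow> x \<in> tensor_part B \<delta> (positive_part G) d"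
proof -
  have "x \<in> free_on B" using assms tensor_part_subset_free_on[of B \<delta> "int_component G" d] by blast
  moreover have "(\<forall>b\<in>B. lookup x b \<in> max_ideal) \<longleftrightarrow> (\<forall>b\<in>B. lookup x b \<in> positive_part G (d - \<delta> b))"
    using max_ideal_int_component tensor_partD(1)[OF assms] by blast
  ultimately show ?thesis
    using tensor_partD(2)[OF assms] by (auto simp: ideal_times_free_def tensor_part_def)
qed

lemma positive_part_subset: "positive_part G d \<subseteq> int_component G d"
  by (auto simp: positive_part_def int_component_def)

text \<open>
  A linear map sends \<open>\<mm>F\<close> to \<open>\<mm>N\<close>; in degree \<open>d\<close> a coefficient in \<open>\<mm>\<close> is a homogeneous ring
  element of positive degree.
\<close>

lemma hom_positive_multiples:
  assumes sc: "module sc" and h: "module_hom fscale sc h" and fam: "graded_family G sc N"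
    and deg: "\<And>b. b \<in> B \<Longrightarrow> h (single b 1) \<in> N (\<delta> b)"
    and w: "w \<in> tensor_part B \<delta> (positive_part G) d"
  shows "h w \<in> positive_multiples G sc N d"
  unfolding module_hom_eq_linear_extension[OF h, of w] linear_extension_def
proof (rule positive_multiples_closed_sum)
  fix b assume "b \<in> keys w"
  then have b: "b \<in> B" using tensor_partD(3)[OF w] by auto
  have p: "lookup w b \<in> positive_part G (d - \<delta> b)" by (rule tensor_partD(1)[OF w b])
  show "sc (lookup w b) (h (single b 1)) \<in> positive_multiples G sc N d"
  proof (cases "d - \<delta> b \<le> 0")
    case True
    then have "lookup w b = 0" using p by (simp add: positive_part_def)
    then show ?thesis by (simp add: module.scale_zero_left[OF sc] positive_multiples.zero)
  next
    case False
    show ?thesis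
      by (rule positive_multiples_single[of _ G "nat (d - \<delta> b)"])
        (use False p deg[OF b] in \<open>auto simp: positive_part_def\<close>)
  qed
qed

lemma tensor_part_positive_multiples:
  assumes "x \<in> positive_multiples G fscale (tensor_part B \<delta> (int_component G)) d"
  shows "x \<in> tensor_part B \<delta> (positive_part G) d"
  using assms
proof induction
  case zero
  show ?case by (rule tensor_part_zero[OF graded_family_positive_part])
next
  case (add r n x y)
  have "fscale r x \<in> tensor_part B \<delta> (positive_part G) d"
  proof (rule tensor_partI)
    fix b assume b: "b \<in> B"
    have x: "lookup x b \<in> int_component G (d - int n - \<delta> b)" by (rule tensor_partD(1)[OF add(3) b])
    show "lookup (fscale r x) b \<in> positive_part G (d - \<delta> b)"
    proof (cases "d - \<delta> b \<le> 0")
      case True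
      then have "lookup x b = 0" using x add(2) by (simp add: int_component_def)
      then show ?thesis using True by (simp add: positive_part_def)
    next
      case False
      then show ?thesis
        using component_int_mult[OF add(1) x] by (simp add: int_component_def positive_part_def)
    qed
  next
    fix b assume "b \<notin> B"
    then show "lookup (fscale r x) b = 0" using tensor_partD(2)[OF add(3)] by simp
  qed
  then show ?case by (rule tensor_part_add[OF graded_family_positive_part]) (rule add(5))
qed

abbreviation "residue_module \<equiv> (\<lambda>r a. res r * a)"
abbreviation "residue_degrees \<equiv> (\<lambda>j. if j = 0 then UNIV else {0::'k}) :: int \<Rightarrow> 'k set"

lemma residue_family: "graded_family G residue_module residue_degrees"
proof (rule graded_familyI)
  fix n d r x assume "r \<in> G n" "x \<in> residue_degrees d"
  then show "res r * x \<in> residue_degrees (int n + d)"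
    using residue_positive[of r n] by (cases "n = 0") (auto split: if_splits)
qed (auto split: if_splits)

lemma independent_residue: "independent_family residue_degrees"
  unfolding independent_family_def
proof (intro allI impI ballI)
  fix D and f :: "int \<Rightarrow> 'k" and d :: int
  assume D: "finite D" "\<forall>d\<in>D. f d \<in> residue_degrees d" "sum f D = 0" "d \<in> D"
  have z: "f e = 0" if "e \<in> D" "e \<noteq> 0" for e using D(2) that by force
  show "f d = 0"
  proof (cases "d = 0")
    case True
    have "sum f D = sum f {0}"
      by (rule sum.mono_neutral_right) (use D z True in auto)
    then show ?thesis using D(3) True by simp
  qed (use z D in auto)
qed

lemma resolution_of_residue_field_exists: "\<exists>F. graded_free_resolution G residue_module residue_degrees F"
proof -
  have "finite_dimensional_family residue_module residue_degrees"
    unfolding finite_dimensional_family_def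
  proof
    fix d
    interpret V: vector_space "\<lambda>a. residue_module (scale a 1)"
      by (rule vector_space_scalars[OF module_residue])
    have "x \<in> V.span {1}" for x
      using V.span_scale[OF V.span_base[of 1 "{1}"], of x] by simp
    then show "\<exists>X. finite X \<and> residue_degrees d \<subseteq> V.span X" by (intro exI[of _ "{1}"]) auto
  qed
  from resolution_exists[OF module_residue residue_family independent_residue this, of 0] show ?thesis
    by auto
qed

text \<open>
  The homogeneity of the augmentation makes it vanish on basis elements of nonzero degree,
  so its scalar lift has the required degrees. The scalars inject into \<open>K\<close>, so identities in
  degree \<open>0\<close> may be checked after passing to residues.
\<close>

lemma residue_resolution_of_resolution:
  assumes F: "graded_free_resolution G residue_module residue_degrees F"
  shows "\<exists>u. residue_resolution scale G (basis F) (bdeg F) (\<lambda>i b. diff F i (single b 1))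
    (\<lambda>b. scale (aug F (single b 1)) 1) u"
proof -
  note sc = module_residue
  note deg = resolution_degree[OF F residue_family independent_residue]
  note hom = resolution_hom[OF F residue_family independent_residue]
  note ex = resolution_exact[OF F residue_family independent_residue, unfolded res_component_eq]
  note cpx = resolution_complex[OF F residue_family independent_residue]
  note tm = diff_eq_tensor_map[OF F residue_family independent_residue, symmetric]
  let ?\<epsilon> = "\<lambda>b. scale (aug F (single b 1)) 1"
  let ?g = "\<lambda>i b. diff F i (single b 1)"
  have aug: "res (counit (*) ?\<epsilon> x) = aug F x" for x
    unfolding module_hom_eq_linear_extension[OF hom(1), of x] linear_extension_def counit_def
    by (simp add: residue_sum residue_mult mult.commute)
  have counit_deg: "counit (*) ?\<epsilon> x \<in> G 0" if x: "x \<in> tensor_part (basis F 0) (bdeg F 0) (int_component G) 0" for x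
    unfolding counit_def
  proof (rule component_sum)
    fix b assume "b \<in> keys x"
    then have b: "b \<in> basis F 0" using tensor_partD(3)[OF x] by auto
    have l: "lookup x b \<in> int_component G (0 - bdeg F 0 b)" by (rule tensor_partD(1)[OF x b])
    have a: "aug F (single b 1) \<in> residue_degrees (bdeg F 0 b)"
      by (rule deg(1)) (simp add: res_component_eq single_in_tensor_part b)
    show "?\<epsilon> b * lookup x b \<in> G 0"
    proof (cases "bdeg F 0 b = 0")
      case True
      then have "lookup x b \<in> G 0" using l by (simp add: int_component_def)
      then show ?thesis using component_mult[OF scalar_component, of "lookup x b" 0] by simp
    qed (use a in simp)
  qed
  have scalar: "x = scale (res x) 1" if "x \<in> G 0" for x
    using that component_0 by auto
  have "1 \<in> residue_degrees 0" by simp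
  from aug_surj[OF F residue_family independent_residue this] obtain u where
    u: "u \<in> tensor_part (basis F 0) (bdeg F 0) (int_component G) 0" "aug F u = 1"
    by (auto simp: res_component_eq)
  have "residue_resolution scale G (basis F) (bdeg F) ?g ?\<epsilon> u"
  proof (intro residue_resolution.intro residue_resolution_axioms.intro)
    show "standard_graded_algebra scale G" by unfold_locales
  next
    fix b i assume "b \<in> basis F (Suc i)"
    then show "?g i b \<in> tensor_part (basis F i) (bdeg F i) (int_component G) (bdeg F (Suc i) b)"
      using deg(2)[of "single b 1" i "bdeg F (Suc i) b"] by (simp add: res_component_eq single_in_tensor_part)
  next
    fix b i assume "b \<in> basis F (Suc (Suc i))"
    then show "tensor_map (*) (?g i) (?g (Suc i) b) = 0"
      unfolding tm by (intro cpx(2)) (simp add: free_on_def)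
  next
    fix x i d assume "x \<in> tensor_part (basis F (Suc i)) (bdeg F (Suc i)) (int_component G) d" "tensor_map (*) (?g i) x = 0"
    then show "\<exists>y\<in>tensor_part (basis F (Suc (Suc i))) (bdeg F (Suc (Suc i))) (int_component G) d.
        tensor_map (*) (?g (Suc i)) y = x"
      unfolding tm by (rule ex(2))
  next
    fix b assume b: "b \<in> basis F 0"
    have a: "aug F (single b 1) \<in> residue_degrees (bdeg F 0 b)"
      by (rule deg(1)) (simp add: res_component_eq single_in_tensor_part b)
    then show "?\<epsilon> b \<in> (if bdeg F 0 b = 0 then G 0 else {0})"
      using scalar_component by auto
  next
    show "u \<in> tensor_part (basis F 0) (bdeg F 0) (int_component G) 0" by (rule u(1))
    show "counit (*) ?\<epsilon> u = 1" using scalar[OF counit_deg[OF u(1)]] aug[of u] u(2) by simp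
  next
    fix b assume b: "b \<in> basis F 1" "bdeg F 1 b = 0"
    have "?g 0 b \<in> tensor_part (basis F 0) (bdeg F 0) (int_component G) 0"
      using deg(2)[of "single b 1" 0 "bdeg F 1 b"] b(2) single_in_tensor_part[OF b(1), of "bdeg F 1"]
      by (simp add: res_component_eq)
    from scalar[OF counit_deg[OF this]] have "counit (*) ?\<epsilon> (?g 0 b) = scale (aug F (?g 0 b)) 1"
      unfolding aug .
    moreover have "aug F (?g 0 b) = 0" by (rule cpx(1)) (use b in \<open>simp add: free_on_def\<close>)
    ultimately show "counit (*) ?\<epsilon> (?g 0 b) = 0" by simp
  next
    fix x d assume x: "x \<in> tensor_part (basis F 0) (bdeg F 0) (int_component G) d" "d \<noteq> 0 \<or> counit (*) ?\<epsilon> x = 0"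
    have "aug F x = 0"
    proof (cases "d = 0")
      case True
      then show ?thesis using x(2) aug[of x] by simp
    next
      case False
      then show ?thesis using deg(1)[of x d] x(1) by (simp add: res_component_eq)
    qed
    then show "\<exists>y\<in>tensor_part (basis F 1) (bdeg F 1) (int_component G) d. tensor_map (*) (?g 0) y = x"
      unfolding tm by (rule ex(1)[OF x(1)])
  qed
  then show ?thesis by blast
qed

context
  fixes sc :: "'r \<Rightarrow> 'm::ab_group_add \<Rightarrow> 'm" and M :: "int \<Rightarrow> 'm set" and F :: "('r, 'm) free_resolution"
  assumes F: "graded_free_resolution G sc M F"
    and fam: "graded_family G sc M" and ind: "independent_family M"
begin

lemma tor_boundaries_group:
  assumes x: "x \<in> tor_boundaries G F i d" and y: "y \<in> tor_boundaries G F i d"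
  shows "x + y \<in> tor_boundaries G F i d" "x - y \<in> tor_boundaries G F i d"
proof -
  let ?I = "ideal_times_free max_ideal (basis F i)"
  interpret h: module_hom fscale fscale "diff F i" by (rule resolution_hom(2)[OF F fam ind])
  note fam' = free_family(1)[OF F fam ind]
  obtain a v where x': "x = diff F i a + v" "a \<in> res_component G F (Suc i) d" "v \<in> res_component G F i d" "v \<in> ?I"
    using x by (auto simp: tor_boundaries_def)
  obtain b w where y': "y = diff F i b + w" "b \<in> res_component G F (Suc i) d" "w \<in> res_component G F i d" "w \<in> ?I"
    using y by (auto simp: tor_boundaries_def)
  have v: "v \<in> tensor_part (basis F i) (bdeg F i) (positive_part G) d"
    and w: "w \<in> tensor_part (basis F i) (bdeg F i) (positive_part G) d"
    using x' y' ideal_times_free_iff[of _ "basis F i" "bdeg F i" d] by (auto simp: res_component_eq)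
  have "v + w \<in> res_component G F i d" "v - w \<in> res_component G F i d"
    using x' y' graded_family_add[OF fam'] graded_family_diff[OF fam'] by auto
  moreover have "v + w \<in> ?I" "v - w \<in> ?I"
    using calculation tensor_part_add[OF graded_family_positive_part v w] tensor_part_diff[OF graded_family_positive_part v w]
      ideal_times_free_iff[of _ "basis F i" "bdeg F i" d] by (auto simp: res_component_eq)
  moreover have "a + b \<in> res_component G F (Suc i) d" "a - b \<in> res_component G F (Suc i) d"
    using x' y' graded_family_add[OF fam'] graded_family_diff[OF fam'] by auto
  moreover have "x + y = diff F i (a + b) + (v + w)" "x - y = diff F i (a - b) + (v - w)"
    unfolding x'(1) y'(1) h.add h.diff by simp_all
  ultimately show "x + y \<in> tor_boundaries G F i d" "x - y \<in> tor_boundaries G F i d"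
    unfolding tor_boundaries_def by blast+
qed

lemma zero_in_tor:
  "0 \<in> tor_cycles G F i d" "0 \<in> tor_boundaries G F i d"
proof -
  note fam' = free_family(1)[OF F fam ind]
  have I: "0 \<in> ideal_times_free max_ideal (basis F k)" for k
    using ideal_times_free_iff[of 0 "basis F k" "bdeg F k" d] tensor_part_zero[OF graded_family_ring]
      tensor_part_zero[OF graded_family_positive_part] by blast
  have h0: "diff F k 0 = 0" for k
    using module_hom.zero[OF resolution_hom(2)[OF F fam ind]] .
  show "0 \<in> tor_cycles G F i d"
    using I h0 graded_family_zero[OF fam'] by (auto simp: tor_cycles_def split: nat.splits)
  have "0 = diff F i 0 + 0" using h0 by simp
  then show "0 \<in> tor_boundaries G F i d"
    unfolding tor_boundaries_def using I graded_family_zero[OF fam'] by blast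
qed

text \<open>
  Lift an expression of the image of \<open>z\<close> as an element of \<open>\<mm>M\<close> to \<open>w\<close> in \<open>\<mm>F\<^sub>0\<close>. Then \<open>z -
  w\<close> lies in the kernel of the augmentation, that is, in the image of \<open>F\<^sub>1\<close>.
\<close>

lemma tor_0_generated:
  assumes gen: "M d \<subseteq> positive_multiples G sc M d"
  shows "is_singleton (cosets (tor_cycles G F 0 d) (tor_boundaries G F 0 d))"
proof (rule subset_cosets_singleton)
  interpret h: module_hom fscale sc "aug F" by (rule resolution_hom(1)[OF F fam ind])
  show "tor_cycles G F 0 d \<subseteq> tor_boundaries G F 0 d"
  proof
    fix z assume "z \<in> tor_cycles G F 0 d"
    then have z: "z \<in> res_component G F 0 d" by (simp add: tor_cycles_def)
    have lift: "\<exists>w\<in>positive_multiples G fscale (res_component G F 0) d. aug F w = m"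
      if "m \<in> positive_multiples G sc M d" for m
      using that
    proof induction
      case zero
      show ?case by (rule bexI[of _ 0]) (simp_all add: h.zero positive_multiples.zero)
    next
      case (add r n x y)
      then obtain w where w: "w \<in> positive_multiples G fscale (res_component G F 0) d" "aug F w = y" by blast
      obtain v where v: "v \<in> res_component G F 0 (d - int n)" "aug F v = x"
        using aug_surj[OF F fam ind add(3)] by blast
      show ?case
        by (rule bexI[OF _ positive_multiples.add[OF add(1,2) v(1) w(1)]]) (simp add: h.add h.scale v w)
    qed
    obtain w where w: "w \<in> positive_multiples G fscale (res_component G F 0) d" "aug F w = aug F z"
      using lift gen resolution_degree(1)[OF F fam ind z] by blast
    have wd: "w \<in> res_component G F 0 d"
      by (rule graded_family_positive_multiples[OF module_fscale free_family(1)[OF F fam ind] w(1)])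
    have "w \<in> tensor_part (basis F 0) (bdeg F 0) (positive_part G) d"
      by (rule tensor_part_positive_multiples) (use w(1) in \<open>simp add: res_component_eq[abs_def]\<close>)
    then have wI: "w \<in> ideal_times_free max_ideal (basis F 0)"
      using ideal_times_free_iff wd unfolding res_component_eq by blast
    have "z - w \<in> res_component G F 0 d" by (rule graded_family_diff[OF free_family(1)[OF F fam ind] z wd])
    moreover have "aug F (z - w) = 0" by (simp add: h.diff w)
    ultimately obtain y where y: "y \<in> res_component G F 1 d" "diff F 0 y = z - w"
      using resolution_exact(1)[OF F fam ind] by blast
    have "z = diff F 0 y + w" using y by simp
    then show "z \<in> tor_boundaries G F 0 d"
      unfolding tor_boundaries_def using y(1) wd wI by auto
  qed
  show "tor_cycles G F 0 d \<noteq> {}" using zero_in_tor(1)[of 0 d] by blast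
qed (rule tor_boundaries_group; assumption)+

end

end

context residue_resolution
begin

context
  fixes sc :: "'r \<Rightarrow> 'm::ab_group_add \<Rightarrow> 'm" and M :: "int \<Rightarrow> 'm set" and F :: "('r, 'm) free_resolution"
  assumes F: "graded_free_resolution G sc M F"
    and fam: "graded_family G sc M" and ind: "independent_family M"
begin

text \<open>
  The kernel of the map starting at \<open>F\<^sub>i\<close>, the \<open>(i+1)\<close>-st syzygy module of \<open>M\<close>.
\<close>

definition kernel :: "nat \<Rightarrow> int \<Rightarrow> (nat \<Rightarrow>\<^sub>0 'r) set" where
  "kernel i d = {x \<in> res_component G F i d. case i of 0 \<Rightarrow> aug F x = 0 | Suc k \<Rightarrow> diff F k x = 0}"

lemmas graded_family_free = free_family(1)[OF F fam ind]

lemma graded_family_kernel: "graded_family G fscale (kernel i)"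
proof (cases i)
  case 0
  interpret h: module_hom fscale sc "aug F" by (rule resolution_hom(1)[OF F fam ind])
  show ?thesis unfolding 0
    by (rule graded_familyI) (simp_all add: kernel_def h.zero h.diff h.scale graded_family_zero[OF graded_family_free]
      graded_family_diff[OF graded_family_free] graded_family_scale[OF graded_family_free])
next
  case (Suc k)
  interpret h: module_hom fscale fscale "diff F k" by (rule resolution_hom(2)[OF F fam ind])
  show ?thesis unfolding Suc
    by (rule graded_familyI) (simp_all add: kernel_def h.zero h.diff h.scale graded_family_zero[OF graded_family_free]
      graded_family_diff[OF graded_family_free] graded_family_scale[OF graded_family_free])
qed

lemma kernel_subset: "kernel i d \<subseteq> res_component G F i d"
  by (auto simp: kernel_def)

lemma free_on_res: "x \<in> res_component G F i d \<Longrightarrow> x \<in> free_on (basis F i)"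
  using res_component_free_on[OF F fam ind] .

lemma diff_in_kernel:
  assumes "x \<in> res_component G F (Suc i) d"
  shows "diff F i x \<in> kernel i d"
proof (cases i)
  case 0
  then show ?thesis
    using assms resolution_degree(2)[OF F fam ind assms] resolution_complex(1)[OF F fam ind, of x] free_on_res[OF assms]
    by (simp add: kernel_def)
next
  case (Suc k)
  then show ?thesis
    using resolution_degree(2)[OF F fam ind assms] resolution_complex(2)[OF F fam ind, of x k] free_on_res[OF assms]
    by (simp add: kernel_def)
qed

lemma kernel_exact:
  assumes "x \<in> kernel i d"
  shows "\<exists>y\<in>res_component G F (Suc i) d. diff F i y = x"
proof (cases i)
  case 0
  then show ?thesis using resolution_exact(1)[OF F fam ind, of x d] assms by (simp add: kernel_def)
next
  case (Suc k)
  then show ?thesis using resolution_exact(2)[OF F fam ind, of x k d] assms by (simp add: kernel_def)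
qed

lemma resolved_module: "module sc"
  by (rule resolution_module[OF F fam ind])

lemmas graded_family_zero_free = graded_family_trivial[OF module_fscale]

text \<open>
  The augmentation identifies \<open>F\<^sub>0\<close> modulo its kernel with \<open>M\<close>.
\<close>

lemma tor_vanishes_of_cover:
  assumes "tor_vanishes fscale (res_component G F 0) (kernel 0) j d"
  shows "tor_vanishes sc M (\<lambda>d. {0}) j d"
proof -
  interpret h: module_hom fscale sc "aug F" by (rule resolution_hom(1)[OF F fam ind])
  have "tor_vanishes sc M (\<lambda>d. {0}) j (d + 0)"
  proof (rule tor_vanishes_iso[where f = "aug F" and s = 0, OF module_fscale resolved_module graded_family_free graded_family_kernel fam
        graded_family_trivial[OF resolved_module] h.add h.scale _ _ _ _ assms])
    show "aug F x \<in> M (d + 0)" if "x \<in> res_component G F 0 d" for d x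
      using resolution_degree(1)[OF F fam ind that] by simp
    show "aug F x \<in> {0}" if "x \<in> kernel 0 d" for d x using that by (simp add: kernel_def)
    show "x \<in> kernel 0 d" if "x \<in> res_component G F 0 d" "aug F x \<in> {0}" for d x using that by (simp add: kernel_def)
    show "\<exists>x\<in>res_component G F 0 d. y - aug F x \<in> {0}" if "y \<in> M (d + 0)" for d y
    proof -
      have "y \<in> M d" using that by simp
      from aug_surj[OF F fam ind this] show ?thesis by auto
    qed
  qed
  then show ?thesis by simp
qed

lemma tor_vanishes_of_next_cover:
  assumes "tor_vanishes fscale (res_component G F (Suc i)) (kernel (Suc i)) j d"
  shows "tor_vanishes fscale (kernel i) (\<lambda>d. {0}) j d"
proof -
  interpret h: module_hom fscale fscale "diff F i" by (rule resolution_hom(2)[OF F fam ind])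
  have "tor_vanishes fscale (kernel i) (\<lambda>d. {0}) j (d + 0)"
  proof (rule tor_vanishes_iso[where f = "diff F i" and s = 0, OF module_fscale module_fscale graded_family_free
        graded_family_kernel graded_family_kernel graded_family_zero_free h.add h.scale _ _ _ _ assms])
    show "diff F i x \<in> kernel i (d + 0)" if "x \<in> res_component G F (Suc i) d" for d x
      using diff_in_kernel[OF that] by simp
    show "diff F i x \<in> {0}" if "x \<in> kernel (Suc i) d" for d x using that by (simp add: kernel_def)
    show "x \<in> kernel (Suc i) d" if "x \<in> res_component G F (Suc i) d" "diff F i x \<in> {0}" for d x
      using that by (simp add: kernel_def)
    show "\<exists>x\<in>res_component G F (Suc i) d. y - diff F i x \<in> {0}" if "y \<in> kernel i (d + 0)" for d y
    proof -
      have "y \<in> kernel i d" using that by simp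
      from kernel_exact[OF this] show ?thesis by auto
    qed
  qed
  then show ?thesis by simp
qed

lemma tor_vanishes_free: "tor_vanishes fscale (res_component G F i) (\<lambda>d. {0}) (Suc j) d"
  using tor_vanishes_direct_sum[OF module_ring_mult graded_family_ring tor_vanishes_ring, where C = "basis F i" and \<gamma> = "bdeg F i"]
  by (simp add: res_component_eq[abs_def] fscale_def[abs_def] tor_vanishes_ring)

text \<open>
  Free modules have no higher \<open>Tor\<close>, so \<open>Tor\<^sub>j\<^sub>+\<^sub>1\<close> of a syzygy module embeds into \<open>Tor\<^sub>j\<close>
  of the next one.
\<close>

lemma tor_vanishes_shift:
  assumes "tor_vanishes fscale (res_component G F n) (kernel n) j d"
  shows "tor_vanishes fscale (res_component G F 0) (kernel 0) (n + j) d"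
  using assms
proof (induction n arbitrary: j)
  case (Suc n)
  have k: "tor_vanishes fscale (kernel n) (\<lambda>d. {0}) j d"
    by (rule tor_vanishes_of_next_cover[OF Suc.prems])
  have sub: "{0} \<subseteq> kernel n d" for d
    by (simp add: graded_family_zero[OF graded_family_kernel])
  have "tor_vanishes fscale (res_component G F n) (kernel n) (Suc j) d"
    by (rule tor_vanishes_quotient[OF module_fscale graded_family_zero_free graded_family_kernel graded_family_free sub kernel_subset
          tor_vanishes_free k])
  then show ?case using Suc.IH[of "Suc j"] by simp
qed simp

text \<open>
  After shifting dimensions \<open>j\<close> times, \<open>Tor\<^sub>j(M, K)\<close> becomes \<open>Tor\<^sub>0\<close> of a module living in
  degrees at least \<open>e\<close>.
\<close>

lemma tor_vanishes_low_degree: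
  assumes b: "\<And>i b. b \<in> basis F i \<Longrightarrow> bdeg F i b \<ge> e" and d: "d < e"
  shows "tor_vanishes sc M (\<lambda>d. {0}) j d"
proof (rule tor_vanishes_of_cover)
  have zero: "x = 0" if x: "x \<in> res_component G F j d" for x
  proof (rule poly_mapping_eqI)
    fix c
    show "lookup x c = lookup 0 c"
    proof (cases "c \<in> basis F j")
      case True
      then have "d - bdeg F j c < 0" using b[OF True] d by simp
      then show ?thesis using x True by (auto simp: res_component_eq tensor_part_def int_component_def)
    qed (use x in \<open>auto simp: res_component_eq tensor_part_def\<close>)
  qed
  have "tor_vanishes fscale (res_component G F j) (kernel j) 0 d"
    by (rule tor_vanishes_0I[OF module_fscale graded_family_free graded_family_kernel])
      (use zero graded_family_zero[OF graded_family_kernel] positive_multiples.zero in force)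
  then show "tor_vanishes fscale (res_component G F 0) (kernel 0) j d"
    using tor_vanishes_shift[of j 0 d] by simp
qed

text \<open>
  The hypothesis says that the homology of \<open>F \<otimes> K\<close> is zero, the conclusion speaks of \<open>M \<otimes>
  P\<close>. For \<open>j = 0\<close> both are \<open>M/\<mm>M\<close>. For \<open>j = k + 1\<close> shifting dimensions reduces the claim to
  \<open>Tor\<^sub>1(F\<^sub>k/N, K)\<close>, where \<open>N\<close> is the image of \<open>F\<^sub>k\<^sub>+\<^sub>1\<close> in \<open>F\<^sub>k\<close>. This is the kernel of
  \<open>N/\<mm>N \<rightarrow> F\<^sub>k/\<mm>F\<^sub>k\<close>, and an element of it comes from a cycle of \<open>F\<^sub>k\<^sub>+\<^sub>1 \<otimes> K\<close>.
\<close>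

lemma tor_vanishes_balance:
  assumes t: "tor_cycles G F j d \<subseteq> tor_boundaries G F j d"
  shows "tor_vanishes sc M (\<lambda>d. {0}) j d"
proof (cases j)
  case 0
  show ?thesis unfolding 0
  proof (rule tor_vanishes_0I[OF resolved_module fam graded_family_trivial[OF resolved_module]])
    fix m assume "m \<in> M d"
    then obtain z where z: "z \<in> res_component G F 0 d" "aug F z = m"
      using aug_surj[OF F fam ind] by blast
    then have "z \<in> tor_boundaries G F 0 d" using t 0 by (auto simp: tor_cycles_def)
    then obtain y w where zw: "z = diff F 0 y + w" "y \<in> res_component G F 1 d" "w \<in> res_component G F 0 d"
      "w \<in> ideal_times_free max_ideal (basis F 0)" by (auto simp: tor_boundaries_def)
    interpret h: module_hom fscale sc "aug F" by (rule resolution_hom(1)[OF F fam ind])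
    have "aug F z = aug F w"
      using zw(1) resolution_complex(1)[OF F fam ind, of y] free_on_res[OF zw(2)] by (simp add: h.add)
    moreover have "aug F w \<in> positive_multiples G sc M d"
    proof (rule hom_positive_multiples[OF resolved_module resolution_hom(1)[OF F fam ind] fam])
      show "w \<in> tensor_part (basis F 0) (bdeg F 0) (positive_part G) d"
        using zw(3,4) ideal_times_free_iff unfolding res_component_eq by blast
      show "aug F (single b 1) \<in> M (bdeg F 0 b)" if "b \<in> basis F 0" for b
        by (rule resolution_degree(1)[OF F fam ind]) (simp add: res_component_eq single_in_tensor_part that)
    qed
    ultimately show "\<exists>n\<in>{0}. m - n \<in> positive_multiples G sc M d" using z(2) by simp
  qed
next
  case (Suc k)
  show ?thesis unfolding Suc
  proof (rule tor_vanishes_of_cover)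
    have "tor_vanishes fscale (res_component G F k) (kernel k) 1 d"
    proof (rule tor_vanishes_1I[OF module_fscale graded_family_free graded_family_kernel kernel_subset])
      show "tor_vanishes fscale (res_component G F k) (\<lambda>d. {0}) 1 d" using tor_vanishes_free[of k 0 d] by simp
      fix x assume x: "x \<in> kernel k d" "x \<in> positive_multiples G fscale (res_component G F k) d"
      obtain z where z: "z \<in> res_component G F (Suc k) d" "diff F k z = x" using kernel_exact[OF x(1)] by blast
      have "x \<in> tensor_part (basis F k) (bdeg F k) (positive_part G) d"
        by (rule tensor_part_positive_multiples) (use x(2) in \<open>simp add: res_component_eq[abs_def]\<close>)
      then have "x \<in> ideal_times_free max_ideal (basis F k)"
        using kernel_subset[of k d] x(1) ideal_times_free_iff unfolding res_component_eq by blast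
      then have "z \<in> tor_cycles G F (Suc k) d" using z by (simp add: tor_cycles_def)
      then have "z \<in> tor_boundaries G F (Suc k) d" using t Suc by blast
      then obtain y w where zw: "z = diff F (Suc k) y + w" "y \<in> res_component G F (Suc (Suc k)) d"
        "w \<in> res_component G F (Suc k) d" "w \<in> ideal_times_free max_ideal (basis F (Suc k))"
        by (auto simp: tor_boundaries_def)
      interpret h: module_hom fscale fscale "diff F k" by (rule resolution_hom(2)[OF F fam ind])
      have "x = diff F k w"
        using zw(1) z(2) resolution_complex(2)[OF F fam ind, of y k] free_on_res[OF zw(2)] by (simp add: h.add)
      moreover have "diff F k w \<in> positive_multiples G fscale (kernel k) d"
      proof (rule hom_positive_multiples[OF module_fscale resolution_hom(2)[OF F fam ind] graded_family_kernel])
        show "w \<in> tensor_part (basis F (Suc k)) (bdeg F (Suc k)) (positive_part G) d"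
          using zw(3,4) ideal_times_free_iff unfolding res_component_eq by blast
        show "diff F k (single b 1) \<in> kernel k (bdeg F (Suc k) b)" if "b \<in> basis F (Suc k)" for b
          by (rule diff_in_kernel) (simp add: res_component_eq single_in_tensor_part that)
      qed
      ultimately show "x \<in> positive_multiples G fscale (kernel k) d" by simp
    qed
    then show "tor_vanishes fscale (res_component G F 0) (kernel 0) (Suc k) d"
      using tor_vanishes_shift[of k 1 d] by simp
  qed
qed

end

end

section \<open>The Koszul complex\<close>

definition koszul_sign :: "nat \<Rightarrow> nat set \<Rightarrow> 'r::comm_ring_1" where
  "koszul_sign a A = (- 1) ^ card {b \<in> A. b < a}"

definition koszul_column :: "'r::comm_ring_1 list \<Rightarrow> nat set \<Rightarrow> (nat set \<Rightarrow>\<^sub>0 'r)" where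
  "koszul_column bs A = (\<Sum>a\<in>A. single (A - {a}) (koszul_sign a A * bs ! a))"

definition wedge_column :: "nat \<Rightarrow> nat set \<Rightarrow> (nat set \<Rightarrow>\<^sub>0 'r::comm_ring_1)" where
  "wedge_column a A = (if a \<in> A then 0 else single (insert a A) (koszul_sign a A))"

abbreviation wedge :: "nat \<Rightarrow> (nat set \<Rightarrow>\<^sub>0 'r) \<Rightarrow> (nat set \<Rightarrow>\<^sub>0 'r::comm_ring_1)" where
  "wedge a \<equiv> linear_extension fscale (wedge_column a)"

lemma fscale_single: "fscale r (single b s) = single b (r * s)"
  by (rule poly_mapping_eqI) (simp add: lookup_single when_def)

lemma koszul_diff_eq: "koszul_diff bs = linear_extension fscale (koszul_column bs)"
proof
  fix x
  show "koszul_diff bs x = linear_extension fscale (koszul_column bs) x"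
    unfolding koszul_diff_def linear_extension_def koszul_column_def koszul_sign_def
      module.scale_sum_right[OF module_fscale] fscale_single
    by (intro sum.cong refl arg_cong2[where f = single]) (simp add: algebra_simps)
qed

lemma koszul_sign_square: "koszul_sign a A * (koszul_sign a A * x) = (x :: 'r::comm_ring_1)"
  by (simp add: koszul_sign_def mult.assoc[symmetric] power_add[symmetric] flip: mult_2)

text \<open>
  Exterior multiplication by the \<open>a\<close>-th basis vector and removal of the \<open>x\<close>-th one
  anticommute: for \<open>x < a\<close> the sign for \<open>a\<close> sees one element less after \<open>x\<close> is removed, for
  \<open>a < x\<close> the sign for \<open>x\<close> sees one more after \<open>a\<close> is inserted.
\<close>

lemma koszul_sign_insert:
  assumes "finite A" "a \<notin> A" "x \<in> A"
  shows "koszul_sign a A * koszul_sign x (insert a A) = - (koszul_sign x A * koszul_sign a (A - {x}) :: 'r::comm_ring_1)"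
proof (cases "x < a")
  case True
  have "{b \<in> insert a A. b < x} = {b \<in> A. b < x}" using True by auto
  moreover have "{b \<in> A. b < a} = insert x {b \<in> A - {x}. b < a}" using True assms by auto
  ultimately show ?thesis using assms(1) by (simp add: koszul_sign_def mult.commute)
next
  case False
  then have "a < x" using assms by (metis nat_neq_iff)
  then have "{b \<in> insert a A. b < x} = insert a {b \<in> A. b < x}" "{b \<in> A. b < a} = {b \<in> A - {x}. b < a}" by auto
  then show ?thesis using assms(1,2) by (simp add: koszul_sign_def mult.commute)
qed

text \<open>
  The homotopy formula. If \<open>a\<close> is in \<open>A\<close>, only the term removing \<open>a\<close> survives on the left;
  otherwise all terms except the one removing \<open>a\<close> cancel in pairs.
\<close>

lemma koszul_homotopy_basis:
  assumes A: "finite A"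
  shows "koszul_diff bs (wedge_column a A) + wedge a (koszul_column bs A) = single A (bs ! a)"
proof -
  interpret k: module_hom fscale fscale "linear_extension fscale (koszul_column bs)"
    by (rule module_hom_linear_extension[OF module_fscale])
  interpret w: module_hom fscale fscale "wedge a :: _ \<Rightarrow> (nat set \<Rightarrow>\<^sub>0 'a)"
    by (rule module_hom_linear_extension[OF module_fscale])
  have w_sum: "wedge a (koszul_column bs A) = (\<Sum>x\<in>A. fscale (koszul_sign x A * bs ! x) (wedge_column a (A - {x})))"
    by (simp add: koszul_column_def w.sum linear_extension_single[OF module_fscale])
  show ?thesis
  proof (cases "a \<in> A")
    case True
    have "wedge a (koszul_column bs A) = (\<Sum>x\<in>A. if x = a then single A (bs ! a) else 0)"
      unfolding w_sum
    proof (rule sum.cong[OF refl])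
      fix x assume x: "x \<in> A"
      show "fscale (koszul_sign x A * bs ! x) (wedge_column a (A - {x})) = (if x = a then single A (bs ! a) else 0)"
      proof (cases "x = a")
        case eq: True
        have "{b \<in> A - {a}. b < a} = {b \<in> A. b < a}" by auto
        then have "koszul_sign a (A - {a}) = (koszul_sign a A :: 'a)" by (simp add: koszul_sign_def)
        moreover have "koszul_sign a A * bs ! a * koszul_sign a A = bs ! a"
          using koszul_sign_square[of a A "bs ! a"] by (simp add: algebra_simps)
        ultimately show ?thesis using eq True by (simp add: wedge_column_def fscale_single insert_absorb)
      next
        case False
        then show ?thesis using True by (simp add: wedge_column_def module.scale_zero_right[OF module_fscale])
      qed
    qed
    also have "\<dots> = single A (bs ! a)" using A True by simp
    finally show ?thesis using True by (simp add: wedge_column_def koszul_diff_eq k.zero)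
  next
    case False
    have "{b \<in> insert a A. b < a} = {b \<in> A. b < a}" by auto
    then have sa: "koszul_sign a (insert a A) = (koszul_sign a A :: 'a)" by (simp add: koszul_sign_def)
    have "koszul_diff bs (wedge_column a A) = fscale (koszul_sign a A) (koszul_column bs (insert a A))"
      using False by (simp add: wedge_column_def koszul_diff_eq linear_extension_single[OF module_fscale])
    also have "\<dots> = single A (koszul_sign a A * (koszul_sign a A * bs ! a))
        + (\<Sum>x\<in>A. single (insert a A - {x}) (koszul_sign a A * (koszul_sign x (insert a A) * bs ! x)))"
      using False A
      by (simp add: koszul_column_def module.scale_right_distrib[OF module_fscale]
          module.scale_sum_right[OF module_fscale] fscale_single sa)
    also have "(\<Sum>x\<in>A. single (insert a A - {x}) (koszul_sign a A * (koszul_sign x (insert a A) * bs ! x)))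
        = (\<Sum>x\<in>A. - fscale (koszul_sign x A * bs ! x) (wedge_column a (A - {x})))"
    proof (rule sum.cong[OF refl])
      fix x assume x: "x \<in> A"
      have "insert a A - {x} = insert a (A - {x})" using x False by auto
      moreover have "koszul_sign a A * (koszul_sign x (insert a A) * bs ! x)
          = - (koszul_sign x A * bs ! x * koszul_sign a (A - {x}))"
      proof -
        have "koszul_sign a A * (koszul_sign x (insert a A) * bs ! x)
            = (koszul_sign a A * koszul_sign x (insert a A)) * bs ! x" by (simp only: mult.assoc)
        also have "\<dots> = - (koszul_sign x A * koszul_sign a (A - {x})) * bs ! x"
          by (rule arg_cong[where f = "\<lambda>y. y * bs ! x"]) (rule koszul_sign_insert[OF A False x])
        finally show ?thesis by (simp add: mult.assoc mult.commute mult.left_commute)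
      qed
      ultimately show "single (insert a A - {x}) (koszul_sign a A * (koszul_sign x (insert a A) * bs ! x))
          = - fscale (koszul_sign x A * bs ! x) (wedge_column a (A - {x}))"
        using False by (simp add: wedge_column_def fscale_single single_uminus)
    qed
    also have "\<dots> = - wedge a (koszul_column bs A)" by (simp add: w_sum sum_negf)
    finally show ?thesis by (simp add: koszul_sign_square)
  qed
qed

lemma koszul_homotopy:
  assumes "\<And>A. A \<in> keys x \<Longrightarrow> finite A"
  shows "koszul_diff bs (wedge a x) + wedge a (koszul_diff bs x) = fscale (bs ! a) x"
proof (induction x rule: poly_mapping_induct_single)
  case zero
  show ?case by (simp add: koszul_diff_eq linear_extension_def module.scale_zero_right[OF module_fscale])
next
  case (add A r y)
  interpret k: module_hom fscale fscale "linear_extension fscale (koszul_column bs)"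
    by (rule module_hom_linear_extension[OF module_fscale])
  interpret w: module_hom fscale fscale "wedge a :: _ \<Rightarrow> (nat set \<Rightarrow>\<^sub>0 'a)"
    by (rule module_hom_linear_extension[OF module_fscale])
  have "koszul_diff bs (wedge a (single A r)) + wedge a (koszul_diff bs (single A r))
      = fscale r (koszul_diff bs (wedge_column a A) + wedge a (koszul_column bs A))"
    by (simp add: koszul_diff_eq linear_extension_single[OF module_fscale] k.scale w.scale
        module.scale_right_distrib[OF module_fscale])
  also have "\<dots> = fscale (bs ! a) (single A r)"
    using koszul_homotopy_basis[OF assms[OF add(1)], of bs a] by (simp add: fscale_single mult.commute)
  finally show ?case
    using add(3) by (simp add: koszul_diff_eq w.add k.add module.scale_right_distrib[OF module_fscale] algebra_simps)
qed

text \<open>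
  By induction on \<open>A\<close>. If \<open>\<partial>\<partial> e\<^sub>A = 0\<close>, applying \<open>\<partial>\<close> to the homotopy formula gives \<open>\<partial>\<partial>(e\<^sub>a \<and>
  e\<^sub>A) = 0\<close>, and \<open>e\<^sub>a \<and> e\<^sub>A\<close> is up to sign the basis element of \<open>insert a A\<close>.
\<close>

lemma koszul_square_basis:
  assumes "finite A"
  shows "koszul_diff bs (koszul_column bs A) = 0"
  using assms
proof (induction A)
  case empty
  show ?case
    by (simp only: koszul_column_def koszul_diff_eq linear_extension_def keys_zero sum.empty)
next
  case (insert a A)
  interpret k: module_hom fscale fscale "linear_extension fscale (koszul_column bs)"
    by (rule module_hom_linear_extension[OF module_fscale])
  interpret w: module_hom fscale fscale "wedge a :: _ \<Rightarrow> (nat set \<Rightarrow>\<^sub>0 'a)"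
    by (rule module_hom_linear_extension[OF module_fscale])
  have fin: "finite C" if "C \<in> keys (koszul_column bs A)" for C
  proof -
    have "keys (koszul_column bs A) \<subseteq> (\<Union>x\<in>A. keys (single (A - {x}) (koszul_sign x A * bs ! x)))"
      unfolding koszul_column_def by (rule Poly_Mapping.keys_sum)
    then show ?thesis using that insert(1) by (auto split: if_splits)
  qed
  have e: "koszul_diff bs (single A r) = fscale r (koszul_column bs A)" for r
    by (simp add: koszul_diff_eq linear_extension_single[OF module_fscale])
  have "koszul_diff bs (wedge_column a A) = single A (bs ! a) - wedge a (koszul_column bs A)"
    using koszul_homotopy_basis[OF insert(1), of bs a] by (simp add: eq_diff_eq)
  then have "koszul_diff bs (koszul_diff bs (wedge_column a A))
      = fscale (bs ! a) (koszul_column bs A) - koszul_diff bs (wedge a (koszul_column bs A))"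
    using e by (simp add: koszul_diff_eq k.diff)
  also have "koszul_diff bs (wedge a (koszul_column bs A)) = fscale (bs ! a) (koszul_column bs A)"
    using koszul_homotopy[of "koszul_column bs A" bs a] fin insert.IH by (simp add: w.zero)
  finally have z: "koszul_diff bs (koszul_diff bs (wedge_column a A)) = 0" by simp
  have "koszul_diff bs (wedge_column a A) = fscale (koszul_sign a A) (koszul_column bs (insert a A))"
    using insert(2) by (simp add: wedge_column_def koszul_diff_eq linear_extension_single[OF module_fscale])
  then have "koszul_column bs (insert a A) = fscale (koszul_sign a A) (koszul_diff bs (wedge_column a A))"
    using koszul_sign_square[of a A "1 :: 'a"] by (simp add: module.scale_scale[OF module_fscale] module.scale_one[OF module_fscale])
  then show ?case using z by (simp add: koszul_diff_eq k.scale module.scale_zero_right[OF module_fscale])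
qed

lemma koszul_square:
  assumes "\<And>A. A \<in> keys x \<Longrightarrow> finite A"
  shows "koszul_diff bs (koszul_diff bs x) = 0"
proof -
  interpret k: module_hom fscale fscale "linear_extension fscale (koszul_column bs)"
    by (rule module_hom_linear_extension[OF module_fscale])
  have "koszul_diff bs (koszul_diff bs x) = (\<Sum>A\<in>keys x. fscale (lookup x A) (koszul_diff bs (koszul_column bs A)))"
    unfolding koszul_diff_eq
    by (subst (2) linear_extension_def) (simp add: k.sum k.scale)
  also have "\<dots> = 0"
  proof (rule sum.neutral, rule ballI)
    fix A assume "A \<in> keys x"
    then show "fscale (lookup x A) (koszul_diff bs (koszul_column bs A)) = 0"
      by (simp add: koszul_square_basis[OF assms] module.scale_zero_right[OF module_fscale])
  qed
  finally show ?thesis .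
qed

context standard_graded_algebra
begin

context
  fixes bs :: "'r list" and c :: nat
  assumes bs: "is_basis_list scale (G c) bs"
begin

abbreviation "koszul_index t \<equiv> {A. A \<subseteq> {..<length bs} \<and> card A = t}"

lemma koszul_component_eq:
  "koszul_component G c bs t d = tensor_part (koszul_index t) (\<lambda>_. int (t * c)) (int_component G) d"
  by (simp add: koszul_component_def free_component_eq)

lemma koszul_index_finite: "A \<in> koszul_index t \<Longrightarrow> finite A"
  by (auto intro: finite_subset)

lemma koszul_finite_keys:
  assumes "x \<in> koszul_component G c bs t d" "A \<in> keys x"
  shows "finite A"
  using tensor_partD(3)[OF assms(1)[unfolded koszul_component_eq]] assms(2)
  by (intro koszul_index_finite[of A t]) auto

lemma basis_element: "a < length bs \<Longrightarrow> bs ! a \<in> G c"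
  using bs span_superset[of "set bs"] unfolding is_basis_list_def by (metis nth_mem subsetD)

lemma sign_mult: "x \<in> G n \<Longrightarrow> koszul_sign a A * x \<in> G n"
proof -
  assume x: "x \<in> G n"
  have "koszul_sign a A = (1 :: 'r) \<or> koszul_sign a A = (- 1 :: 'r)"
    unfolding koszul_sign_def by (cases "even (card {b \<in> A. b < a})") simp_all
  then show ?thesis
    using x component_diff[OF component_zero x] by auto
qed

lemma graded_family_koszul: "graded_family G fscale (koszul_component G c bs t)"
  using graded_family_fscale[OF graded_family_ring] by (simp add: koszul_component_eq[abs_def])

lemma koszul_column_part:
  assumes "A \<in> koszul_index (Suc t)"
  shows "koszul_column bs A \<in> tensor_part (koszul_index t) (\<lambda>_. int (t * c)) (int_component G) (int (Suc t * c))"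
proof -
  have "graded_family G fscale (tensor_part (koszul_index t) (\<lambda>_. int (t * c)) (int_component G))"
    by (rule graded_family_fscale[OF graded_family_ring])
  then show ?thesis
    unfolding koszul_column_def
  proof (rule graded_family_sum)
    fix a assume a: "a \<in> A"
    have "finite A" using assms by (rule koszul_index_finite)
    then have "A - {a} \<in> koszul_index t" using assms a by auto
    moreover have "koszul_sign a A * bs ! a \<in> G c"
      using assms a by (intro sign_mult basis_element) auto
    ultimately show "single (A - {a}) (koszul_sign a A * bs ! a)
        \<in> tensor_part (koszul_index t) (\<lambda>_. int (t * c)) (int_component G) (int (Suc t * c))"
      by (auto simp: tensor_part_def lookup_single when_def int_component_def)
  qed
qed

lemma koszul_diff_part:
  assumes "x \<in> koszul_component G c bs (Suc t) d"
  shows "koszul_diff bs x \<in> koszul_component G c bs t d"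
  unfolding koszul_component_eq koszul_diff_eq linear_extension_eq_tensor_map
  by (rule tensor_map_in_tensor_part[OF module_ring_mult graded_family_ring assms[unfolded koszul_component_eq]])
    (rule koszul_column_part)

lemma wedge_part:
  assumes a: "a < length bs" and x: "x \<in> koszul_component G c bs t d"
  shows "wedge a x \<in> koszul_component G c bs (Suc t) (int c + d)"
proof -
  (* raising the degrees of all basis elements by c shifts the graded pieces by c *)
  have x': "x \<in> tensor_part (koszul_index t) (\<lambda>_. int (Suc t * c)) (int_component G) (int c + d)"
    using x unfolding koszul_component_eq by (auto simp: tensor_part_def algebra_simps)
  show ?thesis
    unfolding koszul_component_eq linear_extension_eq_tensor_map
  proof (rule tensor_map_in_tensor_part[OF module_ring_mult graded_family_ring x'])
    fix A assume A: "A \<in> koszul_index t"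
    have "finite A" using A by (rule koszul_index_finite)
    then have "a \<notin> A \<Longrightarrow> insert a A \<in> koszul_index (Suc t)" using A a by auto
    moreover have "koszul_sign a A \<in> G 0" using sign_mult[OF one_in_component_0, of a A] by simp
    ultimately show "wedge_column a A \<in> tensor_part (koszul_index (Suc t)) (\<lambda>_. int (Suc t * c)) (int_component G) (int (Suc t * c))"
      by (auto simp: wedge_column_def tensor_part_def lookup_single when_def int_component_def)
  qed
qed

lemma graded_family_cycles: "graded_family G fscale (koszul_cycles G c bs t)"
proof -
  interpret k: module_hom fscale fscale "koszul_diff bs"
    unfolding koszul_diff_eq by (rule module_hom_linear_extension[OF module_fscale])
  show ?thesis
    by (rule graded_familyI) (simp_all add: koszul_cycles_def k.zero k.diff k.scale
      graded_family_zero[OF graded_family_koszul] graded_family_diff[OF graded_family_koszul]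
      graded_family_scale[OF graded_family_koszul])
qed

lemma graded_family_boundaries: "graded_family G fscale (koszul_boundaries G c bs t)"
proof -
  interpret k: module_hom fscale fscale "koszul_diff bs"
    unfolding koszul_diff_eq by (rule module_hom_linear_extension[OF module_fscale])
  note fam = graded_family_koszul
  show ?thesis
    unfolding koszul_boundaries_def
  proof (rule graded_familyI)
    fix d show "0 \<in> koszul_diff bs ` koszul_component G c bs (Suc t) d"
      by (rule image_eqI[of _ _ 0]) (simp_all add: k.zero graded_family_zero[OF fam])
  next
    fix d x y assume "x \<in> koszul_diff bs ` koszul_component G c bs (Suc t) d" "y \<in> koszul_diff bs ` koszul_component G c bs (Suc t) d"
    then obtain x' y' where "x' \<in> koszul_component G c bs (Suc t) d" "y' \<in> koszul_component G c bs (Suc t) d"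
      "x = koszul_diff bs x'" "y = koszul_diff bs y'" by (elim imageE)
    then show "x - y \<in> koszul_diff bs ` koszul_component G c bs (Suc t) d"
      by (intro image_eqI[of _ _ "x' - y'"] graded_family_diff[OF fam]) (simp_all add: k.diff)
  next
    fix n d r x assume r: "r \<in> G n" and "x \<in> koszul_diff bs ` koszul_component G c bs (Suc t) d"
    then obtain x' where "x' \<in> koszul_component G c bs (Suc t) d" "x = koszul_diff bs x'" by (elim imageE)
    then show "fscale r x \<in> koszul_diff bs ` koszul_component G c bs (Suc t) (int n + d)"
      by (intro image_eqI[of _ _ "fscale r x'"] graded_family_scale[OF fam r]) (simp_all add: k.scale)
  qed
qed

lemma boundaries_subset_cycles: "koszul_boundaries G c bs t d \<subseteq> koszul_cycles G c bs t d"
proof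
  fix x assume "x \<in> koszul_boundaries G c bs t d"
  then obtain y where y: "y \<in> koszul_component G c bs (Suc t) d" "x = koszul_diff bs y"
    unfolding koszul_boundaries_def by (elim imageE)
  then show "x \<in> koszul_cycles G c bs t d"
    using koszul_diff_part[OF y(1)] koszul_square[OF koszul_finite_keys[OF y(1)]] by (simp add: koszul_cycles_def)
qed

lemma koszul_low:
  assumes "d < int (t * c)"
  shows "koszul_component G c bs t d = {0}"
proof -
  have "x = 0" if x: "x \<in> tensor_part (koszul_index t) (\<lambda>_. int (t * c)) (int_component G) d" for x
  proof (rule poly_mapping_eqI)
    fix A
    show "lookup x A = lookup 0 A"
    proof (cases "A \<in> koszul_index t")
      case True
      then show ?thesis using tensor_partD(1)[OF x True] assms by (simp add: int_component_def)
    next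
      case False
      then show ?thesis using tensor_partD(2)[OF x False] by simp
    qed
  qed
  then show ?thesis
    using tensor_part_zero[OF graded_family_ring] unfolding koszul_component_eq by blast
qed

lemma cycles_low: "d < int (t * c) \<Longrightarrow> koszul_cycles G c bs t d = {0}"
  using koszul_low[of d t] graded_family_zero[OF graded_family_cycles, of t d] by (auto simp: koszul_cycles_def)

lemma cycles_0: "koszul_cycles G c bs 0 d = koszul_component G c bs 0 d"
proof -
  have "koszul_diff bs x = 0" if x: "x \<in> koszul_component G c bs 0 d" for x
  proof -
    have e: "A = {}" if "A \<in> keys x" for A
      using koszul_finite_keys[OF x that] tensor_partD(3)[OF x[unfolded koszul_component_eq]] that by auto
    show ?thesis
      unfolding koszul_diff_def by (intro sum.neutral ballI) (drule e, simp)
  qed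
  then show ?thesis by (auto simp: koszul_cycles_def)
qed

text \<open>
  By the homotopy formula the \<open>k\<close>-th basis element of \<open>R\<^sub>c\<close> times a cycle \<open>z\<close> is the
  boundary of \<open>wedge k z\<close>, and every ring element of degree at least \<open>c\<close> is a combination of
  these basis elements.
\<close>

lemma annihilates_homology:
  assumes r: "r \<in> G n" and n: "n \<ge> c" and z: "z \<in> koszul_cycles G c bs t d"
  shows "fscale r z \<in> koszul_boundaries G c bs t (int n + d)"
proof -
  note fam = graded_family_boundaries[of t]
  have "span (set bs) = G c" using bs by (simp add: is_basis_list_def)
  then obtain s where s: "\<And>k. s k \<in> G (n - c)" "r = (\<Sum>k<length bs. bs ! k * s k)"
    using component_sum_split[of bs c r "n - c"] r n by auto
  have zc: "z \<in> koszul_component G c bs t d" "koszul_diff bs z = 0"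
    using z by (auto simp: koszul_cycles_def)
  have "fscale (bs ! k * s k) z \<in> koszul_boundaries G c bs t (int n + d)" if k: "k < length bs" for k
  proof -
    have "koszul_diff bs (wedge k z) = fscale (bs ! k) z"
      using koszul_homotopy[of z bs k] koszul_finite_keys[OF zc(1)] zc(2) by (simp add: linear_extension_def)
    then have "fscale (bs ! k) z \<in> koszul_boundaries G c bs t (int c + d)"
      unfolding koszul_boundaries_def using wedge_part[OF k zc(1)] by (intro image_eqI[of _ _ "wedge k z"]) simp_all
    from graded_family_scale[OF fam s(1) this, of k] have "fscale (s k * bs ! k) z \<in> koszul_boundaries G c bs t (int (n - c) + (int c + d))"
      by (simp add: module.scale_scale[OF module_fscale])
    moreover have "int (n - c) + (int c + d) = int n + d" using n by simp
    ultimately show ?thesis by (simp only: mult.commute)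
  qed
  then have "(\<Sum>k<length bs. fscale (bs ! k * s k) z) \<in> koszul_boundaries G c bs t (int n + d)"
    by (intro graded_family_sum[OF fam]) auto
  then show ?thesis unfolding s(2) module.scale_sum_left[OF module_fscale] .
qed

text \<open>
  Write a cycle as a combination of cycles of degree at most \<open>b\<close>. If its degree is at least
  \<open>b + c\<close>, all coefficients have degree at least \<open>c\<close> and annihilate the homology.
\<close>

lemma homology_vanishes_high_degree:
  assumes gen: "\<And>d. d > b \<Longrightarrow> koszul_cycles G c bs t d \<subseteq> positive_multiples G fscale (koszul_cycles G c bs t) d"
    and d: "d \<ge> b + int c"
  shows "koszul_cycles G c bs t d = koszul_boundaries G c bs t d"
proof
  note famB = graded_family_boundaries[of t] and famZ = graded_family_cycles[of t]
  have main: "fscale r z \<in> koszul_boundaries G c bs t (int n + e)"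
    if "z \<in> koszul_cycles G c bs t e" "r \<in> G n" "int n + e \<ge> b + int c" for e n r z
    using that
  proof (induction "nat (e - int (t * c))" arbitrary: e n r z rule: less_induct)
    case less
    show ?case
    proof (cases "e \<le> b")
      case True
      then show ?thesis using annihilates_homology[OF less(3) _ less(2)] less(4) by simp
    next
      case False
      have "z \<in> positive_multiples G fscale (koszul_cycles G c bs t) e" using gen[of e] less(2) False by auto
      then show ?thesis
      proof induction
        case zero
        show ?case by (simp add: module.scale_zero_right[OF module_fscale] graded_family_zero[OF famB])
      next
        case (add s m x y)
        have "fscale (r * s) x \<in> koszul_boundaries G c bs t (int (n + m) + (e - int m))"
        proof (cases "e - int m < int (t * c)")
          case True
          then have "x = 0" using add(3) cycles_low by auto
          then show ?thesis by (simp add: module.scale_zero_right[OF module_fscale] graded_family_zero[OF famB])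
        next
          case False
          show ?thesis
          proof (rule less(1)[OF _ add(3) component_mult[OF less(3) add(1)]])
            show "nat (e - int m - int (t * c)) < nat (e - int (t * c))" using False add(2) by simp
            show "b + int c \<le> int (n + m) + (e - int m)" using less(4) by simp
          qed
        qed
        then have "fscale r (fscale s x) \<in> koszul_boundaries G c bs t (int n + e)"
          by (simp add: module.scale_scale[OF module_fscale] algebra_simps)
        then show ?case
          unfolding module.scale_right_distrib[OF module_fscale] by (rule graded_family_add[OF famB]) (rule add(5))
      qed
    qed
  qed
  show "koszul_cycles G c bs t d \<subseteq> koszul_boundaries G c bs t d"
  proof
    fix z assume "z \<in> koszul_cycles G c bs t d"
    from main[OF this one_in_component_0] d show "z \<in> koszul_boundaries G c bs t d"
      by (simp add: module.scale_one[OF module_fscale])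
  qed
qed (rule boundaries_subset_cycles)

end

end

section \<open>Tor of the Koszul cycles\<close>

lemma module_restrict:
  assumes "module s" "\<And>x y. \<phi> (x + y) = \<phi> x + \<phi> y" "\<And>x y. \<phi> (x * y) = \<phi> x * \<phi> y" "\<phi> 1 = 1"
  shows "module (\<lambda>p. s (\<phi> p))"
proof -
  interpret s: module s by fact
  show ?thesis
    by standard (simp_all add: assms s.scale_right_distrib s.scale_left_distrib)
qed

lemma graded_family_restrict:
  "graded_family H s M \<Longrightarrow> (\<And>n p. p \<in> G n \<Longrightarrow> \<phi> p \<in> H n) \<Longrightarrow> graded_family G (\<lambda>p. s (\<phi> p)) M"
  unfolding graded_family_def by blast

lemma positive_multiples_restrict:
  assumes "x \<in> positive_multiples G (\<lambda>p. s (\<phi> p)) M d" "\<And>n p. p \<in> G n \<Longrightarrow> \<phi> p \<in> H n"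
  shows "x \<in> positive_multiples H s M d"
  using assms(1)
proof induction
  case (add r n x y)
  show ?case by (rule positive_multiples.add[OF assms(2)[OF add(1)] add(2,3,5)])
qed (rule positive_multiples.zero)

context residue_resolution
begin

context
  fixes sR :: "'l::field \<Rightarrow> 'q::comm_ring_1 \<Rightarrow> 'q" and H :: "nat \<Rightarrow> 'q set" and \<phi> :: "'r \<Rightarrow> 'q"
    and c :: nat and bs :: "'q list" and \<rho> r :: real
  assumes R: "standard_graded_algebra sR H"
    and \<phi>: "\<And>x y. \<phi> (x + y) = \<phi> x + \<phi> y" "\<And>x y. \<phi> (x * y) = \<phi> x * \<phi> y" "\<phi> 1 = 1"
    and \<phi>_deg: "\<And>n p. p \<in> G n \<Longrightarrow> \<phi> p \<in> H n"
    and bs: "is_basis_list sR (H c) bs"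
    and r: "r \<ge> 0"
    and tor_ring: "\<And>j d. real_of_int d > \<rho> + real j * r \<Longrightarrow>
      tor_vanishes (\<lambda>p x. \<phi> p * x) (int_component H) (\<lambda>d. {0}) j d"
    and tor_residue: "\<And>j d. j \<ge> 2 \<Longrightarrow> real_of_int d > 1 + (real j - 1) * r \<Longrightarrow> residue_tor_vanishes j d"
begin

abbreviation "restricted \<equiv> (\<lambda>p. fscale (\<phi> p)) :: 'r \<Rightarrow> (nat set \<Rightarrow>\<^sub>0 'q) \<Rightarrow> (nat set \<Rightarrow>\<^sub>0 'q)"

lemma module_restricted: "module restricted"
  by (rule module_restrict[OF module_fscale \<phi>])

lemmas family_koszul = graded_family_restrict[OF standard_graded_algebra.graded_family_koszul[OF R bs] \<phi>_deg]
lemmas family_cycles = graded_family_restrict[OF standard_graded_algebra.graded_family_cycles[OF R bs] \<phi>_deg]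
lemmas family_boundaries = graded_family_restrict[OF standard_graded_algebra.graded_family_boundaries[OF R bs] \<phi>_deg]
lemmas family_trivial = graded_family_trivial[OF module_restricted]

text \<open>
  The module \<open>K\<^sub>t\<close> is a direct sum of copies of \<open>R\<close> generated in degree \<open>t c\<close>.
\<close>

lemma koszul_tor:
  assumes "real_of_int d > \<rho> + real (t * c) + real j * r"
  shows "tor_vanishes restricted (koszul_component H c bs t) (\<lambda>d. {0}) j d"
proof -
  interpret R: standard_graded_algebra sR H by (rule R)
  have m: "module (\<lambda>p x. \<phi> p * x)" by (rule module_restrict[OF module_ring_mult \<phi>])
  have f: "graded_family G (\<lambda>p x. \<phi> p * x) (int_component H)"
    by (rule graded_family_restrict[OF R.graded_family_ring \<phi>_deg])
  have "tor_vanishes (\<lambda>p. Poly_Mapping.map (\<lambda>x. \<phi> p * x))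
      (tensor_part (R.koszul_index bs t) (\<lambda>_. int (t * c)) (int_component H)) (\<lambda>d. {0}) j d"
  proof (rule tor_vanishes_direct_sum[OF m f])
    show "tor_vanishes (\<lambda>p x. \<phi> p * x) (int_component H) (\<lambda>d. {0}) j (d - int (t * c))"
      by (rule tor_ring) (use assms in simp)
  qed
  then show ?thesis
    by (simp add: R.koszul_component_eq[OF bs, abs_def] fscale_def[abs_def])
qed

text \<open>
  Generators over \<open>A\<close> also generate over \<open>R\<close>.
\<close>

lemma cycles_generated:
  assumes t: "\<And>d. real_of_int d > b \<Longrightarrow> tor_vanishes restricted (koszul_cycles H c bs t) (\<lambda>d. {0}) 0 d"
    and d: "d > \<lfloor>b\<rfloor>"
  shows "koszul_cycles H c bs t d \<subseteq> positive_multiples H fscale (koszul_cycles H c bs t) d"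
proof
  fix z assume z: "z \<in> koszul_cycles H c bs t d"
  have "tor_vanishes restricted (koszul_cycles H c bs t) (\<lambda>d. {0}) 0 d" by (rule t) (use d in linarith)
  from tor_vanishes_0D[OF module_restricted family_cycles family_trivial this z] have "z \<in> positive_multiples G restricted (koszul_cycles H c bs t) d"
    by simp
  then show "z \<in> positive_multiples H fscale (koszul_cycles H c bs t) d"
    by (rule positive_multiples_restrict) (rule \<phi>_deg)
qed

text \<open>
  The induction on \<open>t\<close> that combines the two short exact sequences of the Koszul complex.
\<close>

lemma koszul_cycles_tor:
  assumes "real_of_int d > \<rho> + real (t * c) + real (t + j) * r"
  shows "tor_vanishes restricted (koszul_cycles H c bs t) (\<lambda>d. {0}) j d"
  using assms
proof (induction t arbitrary: j d)
  case 0
  interpret R: standard_graded_algebra sR H by (rule R)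
  have "tor_vanishes restricted (koszul_component H c bs 0) (\<lambda>d. {0}) j d"
    by (rule koszul_tor) (use 0 in simp)
  moreover have "koszul_cycles H c bs 0 = koszul_component H c bs 0"
    by (rule ext) (rule R.cycles_0[OF bs])
  ultimately show ?case by (simp only:)
next
  case (Suc t)
  interpret R: standard_graded_algebra sR H by (rule R)
  interpret k: module_hom fscale fscale "koszul_diff bs"
    unfolding koszul_diff_eq by (rule module_hom_linear_extension[OF module_fscale])
  let ?Z = "koszul_cycles H c bs" and ?K = "koszul_component H c bs" and ?B = "koszul_boundaries H c bs"
  (* b is the bound on the degrees of the generators of the t-th cycles *)
  define b where "b = \<rho> + real (t * c) + real t * r"
  have sub: "\<And>d. {0} \<subseteq> ?Z t d" "\<And>d. {0} \<subseteq> ?B t d" "\<And>d. {0} \<subseteq> ?Z (Suc t) d"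
    by (simp_all add: graded_family_zero[OF family_cycles] graded_family_zero[OF family_boundaries])
  have ZK: "?Z (Suc t) d \<subseteq> ?K (Suc t) d" for d by (auto simp: koszul_cycles_def)
  have d: "real_of_int d > b + real c + real (Suc j) * r"
    using Suc.prems by (simp add: b_def algebra_simps)
  have Zt: "tor_vanishes restricted (?Z t) (\<lambda>d. {0}) 0 e" if "real_of_int e > b" for e
    by (rule Suc.IH) (use that in \<open>simp add: b_def\<close>)
  (* the largest degree in which the homology can be nonzero is floor b + c - 1 *)
  have high: "?Z t e = ?B t e" if "e > \<lfloor>b\<rfloor> + int c - 1" for e
  proof (rule R.homology_vanishes_high_degree[OF bs])
    show "\<lfloor>b\<rfloor> + int c \<le> e" using that by simp
    fix e assume e: "\<lfloor>b\<rfloor> < e"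
    show "?Z t e \<subseteq> positive_multiples H fscale (?Z t) e" by (rule cycles_generated[OF _ e]) (rule Zt)
  qed
  have "tor_vanishes restricted (?Z t) (?B t) (Suc (Suc j)) d"
  proof (rule tor_vanishes_bounded[OF module_restricted family_cycles family_boundaries R.boundaries_subset_cycles[OF bs] _ high])
    fix e assume e: "e < int (t * c)"
    show "?Z t e = ?B t e"
      using R.cycles_low[OF bs e] R.boundaries_subset_cycles[OF bs, of t e] sub(2)[of e] by blast
  next
    (* d exceeds b + c + (j + 1) r, so d - e exceeds 1 + (j + 1) r, which bounds Tor of K in degree j + 2 *)
    fix e assume "e \<le> \<lfloor>b\<rfloor> + int c - 1"
    then have "real_of_int e \<le> b + real c - 1" by linarith
    then show "residue_tor_vanishes (Suc (Suc j)) (d - e)"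
      using d by (intro tor_residue) (simp_all add: algebra_simps)
  qed
  moreover have "tor_vanishes restricted (?Z t) (\<lambda>d. {0}) (Suc j) d"
  proof (rule Suc.IH)
    have "real (t + Suc j) * r = real t * r + real (Suc j) * r" by (simp add: algebra_simps)
    then show "\<rho> + real (t * c) + real (t + Suc j) * r < real_of_int d" using d by (simp add: b_def)
  qed
  ultimately have "tor_vanishes restricted (?B t) (\<lambda>d. {0}) (Suc j) d"
    by (intro tor_vanishes_sub[OF module_restricted family_trivial family_boundaries family_cycles sub(2) R.boundaries_subset_cycles[OF bs]])
  then have B: "tor_vanishes restricted (?B t) (\<lambda>d. {0}) (Suc j) (d + 0)" by simp
  have KZ: "tor_vanishes restricted (?K (Suc t)) (?Z (Suc t)) (Suc j) d"
  proof (rule tor_vanishes_iso_reverse[where f = "koszul_diff bs" and s = 0, OF module_restricted module_restricted family_koszul family_cycles family_boundaries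
        family_trivial k.add k.scale _ _ _ _ B])
    show "koszul_diff bs x \<in> ?B t (e + 0)" if "x \<in> ?K (Suc t) e" for e x
      using that by (simp add: koszul_boundaries_def)
    show "koszul_diff bs x \<in> {0}" if "x \<in> ?Z (Suc t) e" for e x
      using that by (simp add: koszul_cycles_def)
    show "x \<in> ?Z (Suc t) e" if "x \<in> ?K (Suc t) e" "koszul_diff bs x \<in> {0}" for e x
      using that by (simp add: koszul_cycles_def)
    show "\<exists>x\<in>?K (Suc t) e. y - koszul_diff bs x \<in> {0}" if "y \<in> ?B t (e + 0)" for e y
      using that by (auto simp: koszul_boundaries_def)
  qed
  have K: "tor_vanishes restricted (?K (Suc t)) (\<lambda>d. {0}) j d"
  proof (rule koszul_tor)
    have "real (Suc t + j) * r = real (Suc t) * r + real j * r" by (simp add: algebra_simps)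
    moreover have "real (Suc t) * r \<ge> 0" using r by simp
    ultimately show "\<rho> + real (Suc t * c) + real j * r < real_of_int d" using Suc.prems by linarith
  qed
  show ?case
    by (rule tor_vanishes_sub[OF module_restricted family_trivial family_cycles family_koszul sub(3) ZK K KZ])
qed

end

end

section \<open>The polynomial ring\<close>

type_synonym ('n, 'k) polynomial = "('n \<Rightarrow>\<^sub>0 nat) \<Rightarrow>\<^sub>0 'k"

abbreviation monomial_degree :: "('n::finite \<Rightarrow>\<^sub>0 nat) \<Rightarrow> nat" where
  "monomial_degree m \<equiv> (\<Sum>v\<in>UNIV. lookup m v)"

lemma monomial_degree_add: "monomial_degree (m + m') = monomial_degree m + monomial_degree m'"
  by (simp add: lookup_add sum.distrib)

lemma monomial_degree_eq_0: "monomial_degree m = 0 \<longleftrightarrow> m = 0"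
  by (auto intro!: poly_mapping_eqI)

lemma monomial_degree_variable: "monomial_degree (single v (Suc 0)) = 1"
  by (simp add: lookup_single when_def)

lemma fscale_eq_mult: "fscale a p = single 0 a * p"
  by (simp add: fscale_def mult_map_scale_conv_mult)

lemma homogeneous_polysI: "(\<And>m. m \<in> keys p \<Longrightarrow> monomial_degree m = d) \<Longrightarrow> p \<in> homogeneous_polys d"
  by (simp add: homogeneous_polys_def)

lemma homogeneous_polysD: "p \<in> homogeneous_polys d \<Longrightarrow> m \<in> keys p \<Longrightarrow> monomial_degree m = d"
  by (simp add: homogeneous_polys_def)

lemma vector_space_polys: "vector_space (fscale :: 'k::field \<Rightarrow> ('b \<Rightarrow>\<^sub>0 'k) \<Rightarrow> _)"
  by standard (auto intro!: poly_mapping_eqI simp: lookup_add algebra_simps)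

lemma homogeneous_polys_subspace:
  "module.subspace (fscale :: 'k::field \<Rightarrow> _) (homogeneous_polys d :: (('n::finite \<Rightarrow>\<^sub>0 nat) \<Rightarrow>\<^sub>0 'k) set)"
proof (rule module.subspaceI[OF module_fscale])
  show "0 \<in> (homogeneous_polys d :: ('n, 'k) polynomial set)" by (simp add: homogeneous_polys_def)
next
  fix p q :: "('n, 'k) polynomial"
  assume "p \<in> homogeneous_polys d" "q \<in> homogeneous_polys d"
  then show "p + q \<in> homogeneous_polys d"
    using Poly_Mapping.keys_add[of p q] by (auto intro!: homogeneous_polysI dest: homogeneous_polysD)
next
  fix a and p :: "('n, 'k) polynomial"
  assume "p \<in> homogeneous_polys d"
  then show "fscale a p \<in> homogeneous_polys d"
    using keys_fscale[of a p] by (auto intro!: homogeneous_polysI dest: homogeneous_polysD)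
qed

text \<open>
  The component of degree \<open>d\<close> collects the monomials of degree \<open>d\<close>. A coefficient of \<open>p\<close> can
  come from one component only, which gives uniqueness.
\<close>

lemma homogeneous_polys_decomposition:
  fixes p :: "('n::finite, 'k::field) polynomial"
  shows "\<exists>!f. (\<forall>d. f d \<in> homogeneous_polys d) \<and> finite {d. f d \<noteq> 0} \<and> p = (\<Sum>d\<in>{d. f d \<noteq> 0}. f d)"
proof (rule ex_ex1I)
  define f where "f d = (\<Sum>m\<in>{m \<in> keys p. monomial_degree m = d}. single m (lookup p m))" for d
  have l: "lookup (f d) m = (if monomial_degree m = d then lookup p m else 0)" for d m
    by (simp add: f_def lookup_sum_single in_keys_iff)
  have "f d \<in> homogeneous_polys d" for d
    by (rule homogeneous_polysI) (auto simp: in_keys_iff l split: if_splits)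
  moreover have sub: "{d. f d \<noteq> 0} \<subseteq> monomial_degree ` keys p"
  proof
    fix d assume "d \<in> {d. f d \<noteq> 0}"
    then have "f d \<noteq> 0" by simp
    then obtain m where "lookup (f d) m \<noteq> 0" by (metis lookup_zero poly_mapping_eqI)
    then show "d \<in> monomial_degree ` keys p" by (auto simp: l in_keys_iff split: if_splits)
  qed
  moreover have "finite {d. f d \<noteq> 0}" by (rule finite_subset[OF sub]) simp
  moreover have "p = (\<Sum>d\<in>{d. f d \<noteq> 0}. f d)"
  proof -
    have "(\<Sum>d\<in>{d. f d \<noteq> 0}. f d) = (\<Sum>d\<in>monomial_degree ` keys p. f d)"
      by (rule sum.mono_neutral_left) (use sub in auto)
    also have "\<dots> = p"
    proof (rule poly_mapping_eqI)
      fix m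
      have "lookup (\<Sum>d\<in>monomial_degree ` keys p. f d) m
          = (\<Sum>d\<in>monomial_degree ` keys p. if d = monomial_degree m then lookup p m else 0)"
        unfolding lookup_sum by (rule sum.cong) (auto simp: l)
      also have "\<dots> = (if monomial_degree m \<in> monomial_degree ` keys p then lookup p m else 0)"
        by (rule sum.delta) simp
      also have "\<dots> = lookup p m" by (auto simp: in_keys_iff)
      finally show "lookup (\<Sum>d\<in>monomial_degree ` keys p. f d) m = lookup p m" .
    qed
    finally show ?thesis by simp
  qed
  ultimately show "\<exists>f. (\<forall>d. f d \<in> homogeneous_polys d) \<and> finite {d. f d \<noteq> 0} \<and> p = (\<Sum>d\<in>{d. f d \<noteq> 0}. f d)"
    by blast
next
  have key: "lookup (f d) m = (if monomial_degree m = d then lookup p m else 0)"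
    if f: "(\<forall>d. f d \<in> homogeneous_polys d) \<and> finite {d. f d \<noteq> 0} \<and> p = (\<Sum>d\<in>{d. f d \<noteq> 0}. f d)" for f d m
  proof -
    have z: "lookup (f e) m = 0" if "e \<noteq> monomial_degree m" for e
      using f that homogeneous_polysD[of "f e" e m] by (auto simp: in_keys_iff)
    have "lookup p m = (\<Sum>e\<in>{e. f e \<noteq> 0}. lookup (f e) m)"
      using f lookup_sum[of f "{e. f e \<noteq> 0}" m] by simp
    also have "\<dots> = (\<Sum>e\<in>{e. f e \<noteq> 0}. if e = monomial_degree m then lookup (f e) m else 0)"
      by (rule sum.cong[OF refl]) (simp add: z)
    also have "\<dots> = (if monomial_degree m \<in> {e. f e \<noteq> 0} then lookup (f (monomial_degree m)) m else 0)"
      by (rule sum.delta) (use f in blast)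
    also have "\<dots> = lookup (f (monomial_degree m)) m" by auto
    finally show ?thesis using z[of d] by auto
  qed
  fix f f'
  assume f: "(\<forall>d. f d \<in> homogeneous_polys d) \<and> finite {d. f d \<noteq> 0} \<and> p = (\<Sum>d\<in>{d. f d \<noteq> 0}. f d)"
    and f': "(\<forall>d. f' d \<in> homogeneous_polys d) \<and> finite {d. f' d \<noteq> 0} \<and> p = (\<Sum>d\<in>{d. f' d \<noteq> 0}. f' d)"
  show "f = f'"
    by (rule ext, rule poly_mapping_eqI) (simp only: key[OF f] key[OF f'])
qed

lemma homogeneous_polys_mult:
  assumes "p \<in> homogeneous_polys d" "q \<in> homogeneous_polys e"
  shows "p * q \<in> homogeneous_polys (d + e)"
proof (rule homogeneous_polysI)
  fix m assume "m \<in> keys (p * q)"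
  then obtain a b where "a \<in> keys p" "b \<in> keys q" "m = a + b"
    using keys_mult[of p q] by blast
  then show "monomial_degree m = d + e"
    using homogeneous_polysD[OF assms(1)] homogeneous_polysD[OF assms(2)] by (simp add: monomial_degree_add)
qed

lemma homogeneous_polys_0:
  "(homogeneous_polys 0 :: ('n::finite, 'k::field) polynomial set) = range (\<lambda>a. fscale a 1)"
proof
  show "(homogeneous_polys 0 :: ('n, 'k) polynomial set) \<subseteq> range (\<lambda>a. fscale a 1)"
  proof
    fix p :: "('n, 'k) polynomial"
    assume p: "p \<in> homogeneous_polys 0"
    have z: "lookup p m = 0" if "m \<noteq> 0" for m
      using homogeneous_polysD[OF p, of m] that monomial_degree_eq_0[of m] by (auto simp: in_keys_iff)
    have "p = fscale (lookup p 0) 1"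
      by (rule poly_mapping_eqI) (simp add: lookup_one when_def z)
    then show "p \<in> range (\<lambda>a. fscale a 1)" by blast
  qed
  show "range (\<lambda>a. fscale a 1) \<subseteq> (homogeneous_polys 0 :: ('n, 'k) polynomial set)"
  proof clarify
    fix a :: 'k
    let ?p = "fscale a 1 :: ('n, 'k) polynomial"
    have "keys ?p \<subseteq> {0}" using keys_fscale[of a "1 :: ('n, 'k) polynomial"] by simp
    then show "?p \<in> homogeneous_polys 0"
      by (intro homogeneous_polysI) auto
  qed
qed

abbreviation variable :: "'n \<Rightarrow> ('n::finite, 'k::field) polynomial" where
  "variable v \<equiv> single (single v (Suc 0)) 1"

lemma variable_homogeneous: "variable v \<in> homogeneous_polys 1"
  by (rule homogeneous_polysI) (simp add: monomial_degree_variable)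

lemma polys_generated:
  fixes A :: "('n::finite, 'k::field) polynomial set"
  assumes X: "range variable \<subseteq> A" and one: "1 \<in> A" and sub: "module.subspace fscale A"
    and mult: "\<And>x y. x \<in> A \<Longrightarrow> y \<in> A \<Longrightarrow> x * y \<in> A"
  shows "A = UNIV"
proof -
  have pow: "single (single v n) 1 \<in> A" for v n
  proof (induction n)
    case (Suc n)
    have "variable v * single (single v n) 1 \<in> A" using mult X Suc by blast
    then show ?case by (simp add: mult_single single_add[symmetric])
  qed (use one in simp)
  have mon: "single m 1 \<in> A" for m :: "'n \<Rightarrow>\<^sub>0 nat"
  proof (induction m rule: poly_mapping_induct_single)
    case (add b r x)
    have "single (single b r) 1 * single x 1 \<in> A" by (rule mult[OF pow add(3)])
    then show ?case by (simp add: mult_single)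
  qed (use one in simp)
  have "p \<in> A" for p
  proof -
    have "(\<Sum>m\<in>keys p. fscale (lookup p m) (single m 1)) \<in> A"
      by (intro module.subspace_sum[OF module_fscale sub] module.subspace_scale[OF module_fscale sub] mon)
    then show "p \<in> A" using poly_mapping_sum_singles[of p] by (simp add: fscale_single)
  qed
  then show ?thesis by blast
qed

theorem polynomial_ring_standard_graded:
  "standard_graded_algebra fscale (homogeneous_polys :: nat \<Rightarrow> ('n::finite, 'k::field) polynomial set)"
proof (intro standard_graded_algebra.intro standard_graded_algebra_axioms.intro)
  show "vector_space (fscale :: 'k \<Rightarrow> ('n, 'k) polynomial \<Rightarrow> _)" by (rule vector_space_polys)
  show "fscale a (x * y) = fscale a x * y" for a :: 'k and x y :: "('n, 'k) polynomial"
    by (simp add: fscale_eq_mult mult.assoc)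
  show "module.subspace fscale (homogeneous_polys d :: ('n, 'k) polynomial set)" for d
    by (rule homogeneous_polys_subspace)
  show "\<exists>!f. (\<forall>d. f d \<in> homogeneous_polys d) \<and> finite {d. f d \<noteq> 0} \<and> x = (\<Sum>d\<in>{d. f d \<noteq> 0}. f d)"
    for x :: "('n, 'k) polynomial"
    by (rule homogeneous_polys_decomposition)
  show "x * y \<in> homogeneous_polys (d + e)" if "x \<in> homogeneous_polys d" "y \<in> homogeneous_polys e"
    for x y :: "('n, 'k) polynomial" and d e
    using that by (rule homogeneous_polys_mult)
  show "(homogeneous_polys 0 :: ('n, 'k) polynomial set) = range (\<lambda>a. fscale a 1)"
    by (rule homogeneous_polys_0)
  show "\<exists>X. finite X \<and> X \<subseteq> (homogeneous_polys 1 :: ('n, 'k) polynomial set) \<and>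
      (\<forall>A. X \<subseteq> A \<and> 1 \<in> A \<and> module.subspace fscale A \<and> (\<forall>x\<in>A. \<forall>y\<in>A. x * y \<in> A) \<longrightarrow> A = UNIV)"
  proof (intro exI[of _ "range variable"] conjI allI impI)
    show "finite (range variable :: ('n, 'k) polynomial set)" by simp
    show "range variable \<subseteq> (homogeneous_polys 1 :: ('n, 'k) polynomial set)"
      using variable_homogeneous by blast
    fix A :: "('n, 'k) polynomial set"
    assume "range variable \<subseteq> A \<and> 1 \<in> A \<and> module.subspace fscale A \<and> (\<forall>x\<in>A. \<forall>y\<in>A. x * y \<in> A)"
    then show "A = UNIV" by (intro polys_generated) auto
  qed
qed

text \<open>
  The pieces of the ideal generated by the variables in \<open>U\<close>: all monomials are divisible by
  such a variable.
\<close>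

definition variable_ideal :: "'n set \<Rightarrow> int \<Rightarrow> ('n::finite, 'k::field) polynomial set" where
  "variable_ideal U e = {p \<in> int_component homogeneous_polys e. \<forall>m\<in>keys p. \<exists>v\<in>U. lookup m v > 0}"

lemma int_component_polys:
  fixes p :: "('n::finite, 'k::field) polynomial"
  shows "p \<in> int_component homogeneous_polys e \<longleftrightarrow> (\<forall>m\<in>keys p. int (monomial_degree m) = e)"
proof (cases "e < 0")
  case True
  have "p = 0" if *: "\<forall>m\<in>keys p. int (monomial_degree m) = e"
  proof (rule poly_mapping_eqI)
    fix m :: "'n \<Rightarrow>\<^sub>0 nat"
    have "int (monomial_degree m) \<ge> 0" by (rule of_nat_0_le_iff)
    then have "m \<notin> keys p" using * True by (metis not_less)
    then show "lookup p m = lookup 0 m" by (simp add: in_keys_iff)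
  qed
  then show ?thesis using True by (auto simp: int_component_def)
next
  case False
  then show ?thesis by (auto simp: int_component_def homogeneous_polys_def simp del: of_nat_sum)
qed

lemma variable_ideal_iff:
  "p \<in> variable_ideal U e \<longleftrightarrow> (\<forall>m\<in>keys p. int (monomial_degree m) = e \<and> (\<exists>v\<in>U. lookup m v > 0))"
  unfolding variable_ideal_def int_component_polys by blast

lemma keys_variable_mult: "m \<in> keys (variable v * p) \<longleftrightarrow> (\<exists>m'\<in>keys p. m = single v (Suc 0) + m')"
proof -
  have eq: "variable v * p = (\<Sum>m'\<in>keys p. single (single v (Suc 0) + m') (lookup p m'))"
    by (subst (1) poly_mapping_sum_singles[of p]) (simp add: sum_distrib_left mult_single)
  have "lookup (variable v * p) m = (\<Sum>m'\<in>keys p. if m = single v (Suc 0) + m' then lookup p m' else 0)"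
    unfolding eq lookup_sum by (rule sum.cong) (auto simp: lookup_single when_def)
  also have "\<dots> = (if \<exists>m'\<in>keys p. m = single v (Suc 0) + m' then lookup p (m - single v (Suc 0)) else 0)"
  proof (cases "\<exists>m'\<in>keys p. m = single v (Suc 0) + m'")
    case True
    then obtain m' where m': "m' \<in> keys p" "m = single v (Suc 0) + m'" by blast
    have "(\<Sum>k\<in>keys p. if m = single v (Suc 0) + k then lookup p k else 0) = (\<Sum>k\<in>keys p. if k = m' then lookup p k else 0)"
      using m'(2) by (intro sum.cong) auto
    then show ?thesis using m' by simp
  next
    case False
    then show ?thesis by (auto intro!: sum.neutral)
  qed
  finally show ?thesis by (auto simp: in_keys_iff)
qed

context
  fixes B :: "nat \<Rightarrow> nat set" and \<delta> g \<epsilon> and u :: "nat \<Rightarrow>\<^sub>0 ('n::finite, 'k::field) polynomial"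
  assumes P: "residue_resolution (fscale :: 'k \<Rightarrow> _) (homogeneous_polys :: nat \<Rightarrow> ('n, 'k) polynomial set) B \<delta> g \<epsilon> u"
begin

interpretation P: residue_resolution "fscale :: 'k \<Rightarrow> _" "homogeneous_polys :: nat \<Rightarrow> ('n, 'k) polynomial set" B \<delta> g \<epsilon> u
  by (rule P)

lemma graded_family_variable_ideal:
  "graded_family homogeneous_polys (*) (variable_ideal U :: int \<Rightarrow> ('n, 'k) polynomial set)"
proof (rule graded_familyI)
  fix d and x y :: "('n, 'k) polynomial"
  assume "x \<in> variable_ideal U d" "y \<in> variable_ideal U d"
  moreover have "keys (x - y) \<subseteq> keys x \<union> keys y"
    by (auto simp: in_keys_iff lookup_minus)
  ultimately show "x - y \<in> variable_ideal U d" unfolding variable_ideal_iff by blast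
next
  fix n d and r x :: "('n, 'k) polynomial"
  assume r: "r \<in> homogeneous_polys n" and x: "x \<in> variable_ideal U d"
  show "r * x \<in> variable_ideal U (int n + d)"
    unfolding variable_ideal_iff
  proof
    fix m assume "m \<in> keys (r * x)"
    then obtain a b where ab: "a \<in> keys r" "b \<in> keys x" "m = a + b" using keys_mult[of r x] by blast
    then have "int (monomial_degree b) = d" "\<exists>v\<in>U. lookup b v > 0" "monomial_degree a = n"
      using x homogeneous_polysD[OF r] unfolding variable_ideal_iff by blast+
    then show "int (monomial_degree m) = int n + d \<and> (\<exists>v\<in>U. 0 < lookup m v)"
      unfolding ab(3) monomial_degree_add by (auto simp: lookup_add)
  qed
qed (simp add: variable_ideal_iff)

text \<open>
  Adding a variable \<open>v\<close> to \<open>U\<close>: multiplication by \<open>v\<close> is injective modulo the old ideal and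
  has the new ideal modulo the old one as its image. So \<open>S/I\<close> shifted by one, \<open>S/I\<close> and
  \<open>S/J\<close> form a short exact sequence for the old ideal \<open>I\<close> and the new ideal \<open>J\<close>, and
  \<open>t\<^sub>j\<^sub>+\<^sub>1(S/J) \<le> j + 1\<close> follows from the bounds for \<open>S/I\<close>.
\<close>

lemma tor_vanishes_variable_ideal:
  assumes "finite U" "d > int j"
  shows "P.tor_vanishes (*) (int_component homogeneous_polys) (variable_ideal U) j d"
  using assms
proof (induction U arbitrary: j d)
  case empty
  let ?S = "int_component (homogeneous_polys :: nat \<Rightarrow> ('n, 'k) polynomial set)"
  have "P.tor_vanishes (*) ?S (\<lambda>d. {0}) j d"
  proof (cases j)
    case 0
    show ?thesis unfolding 0
    proof (rule P.tor_vanishes_0I[OF module_ring_mult P.graded_family_ring graded_family_trivial[OF module_ring_mult]])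
      fix x assume x: "x \<in> ?S d"
      have "x * 1 \<in> positive_multiples homogeneous_polys (*) ?S d"
        by (rule positive_multiples_single[of _ _ "nat d"])
          (use x empty 0 P.one_in_component_0 in \<open>auto simp: int_component_def\<close>)
      then show "\<exists>n\<in>{0}. x - n \<in> positive_multiples homogeneous_polys (*) ?S d" by simp
    qed
  qed (simp add: P.tor_vanishes_ring)
  moreover have "variable_ideal {} = (\<lambda>d. {0 :: ('n, 'k) polynomial})"
    by (intro ext) (auto simp: variable_ideal_iff)
  ultimately show ?case by simp
next
  case (insert v U)
  let ?S = "int_component (homogeneous_polys :: nat \<Rightarrow> ('n, 'k) polynomial set)"
  let ?I = "variable_ideal U :: int \<Rightarrow> ('n, 'k) polynomial set"
  let ?J = "variable_ideal (insert v U) :: int \<Rightarrow> ('n, 'k) polynomial set"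
  note fam = graded_family_variable_ideal
  have sub: "?I e \<subseteq> ?J e" "?J e \<subseteq> ?S e" for e
    by (auto simp: variable_ideal_iff int_component_polys)
  have step: "P.tor_vanishes (*) ?J ?I j (d - 1 + 1)" if "d - 1 > int j" for j d
  proof (rule P.tor_vanishes_iso[where f = "\<lambda>p. variable v * p" and s = 1, OF module_ring_mult module_ring_mult
        P.graded_family_ring fam fam fam distrib_left _ _ _ _ _ insert.IH[OF that]])
    show "variable v * (r * x) = r * (variable v * x)" for r x :: "('n, 'k) polynomial"
      by (simp add: mult.left_commute)
  next
    fix e and x :: "('n, 'k) polynomial" assume x: "x \<in> ?S e"
    show "variable v * x \<in> ?J (e + 1)"
      unfolding variable_ideal_iff
    proof
      fix m assume "m \<in> keys (variable v * x)"
      then obtain m' where m': "m' \<in> keys x" "m = single v (Suc 0) + m'" by (auto simp: keys_variable_mult)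
      have "int (monomial_degree m') = e" using x m'(1) by (simp add: int_component_polys)
      then show "int (monomial_degree m) = e + 1 \<and> (\<exists>u\<in>insert v U. 0 < lookup m u)"
        unfolding m'(2) monomial_degree_add monomial_degree_variable by (auto simp: lookup_add)
    qed
  next
    fix e and x :: "('n, 'k) polynomial" assume x: "x \<in> ?I e"
    show "variable v * x \<in> ?I (e + 1)"
      unfolding variable_ideal_iff
    proof
      fix m assume "m \<in> keys (variable v * x)"
      then obtain m' where m': "m' \<in> keys x" "m = single v (Suc 0) + m'" by (auto simp: keys_variable_mult)
      have "int (monomial_degree m') = e" "\<exists>u\<in>U. lookup m' u > 0"
        using x m'(1) unfolding variable_ideal_iff by blast+
      then show "int (monomial_degree m) = e + 1 \<and> (\<exists>u\<in>U. 0 < lookup m u)"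
        unfolding m'(2) monomial_degree_add monomial_degree_variable by (auto simp: lookup_add)
    qed
  next
    fix e and x :: "('n, 'k) polynomial" assume x: "x \<in> ?S e" "variable v * x \<in> ?I (e + 1)"
    show "x \<in> ?I e"
      unfolding variable_ideal_iff
    proof
      fix m assume m: "m \<in> keys x"
      then have "single v (Suc 0) + m \<in> keys (variable v * x)" by (auto simp: keys_variable_mult)
      then obtain u where u: "u \<in> U" "lookup (single v (Suc 0) + m) u > 0"
        using x(2) unfolding variable_ideal_iff by blast
      then have "lookup m u > 0" using insert.hyps by (auto simp: lookup_add lookup_single when_def split: if_splits)
      then show "int (monomial_degree m) = e \<and> (\<exists>v\<in>U. 0 < lookup m v)"
        using x(1) m u(1) unfolding int_component_polys by blast
    qed
  next
    fix e and q :: "('n, 'k) polynomial" assume q: "q \<in> ?J (e + 1)"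
    let ?D = "{m \<in> keys q. lookup m v > 0}"
    have split: "single v (Suc 0) + (m - single v (Suc 0)) = m" if "lookup m v > 0" for m :: "'n \<Rightarrow>\<^sub>0 nat"
      by (rule poly_mapping_eqI) (use that in \<open>auto simp: lookup_add lookup_minus lookup_single when_def\<close>)
    (* p is the sum of the terms of q divisible by v, divided by v *)
    define p where "p = (\<Sum>m\<in>?D. single (m - single v (Suc 0)) (lookup q m))"
    have "p \<in> ?S e"
      unfolding int_component_polys
    proof
      fix m assume "m \<in> keys p"
      then obtain m' where m': "m' \<in> ?D" "m = m' - single v (Suc 0)"
        using Poly_Mapping.keys_sum[of "\<lambda>m. single (m - single v (Suc 0)) (lookup q m)" ?D]
        by (auto simp: p_def split: if_splits)
      then have "int (monomial_degree m') = e + 1" using q unfolding variable_ideal_iff by blast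
      moreover have "monomial_degree m' = 1 + monomial_degree m"
        using split[of m'] m' monomial_degree_add[of "single v (Suc 0)" m] by (simp add: monomial_degree_variable)
      ultimately show "int (monomial_degree m) = e" by simp
    qed
    moreover have "q - variable v * p \<in> ?I (e + 1)"
    proof -
      have "variable v * p = (\<Sum>m\<in>?D. single m (lookup q m))"
        unfolding p_def sum_distrib_left mult_single by (rule sum.cong) (simp_all add: split)
      then have l: "lookup (q - variable v * p) m = (if lookup m v > 0 then 0 else lookup q m)" for m
        by (simp add: lookup_minus lookup_sum_single in_keys_iff)
      show ?thesis
        unfolding variable_ideal_iff
      proof
        fix m assume "m \<in> keys (q - variable v * p)"
        then have "m \<in> keys q" "\<not> lookup m v > 0" using l[of m] by (auto simp: in_keys_iff split: if_splits)
        moreover from q[unfolded variable_ideal_iff, rule_format, OF this(1)]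
        have "int (monomial_degree m) = e + 1" "\<exists>u\<in>insert v U. 0 < lookup m u" by simp_all
        ultimately show "int (monomial_degree m) = e + 1 \<and> (\<exists>u\<in>U. 0 < lookup m u)" by simp
      qed
    qed
    ultimately show "\<exists>p\<in>?S e. q - variable v * p \<in> ?I (e + 1)" by (intro bexI[of _ p])
  qed
  show ?case
  proof (cases j)
    case 0
    then show ?thesis
      using P.tor_vanishes_quotient_0[OF _ sub(1)] insert.IH[of 0 d] insert.prems by simp
  next
    case (Suc k)
    have "P.tor_vanishes (*) ?J ?I k d" using step[of k d] insert.prems Suc by simp
    then show ?thesis unfolding Suc
      by (intro P.tor_vanishes_quotient[OF module_ring_mult fam fam P.graded_family_ring sub] insert.IH)
        (use insert.prems Suc in simp_all)
  qed
qed

text \<open>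
  With all variables in \<open>U\<close> the quotient of \<open>S\<close> is the residue field.
\<close>

lemma polynomial_ring_koszul:
  assumes "d > int j"
  shows "P.residue_tor_vanishes j d"
proof -
  have "variable_ideal UNIV = positive_part (homogeneous_polys :: nat \<Rightarrow> ('n, 'k) polynomial set)"
  proof (intro ext set_eqI)
    fix e and p :: "('n, 'k) polynomial"
    have pos: "(\<exists>v. lookup m v > 0) \<longleftrightarrow> monomial_degree m > 0" for m :: "'n \<Rightarrow>\<^sub>0 nat"
      by (auto simp: sum_eq_0_iff[symmetric] simp flip: neq0_conv)
    show "p \<in> variable_ideal UNIV e \<longleftrightarrow> p \<in> positive_part homogeneous_polys e"
    proof (cases "e \<le> 0")
      case True
      have "p = 0" if "p \<in> variable_ideal UNIV e"
      proof (rule poly_mapping_eqI)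
        fix m
        have "m \<notin> keys p"
        proof
          assume "m \<in> keys p"
          note m = that[unfolded variable_ideal_iff, rule_format, OF this]
          have "monomial_degree m > 0" using m pos[of m] by blast
          then have "0 < int (monomial_degree m)" by (simp only: of_nat_0_less_iff)
          then show False using conjunct1[OF m] True by linarith
        qed
        then show "lookup p m = lookup 0 m" by (simp add: in_keys_iff)
      qed
      then show ?thesis using True by (auto simp: positive_part_def variable_ideal_iff)
    next
      case False
      then have "positive_part homogeneous_polys e = (int_component homogeneous_polys e :: ('n, 'k) polynomial set)"
        by (simp add: positive_part_def int_component_def)
      moreover have "\<exists>v. lookup m v > 0" if "int (monomial_degree m) = e" for m :: "'n \<Rightarrow>\<^sub>0 nat"
        using pos[of m] that False by simp
      ultimately show ?thesis unfolding variable_ideal_iff by (auto simp: int_component_polys simp del: of_nat_sum)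
    qed
  qed
  then show ?thesis using tor_vanishes_variable_ideal[OF finite assms, of UNIV] by simp
qed

end

section \<open>Regularity and the Backelin rate\<close>

context standard_graded_algebra
begin

lemma ring_positive_multiples:
  assumes "d > 0"
  shows "int_component G d \<subseteq> positive_multiples G (*) (int_component G) d"
proof
  fix x assume x: "x \<in> int_component G d"
  have "x * 1 \<in> positive_multiples G (*) (int_component G) d"
    by (rule positive_multiples_single[of _ _ "nat d"])
      (use x assms one_in_component_0 in \<open>auto simp: int_component_def\<close>)
  then show "x \<in> positive_multiples G (*) (int_component G) d" by simp
qed

lemma finite_span_ring: "\<exists>X. finite X \<and> int_component G d \<subseteq> span X"
proof (cases "d < 0")
  case True
  then show ?thesis by (intro exI[of _ "{}"]) (simp add: int_component_def)
next
  case False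
  then show ?thesis using component_finite_span[of "nat d"] by (simp add: int_component_def)
qed

lemma scalar_action: "(\<lambda>a. (*) (scale a 1)) = scale"
  by (intro ext) (rule scale_eq_mult[symmetric])

lemma finite_dimensional_subfamily:
  assumes "\<And>d. M d \<subseteq> int_component G d"
  shows "finite_dimensional_family (*) M"
  unfolding finite_dimensional_family_def scalar_action
  using finite_span_ring assms by (meson order_trans)

text \<open>
  The definition of \<open>tor\<close> selects a resolution. Once some resolution exists, the selected
  one is a resolution as well, and boundaries form a group containing zero.
\<close>

lemma tor_singleton_iff:
  assumes F: "graded_free_resolution G sc M F" and fam: "graded_family G sc M" and ind: "independent_family M"
  shows "is_singleton (tor G sc M i d) \<longleftrightarrow>
    tor_cycles G (SOME F. graded_free_resolution G sc M F) i d
      \<subseteq> tor_boundaries G (SOME F. graded_free_resolution G sc M F) i d"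
proof -
  let ?F = "SOME F. graded_free_resolution G sc M F"
  have F': "graded_free_resolution G sc M ?F" by (rule someI[of _ F]) (rule F)
  note z = zero_in_tor[OF F' fam ind, of i d]
  note g = tor_boundaries_group[OF F' fam ind]
  show ?thesis
    unfolding tor_def Let_def
    using cosets_singleton_subset[OF _ z] subset_cosets_singleton[of "tor_cycles G ?F i d" "tor_boundaries G ?F i d"] z g
    by blast
qed

lemma t_top_less:
  assumes "t_top G sc M i < ereal (of_int d)"
  shows "is_singleton (tor G sc M i d)"
proof (rule ccontr)
  assume "\<not> is_singleton (tor G sc M i d)"
  then have "ereal (of_int d) \<le> t_top G sc M i"
    unfolding t_top_def by (intro Sup_upper imageI) simp
  then show False using assms by simp
qed

text \<open>
  Here the resolution \<open>F\<close> of the first argument of \<open>Tor(K, K)\<close> also serves as \<open>P\<close>, so that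
  both sides compute the homology of the same complex \<open>F/\<mm>F\<close>.
\<close>

lemma residue_tor_of_resolution:
  assumes F: "graded_free_resolution G residue_module residue_degrees F"
    and P: "residue_resolution scale G (basis F) (bdeg F) (\<lambda>i b. diff F i (single b 1))
      (\<lambda>b. scale (aug F (single b 1)) 1) u"
  shows "tor_cycles G F i d \<subseteq> tor_boundaries G F i d \<longleftrightarrow>
    residue_resolution.tor_vanishes (basis F) (bdeg F) (\<lambda>i b. diff F i (single b 1))
      (*) (int_component G) (positive_part G) i d"
proof -
  interpret P: residue_resolution scale G "basis F" "bdeg F" "\<lambda>i b. diff F i (single b 1)"
    "\<lambda>b. scale (aug F (single b 1)) 1" u by (rule P)
  note tm = diff_eq_tensor_map[OF F residue_family independent_residue, symmetric]
  have I: "x \<in> P.T (int_component G) k d \<Longrightarrow> x \<in> ideal_times_free max_ideal (basis F k) \<longleftrightarrow> x \<in> P.T (positive_part G) k d" for x k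
    by (rule ideal_times_free_iff)
  have deg: "x \<in> P.T (int_component G) (Suc k) d \<Longrightarrow> diff F k x \<in> P.T (int_component G) k d" for x k
    using resolution_degree(2)[OF F residue_family independent_residue, of x k d] by (simp add: res_component_eq)
  have cyc: "z \<in> tor_cycles G F i d \<longleftrightarrow>
      z \<in> P.T (int_component G) i d \<and> (\<forall>k. i = Suc k \<longrightarrow> diff F k z \<in> P.T (positive_part G) k d)" for z
    using I deg by (cases i) (auto simp: tor_cycles_def res_component_eq)
  have bound: "z \<in> tor_boundaries G F i d \<longleftrightarrow>
      (\<exists>y\<in>P.T (int_component G) (Suc i) d. z - diff F i y \<in> P.T (positive_part G) i d)" for z
  proof
    assume "z \<in> tor_boundaries G F i d"
    then obtain y w where "z = diff F i y + w" "y \<in> P.T (int_component G) (Suc i) d" "w \<in> P.T (int_component G) i d"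
      "w \<in> ideal_times_free max_ideal (basis F i)"
      by (auto simp: tor_boundaries_def res_component_eq)
    then show "\<exists>y\<in>P.T (int_component G) (Suc i) d. z - diff F i y \<in> P.T (positive_part G) i d"
      using I by (intro bexI[of _ y]) auto
  next
    assume "\<exists>y\<in>P.T (int_component G) (Suc i) d. z - diff F i y \<in> P.T (positive_part G) i d"
    then obtain y where y: "y \<in> P.T (int_component G) (Suc i) d" "z - diff F i y \<in> P.T (positive_part G) i d" by blast
    have w: "z - diff F i y \<in> P.T (int_component G) i d"
      by (rule tensor_part_mono[OF y(2) positive_part_subset])
    have "z = diff F i y + (z - diff F i y)" by simp
    then show "z \<in> tor_boundaries G F i d"
      using y w I[OF w] unfolding tor_boundaries_def res_component_eq by blast
  qed
  show ?thesis
    unfolding P.tor_vanishes_def subset_iff cyc bound tm by blast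
qed

text \<open>
  For positive \<open>j\<close> the sequence \<open>0 \<rightarrow> \<mm> \<rightarrow> R \<rightarrow> K \<rightarrow> 0\<close> bounds \<open>Tor\<^sub>j(K, K)\<close> by \<open>Tor\<^sub>j\<^sub>-\<^sub>1(\<mm>,
  K)\<close>, and \<open>\<mm>\<close> has a resolution with generators in positive degrees.
\<close>

lemma (in residue_resolution) residue_tor_vanishes_nonpositive:
  assumes "d \<le> 0"
  shows "residue_tor_vanishes (Suc j) d"
proof -
  have ind: "independent_family (positive_part G)"
    by (rule independent_family_mono[OF independent_ring positive_part_subset])
  have "\<exists>F. graded_free_resolution G (*) (positive_part G) F \<and> (\<forall>i. \<forall>b\<in>basis F i. bdeg F i b \<ge> 1)"
    by (rule resolution_exists[OF module_ring_mult graded_family_positive_part ind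
          finite_dimensional_subfamily[OF positive_part_subset]]) (simp add: positive_part_def)
  then obtain F where F: "graded_free_resolution G (*) (positive_part G) F"
    "\<And>i b. b \<in> basis F i \<Longrightarrow> bdeg F i b \<ge> 1" by (elim exE conjE) (simp only: Ball_def)
  have sub: "{0} \<subseteq> positive_part G e" for e
    by (simp add: positive_part_def)
  show ?thesis
    by (rule tor_vanishes_quotient[OF module_ring_mult graded_family_trivial[OF module_ring_mult]
          graded_family_positive_part graded_family_ring sub positive_part_subset tor_vanishes_ring
          tor_vanishes_low_degree[OF F(1) graded_family_positive_part ind F(2)]])
      (use assms in simp_all)
qed

lemma backelin_rate_bounds:
  assumes rate: "backelin_rate scale G = ereal r" and j: "j \<ge> 2"
  shows "t_residue_field scale G j \<le> ereal (1 + (real j - 1) * r)"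
proof (cases "\<forall>i>1. t_residue_field scale G i = - \<infinity>")
  case True
  then show ?thesis using j by simp
next
  case False
  then have "(t_residue_field scale G j - 1) / ereal (real j - 1) \<le> ereal r"
    using rate j unfolding backelin_rate_def by (metis (no_types, lifting) SUP_upper greaterThan_iff less_le_trans one_less_numeral_iff semiring_norm(76))
  moreover have "real j - 1 > 0" using j by simp
  ultimately show ?thesis
    by (cases "t_residue_field scale G j") (auto simp: field_simps one_ereal_def)
qed

lemma chosen_residue_resolution:
  obtains F :: "('r, 'k) free_resolution" and u where
    "residue_resolution scale G (basis F) (bdeg F) (\<lambda>i b. diff F i (single b 1))
      (\<lambda>b. scale (aug F (single b 1)) 1) u"
    "\<And>i d. is_singleton (tor G residue_module residue_degrees i d) \<longleftrightarrow>
      residue_resolution.tor_vanishes (basis F) (bdeg F) (\<lambda>i b. diff F i (single b 1))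
        (*) (int_component G) (positive_part G) i d"
proof -
  define F :: "('r, 'k) free_resolution"
    where "F = (SOME F. graded_free_resolution G residue_module residue_degrees F)"
  obtain F0 where F0: "graded_free_resolution G residue_module residue_degrees F0"
    using resolution_of_residue_field_exists by blast
  then have F: "graded_free_resolution G residue_module residue_degrees F"
    unfolding F_def by (rule someI)
  obtain u where P: "residue_resolution scale G (basis F) (bdeg F) (\<lambda>i b. diff F i (single b 1))
      (\<lambda>b. scale (aug F (single b 1)) 1) u"
    using residue_resolution_of_resolution[OF F] by blast
  show thesis
    by (rule that[OF P, unfolded tor_singleton_iff[OF F0 residue_family independent_residue] F_def[symmetric]])
      (rule residue_tor_of_resolution[OF F P])
qed

text \<open>
  A nonzero \<open>Tor\<^sub>i(K, K)\<close> with \<open>i > 1\<close> lives in degrees at least \<open>1\<close>, so \<open>t\<^sub>i(K) - 1\<close> is not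
  negative.
\<close>

lemma backelin_rate_nonneg: "backelin_rate scale G \<ge> 0"
proof (cases "\<forall>i>1. t_residue_field scale G i = - \<infinity>")
  case True
  then show ?thesis by (simp add: backelin_rate_def)
next
  case False
  then obtain i where i: "i > 1" "t_residue_field scale G i \<noteq> - \<infinity>" by blast
  obtain F :: "('r, 'k) free_resolution" and u where P: "residue_resolution scale G (basis F) (bdeg F) (\<lambda>i b. diff F i (single b 1))
      (\<lambda>b. scale (aug F (single b 1)) 1) u"
    and tor_iff: "\<And>i d. is_singleton (tor G residue_module residue_degrees i d) \<longleftrightarrow>
      residue_resolution.tor_vanishes (basis F) (bdeg F) (\<lambda>i b. diff F i (single b 1))
        (*) (int_component G) (positive_part G) i d"
    by (rule chosen_residue_resolution) blast
  interpret P: residue_resolution scale G "basis F" "bdeg F" "\<lambda>i b. diff F i (single b 1)"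
    "\<lambda>b. scale (aug F (single b 1)) 1" u by (rule P)
  have "{j. \<not> is_singleton (tor G residue_module residue_degrees i j)} \<noteq> {}"
  proof
    assume e: "{j. \<not> is_singleton (tor G residue_module residue_degrees i j)} = {}"
    have "t_residue_field scale G i = - \<infinity>"
      unfolding t_residue_field_def t_top_def e by (simp add: bot_ereal_def)
    then show False using i(2) by simp
  qed
  then obtain d where d: "\<not> is_singleton (tor G residue_module residue_degrees i d)" by blast
  obtain k where k: "i = Suc k" using i(1) by (cases i) auto
  have "\<not> d \<le> 0"
    using d P.residue_tor_vanishes_nonpositive[of d k]
    unfolding tor_iff k by blast
  then have "(1 :: ereal) \<le> ereal (of_int d)" by (simp add: one_ereal_def)
  also have "\<dots> \<le> t_residue_field scale G i"
    unfolding t_residue_field_def t_top_def by (intro Sup_upper imageI) (use d in simp)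
  finally have "0 \<le> t_residue_field scale G i - 1"
    by (cases "t_residue_field scale G i") (auto simp: one_ereal_def)
  then have "0 \<le> (t_residue_field scale G i - 1) / ereal (real i - 1)"
    using i(1) by (intro zero_le_divide_ereal) simp_all
  also have "\<dots> \<le> backelin_rate scale G"
    unfolding backelin_rate_def if_not_P[OF False] by (rule SUP_upper) (use i in simp)
  finally show ?thesis .
qed

text \<open>
  Both claims follow from the same fact, that the cycles of degree above \<open>ic + X\<close> are
  combinations of cycles of lower degree. Stating it with an extended real \<open>X\<close> lets the
  minimum of the two bounds be inserted without distinguishing which of them is finite.
\<close>

context
  fixes bs :: "'r list" and c i :: nat and X :: ereal
  assumes bs: "is_basis_list scale (G c) bs"
    and gen: "\<And>d. ereal (of_int d) > ereal (real (i * c)) + X \<Longrightarrow>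
      koszul_cycles G c bs i d \<subseteq> positive_multiples G fscale (koszul_cycles G c bs i) d"
begin

lemma t_top_cycles_bound: "t_top G fscale (koszul_cycles G c bs i) 0 \<le> ereal (real (i * c)) + X"
proof -
  note fam = graded_family_cycles[OF bs, of i]
  have sub: "koszul_cycles G c bs i d \<subseteq> tensor_part (koszul_index bs i) (\<lambda>_. int (i * c)) (int_component G) d" for d
    unfolding koszul_component_eq[OF bs, symmetric] by (auto simp: koszul_cycles_def)
  have ind: "independent_family (koszul_cycles G c bs i)"
    by (rule independent_family_mono[OF independent_family_tensor_part[OF independent_ring] sub])
  have "finite {A \<in> koszul_index bs i. int (i * c) \<le> d}" for d
    by (rule finite_subset[of _ "Pow {..<length bs}"]) auto
  then have "finite_dimensional_family fscale (tensor_part (koszul_index bs i) (\<lambda>_. int (i * c)) (int_component G))"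
    by (rule finite_dimensional_free)
  then have fd: "finite_dimensional_family fscale (koszul_cycles G c bs i)"
    unfolding finite_dimensional_family_def using sub by (meson order_trans)
  obtain F where F: "graded_free_resolution G fscale (koszul_cycles G c bs i) F"
    using resolution_exists[OF module_fscale fam ind fd cycles_low[OF bs]] by blast
  then have F': "graded_free_resolution G fscale (koszul_cycles G c bs i)
      (SOME F. graded_free_resolution G fscale (koszul_cycles G c bs i) F)"
    by (rule someI)
  show ?thesis
    unfolding t_top_def
  proof (rule Sup_least)
    fix y assume "y \<in> (\<lambda>j. ereal (of_int j)) ` {j. \<not> is_singleton (tor G fscale (koszul_cycles G c bs i) 0 j)}"
    then obtain d where d: "y = ereal (of_int d)" "\<not> is_singleton (tor G fscale (koszul_cycles G c bs i) 0 d)" by blast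
    show "y \<le> ereal (real (i * c)) + X"
    proof (rule ccontr)
      assume "\<not> y \<le> ereal (real (i * c)) + X"
      then have "ereal (real (i * c)) + X < ereal (of_int d)" using d(1) by simp
      from tor_0_generated[OF F' fam ind gen[OF this]] show False
        using d(2) by (simp add: tor_def Let_def)
    qed
  qed
qed

lemma koszul_homology_bound:
  assumes "ereal (of_int j) \<ge> X + ereal (real c)"
  shows "is_singleton (koszul_homology G c bs i (int (i * c) + j))"
proof -
  let ?d = "int (i * c) + j"
  have X: "X \<le> ereal (of_int j - real c)" using assms by (cases X) auto
  have eq: "koszul_cycles G c bs i ?d = koszul_boundaries G c bs i ?d"
  proof (rule homology_vanishes_high_degree[OF bs, where b = "?d - int c"])
    fix e assume e: "?d - int c < e"
    have "ereal (real (i * c)) + X \<le> ereal (real (i * c)) + ereal (of_int j - real c)"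
      by (rule add_left_mono[OF X])
    also have "\<dots> < ereal (of_int e)"
    proof -
      have "real_of_int (?d - int c) < real_of_int e" using e by (simp only: of_int_less_iff)
      then show ?thesis by simp
    qed
    finally show "koszul_cycles G c bs i e \<subseteq> positive_multiples G fscale (koszul_cycles G c bs i) e" by (rule gen)
  qed simp
  note fam = graded_family_boundaries[OF bs, of i]
  show ?thesis
    unfolding koszul_homology_def eq
  proof (rule subset_cosets_singleton)
    show "koszul_boundaries G c bs i ?d \<noteq> {}"
      using graded_family_zero[OF fam, of ?d] by blast
  qed (simp_all only: order_refl graded_family_add[OF fam] graded_family_diff[OF fam])
qed

end

text \<open>
  The case \<open>A = R\<close>. For \<open>i = 0\<close> the bound is \<open>0\<close> even if the rate is infinite, because \<open>0 *
  \<infinity> = 0\<close> for extended reals, so this case is treated separately: \<open>Z\<^sub>0\<close> is \<open>R\<close> itself.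
\<close>

lemma cycles_generated_rate:
  assumes bs: "is_basis_list scale (G c) bs"
    and d: "ereal (of_int d) > ereal (real (i * c)) + ereal (real i) * backelin_rate scale G"
  shows "koszul_cycles G c bs i d \<subseteq> positive_multiples G fscale (koszul_cycles G c bs i) d"
proof (cases "i = 0")
  case True
  then have d0: "d > 0" using d by (simp add: zero_ereal_def[symmetric])
  show ?thesis
  proof
    fix z assume "z \<in> koszul_cycles G c bs i d"
    then have z: "z \<in> tensor_part (koszul_index bs 0) (\<lambda>_. int (0 * c)) (int_component G) d"
      unfolding True koszul_component_eq[OF bs, symmetric] by (simp add: koszul_cycles_def)
    have idx: "koszul_index bs 0 = {{}}" using finite_subset[of _ "{..<length bs}"] by auto
    have one: "single {} 1 \<in> koszul_cycles G c bs i 0"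
      unfolding True cycles_0[OF bs] koszul_component_eq[OF bs] idx
      using one_in_component_0 by (auto simp: tensor_part_def lookup_single when_def int_component_def)
    have "z = fscale (lookup z {}) (single {} 1)"
    proof (rule poly_mapping_eqI)
      fix A show "lookup z A = lookup (fscale (lookup z {}) (single {} 1)) A"
        using tensor_partD(2)[OF z, of A] unfolding idx by (auto simp: lookup_single when_def)
    qed
    moreover have "fscale (lookup z {}) (single {} 1) \<in> positive_multiples G fscale (koszul_cycles G c bs i) d"
    proof (rule positive_multiples_single[of _ _ "nat d"])
      show "lookup z {} \<in> G (nat d)"
        using tensor_partD(1)[OF z, of "{}"] d0 unfolding idx by (simp add: int_component_def)
    qed (use d0 one in simp_all)
    ultimately show "z \<in> positive_multiples G fscale (koszul_cycles G c bs i) d" by simp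
  qed
next
  case False
  obtain r where r: "backelin_rate scale G = ereal r" "r \<ge> 0"
  proof (cases "backelin_rate scale G")
    case PInf
    then show ?thesis using d False by simp
  qed (use backelin_rate_nonneg that in auto)
  obtain F :: "('r, 'k) free_resolution" and u where P: "residue_resolution scale G (basis F) (bdeg F) (\<lambda>i b. diff F i (single b 1))
      (\<lambda>b. scale (aug F (single b 1)) 1) u"
    and tor_iff: "\<And>i d. is_singleton (tor G residue_module residue_degrees i d) \<longleftrightarrow>
      residue_resolution.tor_vanishes (basis F) (bdeg F) (\<lambda>i b. diff F i (single b 1))
        (*) (int_component G) (positive_part G) i d"
    by (rule chosen_residue_resolution) blast
  interpret P: residue_resolution scale G "basis F" "bdeg F" "\<lambda>i b. diff F i (single b 1)"
    "\<lambda>b. scale (aug F (single b 1)) 1" u by (rule P)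
  have tor_ring: "P.tor_vanishes (\<lambda>p x. p * x) (int_component G) (\<lambda>d. {0}) j e" if "real_of_int e > 0 + real j * r" for j e
  proof (cases j)
    case 0
    then have "e > 0" using that by simp
    then show ?thesis unfolding 0
      using ring_positive_multiples[of e]
      by (intro P.tor_vanishes_0I[OF module_ring_mult graded_family_ring graded_family_trivial[OF module_ring_mult]]) auto
  qed (simp add: P.tor_vanishes_ring)
  have tor_residue: "P.residue_tor_vanishes j e" if "j \<ge> 2" "real_of_int e > 1 + (real j - 1) * r" for j e
  proof -
    have "t_residue_field scale G j \<le> ereal (1 + (real j - 1) * r)" by (rule backelin_rate_bounds[OF r(1) that(1)])
    also have "\<dots> < ereal (of_int e)" using that(2) by simp
    finally have "is_singleton (tor G residue_module residue_degrees j e)"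
      unfolding t_residue_field_def by (rule t_top_less)
    then show ?thesis unfolding tor_iff .
  qed
  have "real (i * c) + real i * r < real_of_int d" using d r(1) by simp
  then have "\<lfloor>real (i * c) + real i * r\<rfloor> < d" by (simp only: floor_less_iff)
  then show ?thesis
  proof (rule P.cycles_generated[where \<phi> = "\<lambda>x. x" and \<rho> = 0, OF standard_graded_algebra_axioms _ _ _ _ bs r(2) tor_ring tor_residue, rotated -1])
    fix e :: int assume "real (i * c) + real i * r < real_of_int e"
    then show "P.tor_vanishes fscale (koszul_cycles G c bs i) (\<lambda>d. {0}) 0 e"
      by (intro P.koszul_cycles_tor[where \<phi> = "\<lambda>x. x" and \<rho> = 0 and r = r, OF standard_graded_algebra_axioms _ _ _ _ bs r(2) tor_ring tor_residue])
        simp_all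
  qed simp_all
qed

text \<open>
  The case \<open>A = S\<close>. The regularity is nonnegative because \<open>Tor\<^sub>0(R, K)\<close> is nonzero in degree
  \<open>0\<close>, as \<open>1 \<noteq> 0\<close> in \<open>R\<close>; so it is a real number unless it is infinite, when nothing is
  claimed.
\<close>

lemma cycles_generated_regularity:
  fixes \<phi> :: "(('n::finite \<Rightarrow>\<^sub>0 nat) \<Rightarrow>\<^sub>0 'k) \<Rightarrow> 'r"
  assumes pres: "graded_presentation scale G \<phi>"
    and bs: "is_basis_list scale (G c) bs"
    and d: "ereal (of_int d) > ereal (real (i * c)) + (ereal (real i) + cm_regularity G \<phi>)"
  shows "koszul_cycles G c bs i d \<subseteq> positive_multiples G fscale (koszul_cycles G c bs i) d"
proof -
  let ?S = "homogeneous_polys :: nat \<Rightarrow> (('n \<Rightarrow>\<^sub>0 nat) \<Rightarrow>\<^sub>0 'k) set"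
  let ?sc = "\<lambda>p x. \<phi> p * x"
  interpret S: standard_graded_algebra "fscale :: 'k \<Rightarrow> _" ?S by (rule polynomial_ring_standard_graded)
  interpret h: module_hom fscale scale \<phi> using pres by (simp add: graded_presentation_def)
  have \<phi>: "\<phi> (x + y) = \<phi> x + \<phi> y" "\<phi> (x * y) = \<phi> x * \<phi> y" "\<phi> 1 = 1" "p \<in> ?S n \<Longrightarrow> \<phi> p \<in> G n" for x y p n
    using pres h.add by (auto simp: graded_presentation_def image_subset_iff)
  have sc: "module ?sc" by (rule module_restrict[OF module_ring_mult \<phi>(1-3)])
  have fam: "graded_family ?S ?sc (int_component G)" by (rule graded_family_restrict[OF graded_family_ring \<phi>(4)])
  have act: "(\<lambda>a. ?sc (fscale a 1)) = scale"
    by (intro ext) (simp add: h.scale \<phi>(3) scale_eq_mult[symmetric])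
  have "S.finite_dimensional_family ?sc (int_component G)"
    unfolding S.finite_dimensional_family_def act by (intro allI finite_span_ring)
  from S.resolution_exists[OF sc fam independent_ring this, of 0]
  obtain F0 where F0: "graded_free_resolution ?S ?sc (int_component G) F0" by (auto simp: int_component_def)
  define F where "F = (SOME F. graded_free_resolution ?S ?sc (int_component G) F)"
  have F: "graded_free_resolution ?S ?sc (int_component G) F" unfolding F_def by (rule someI[of _ F0]) (rule F0)
  obtain E where E: "graded_free_resolution ?S S.residue_module S.residue_degrees E"
    using S.resolution_of_residue_field_exists by blast
  obtain u where P: "residue_resolution (fscale :: 'k \<Rightarrow> _) ?S (basis E) (bdeg E) (\<lambda>i b. diff E i (single b 1))
      (\<lambda>b. fscale (aug E (single b 1)) 1) u"
    using S.residue_resolution_of_resolution[OF E] by blast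
  interpret P: residue_resolution "fscale :: 'k \<Rightarrow> _" ?S "basis E" "bdeg E" "\<lambda>i b. diff E i (single b 1)"
    "\<lambda>b. fscale (aug E (single b 1)) 1" u by (rule P)
  have vanish: "P.tor_vanishes ?sc (int_component G) (\<lambda>d. {0}) j e"
    if "is_singleton (tor ?S ?sc (int_component G) j e)" for j e
  proof -
    have "tor_cycles ?S F j e \<subseteq> tor_boundaries ?S F j e"
      using that unfolding S.tor_singleton_iff[OF F0 fam independent_ring] F_def .
    then show ?thesis by (rule P.tor_vanishes_balance[OF F fam independent_ring])
  qed
  have t_le: "t_top ?S ?sc (int_component G) j - ereal (real j) \<le> cm_regularity G \<phi>" for j
    unfolding cm_regularity_def by (rule SUP_upper) simp
  have "\<not> is_singleton (tor ?S ?sc (int_component G) 0 0)"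
  proof
    assume "is_singleton (tor ?S ?sc (int_component G) 0 0)"
    from P.tor_vanishes_0D[OF sc fam graded_family_trivial[OF sc] vanish[OF this], of 1]
    have "1 \<in> positive_multiples ?S ?sc (int_component G) 0"
      using one_in_component_0 by (simp add: int_component_def)
    moreover have "x = 0" if "x \<in> positive_multiples ?S ?sc (int_component G) 0" for x
      using that by induction (auto simp: int_component_def)
    ultimately show False by fastforce
  qed
  then have "ereal (of_int 0) \<le> t_top ?S ?sc (int_component G) 0"
    unfolding t_top_def by (intro Sup_upper imageI) simp
  also have "\<dots> \<le> cm_regularity G \<phi>" using t_le[of 0] by (simp add: zero_ereal_def[symmetric])
  finally have reg0: "cm_regularity G \<phi> \<ge> 0" by (simp add: zero_ereal_def)
  obtain \<rho> where \<rho>: "cm_regularity G \<phi> = ereal \<rho>"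
  proof (cases "cm_regularity G \<phi>")
    case PInf
    then show ?thesis using d by simp
  qed (use reg0 that in auto)
  have tor_ring: "P.tor_vanishes ?sc (int_component G) (\<lambda>d. {0}) j e" if "real_of_int e > \<rho> + real j * 1" for j e
  proof (rule vanish, rule S.t_top_less)
    have "t_top ?S ?sc (int_component G) j \<le> ereal (\<rho> + real j)"
      using t_le[of j] unfolding \<rho> by (cases "t_top ?S ?sc (int_component G) j") auto
    also have "\<dots> < ereal (of_int e)" using that by simp
    finally show "t_top ?S ?sc (int_component G) j < ereal (of_int e)" .
  qed
  have tor_residue: "P.residue_tor_vanishes j e" if "j \<ge> 2" "real_of_int e > 1 + (real j - 1) * 1" for j e
    by (rule polynomial_ring_koszul[OF P]) (use that in simp)
  have "\<rho> + real (i * c) + real i < real_of_int d" using d \<rho> by (simp add: algebra_simps)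
  then have "\<lfloor>\<rho> + real (i * c) + real i\<rfloor> < d" by (simp only: floor_less_iff)
  then show ?thesis
  proof (rule P.cycles_generated[where \<phi> = \<phi> and \<rho> = \<rho> and r = 1, OF standard_graded_algebra_axioms \<phi> bs _ tor_ring tor_residue, rotated -1])
    fix e :: int assume "\<rho> + real (i * c) + real i < real_of_int e"
    then show "P.tor_vanishes (\<lambda>p. fscale (\<phi> p)) (koszul_cycles G c bs i) (\<lambda>d. {0}) 0 e"
      by (intro P.koszul_cycles_tor[where \<phi> = \<phi> and \<rho> = \<rho> and r = 1, OF standard_graded_algebra_axioms \<phi> bs _ tor_ring tor_residue])
        simp_all
  qed simp_all
qed

end

theorem corollary2p5:
  fixes scale :: "'k::field \<Rightarrow> 'r::comm_ring_1 \<Rightarrow> 'r"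
    and G :: "nat \<Rightarrow> 'r set"
    and \<phi> :: "(('n::finite \<Rightarrow>\<^sub>0 nat) \<Rightarrow>\<^sub>0 'k) \<Rightarrow> 'r"
    and c i :: nat
    and bs :: "'r list"
  assumes "standard_graded_algebra scale G"
    and "graded_presentation scale G \<phi>"
    and "c \<ge> 1"
    and "is_basis_list scale (G c) bs"
  shows "t_top G fscale (koszul_cycles G c bs i) 0
           \<le> ereal (real (i * c))
             + min (ereal (real i) * backelin_rate scale G) (ereal (real i) + cm_regularity G \<phi>)
         \<and> (\<forall>j::int. ereal (of_int j)
               \<ge> min (ereal (real i) * backelin_rate scale G) (ereal (real i) + cm_regularity G \<phi>)
                 + ereal (real c)
             \<longrightarrow> is_singleton (koszul_homology G c bs i (int (i * c) + j)))"
proof -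
  interpret R: standard_graded_algebra scale G by (rule assms(1))
  let ?X = "min (ereal (real i) * backelin_rate scale G) (ereal (real i) + cm_regularity G \<phi>)"
  have gen: "koszul_cycles G c bs i d \<subseteq> positive_multiples G fscale (koszul_cycles G c bs i) d"
    if "ereal (of_int d) > ereal (real (i * c)) + ?X" for d
    using that R.cycles_generated_rate[OF assms(4), of i d]
      R.cycles_generated_regularity[OF assms(2,4), of i d]
    by (cases "ereal (real i) * backelin_rate scale G \<le> ereal (real i) + cm_regularity G \<phi>")
      (simp_all add: min_def)
  show ?thesis
    using R.t_top_cycles_bound[OF assms(4) gen] R.koszul_homology_bound[OF assms(4) gen] by blast
qed

end
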